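(* Let $(G,E)$ be a countable pseudo-free self-similar directed graph. Consider the corresponding Exel–Pardo groupoid $\mathcal G:=\mathcal G_{G,E}$ with its standard grading $\Phi\colon\mathcal G\to\mathbb Z$. Then $\mathcal G$ has essentially central isotropy if and only if the following conditions are satisfied: (i) if $v\in\mathcal{BV}(G,E)\cup E^{\mathrm{sing}}_0(G)$, then the stabilizer of $v$ in $G$ is trivial; (ii) if $L\in\mathcal L(G,E)$ and $(g,\gamma)$ is a $G$-circuit with vertices in $L$ and no entry in $L$, then the stabilizer of $r(\gamma)$ in $G$ is trivial; (iii) if $M\in\mathcal M_\infty(G,E)$ and $v\in M$, then there are no elements $g\ne1_G$ that act trivially on $vE^*M$.
   Context: Graphs. $E$ is a directed graph with vertex set $E^0$, edge set $E^1$ and maps $r,s\colon E^1\to E^0$. $E^*$ is the set of finite paths: vertices (length $0$) and words $e_1\cdots e_n$ of edges with $s(e_i)=r(e_{i+1})$, with $r(e_1\cdots e_n)=r(e_1)$, $s(e_1\cdots e_n)=s(e_n)$; $|\alpha|$ is the length. $E^\infty$ is the set of infinite paths. For sets of paths, $AB$ is the set of concatenations; $vE^1M=\{e\in E^1:r(e)=v,\ s(e)\in M\}$, $vE^*M=\{\alpha\in E^*:r(\alpha)=v,\ s(\alpha)\in M\}$. $E^{\mathrm{sing}}=\{v:|vE^1|\in\{0,\infty\}\}$; other vertices are regular. $\partial E=E^\infty\cup\{\alpha\in E^*:s(\alpha)\in E^{\mathrm{sing}}\}$, with basis of topology $Z_F(\alpha)=Z(\alpha)\setminus\bigcup_{\beta\in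 F}Z(\alpha\beta)$, $\alpha\in E^*$, $F\subset s(\alpha)E^*$ finite, where $Z(\alpha)$ is the set of boundary paths with initial segment $\alpha$. $\sigma$ removes the first edge. Self-similarity. $(G,E)$ is a self-similar graph if the discrete group $G$ acts on the set $E^*$ preserving length and commuting with $r$ and $s$, and we are given $G\times E^*\to G$, $(g,\mu)\mapsto g|_\mu$, with: $g\cdot(\mu\nu)=(g\cdot\mu)(g|_\mu\cdot\nu)$ and $g|_{\mu\nu}=(g|_\mu)|_\nu$ when $s(\mu)=r(\nu)$; $(gh)|_\mu=g|_{h\cdot\mu}h|_\mu$; $g|_v=g$ for $v\in E^0$. It is pseudo-free if $g\cdot\mu=\mu$, $g|_\mu=1_G$ imply $g=1_G$; countable if $G,E^0,E^1$ are countable. $G$ acts on $\partial E$ so that the initial segment of $g\cdot x$ of length $n$ is $g\cdot(x_1\cdots x_n)$. Groupoid. $Q(G)$ is the group of sequences $\mathbb Z_+\to G$ modulo equality for all sufficiently large $n$; for $m\in\mathbb Z$, $\mathcal T_m$ is the automorphism of $Q(G)$ induced by $\mathcal T_m(f)(n)=f(n-m)$ if $n\ge m$, and $1_G$ otherwise. $[g|_x]\in Q(G)$ is the class of $n\mapsto g|_{x(0,\min(n,|x|))}$, $x(0,j)$ being the initial segment of $x$ of length $j$. $\mathcal G_{G,E}$ is the set of quadruples $(\mu(g\cdot x),\mathcal T_{|\mu|}([g|_x]),|\mu|-|\nu|,\nu x)$, $x\in\partial E$, $g\in G$, $\mu,\nu\in E^*$, $s(\nu)=r(x)$, $s(\mu)=g\cdot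 r(x)$, with product $(x,q,m,y)(y,q',n,z)=(x,q\mathcal T_m(q'),m+n,z)$, unit space $\partial E$, and basis of topology given by the sets of such quadruples with fixed $\mu,g,\nu$ and $x$ ranging over $Z_F(s(\nu))$, $F\subset s(\nu)E^*$ finite. In the pseudo-free case it is a Hausdorff locally compact étale groupoid. $\Phi(y,q,n,z)=n$. $[x]_{\mathcal G}$ denotes the orbit of $x$. Essentially central isotropy: for every $x\in\mathcal G^{(0)}$, $\Phi$ is injective on $\operatorname{Iso}(\mathcal G_{\overline{[x]}})^\circ_x$, the fiber at $x$ of the interior, relative to the reduced groupoid $\mathcal G_{\overline{[x]}}=\{g:r(g)\in\overline{[x]}\}$, of the isotropy bundle $\operatorname{Iso}(\mathcal G_{\overline{[x]}})=\bigcup_y\mathcal G^y_y$ ($y\in\overline{[x]}$), and the image is in the center of the grading group (automatic for $\mathbb Z$). Tails. $v\ge w$ means $vE^*w\ne\emptyset$; $v\sim w$ means $v\ge w\ge v$. A maximal $G$-tail is a nonempty $G$-invariant $M\subset E^0$ such that: if $v\ge w$ and $w\in M$ then $v\in M$; if $v\in M$ is regular then $vE^1M\ne\emptyset$; for all $v,w\in M$ there are $g\in G$, $u\in M$ with $v\ge u$, $w\ge g\cdot u$. $\mathcal M(G,E)$ is the set of these. $v\in M$ is minimal if every $w\in M$ with $w\le v$ satisfies $w\sim v$. $\mathrm M_G(x)=\{r(y):y\in[x]_{\mathcal G}\}$ is a maximal $G$-tail. $A_{G,E}$ is the set of $x\in\partial E$ such that $\sigma^n(x)=g\cdot\sigma^m(x)$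 with $g\in G$, $n,m\in\mathbb Z_+$ implies $n=m$. A path $x=x_1x_2\cdots\in E^\infty$ with vertices in $M$ has no entry in $M$ if $r(x_n)E^1M=\{x_n\}$ for all $n$. $\mathcal L(G,E)$ is the set of $M\in\mathcal M(G,E)$ for which there is a path in $E^\infty\setminus A_{G,E}$ with vertices in $M$ and no entry in $M$; $\mathcal M_\gamma(G,E)=\mathcal M(G,E)\setminus\mathcal L(G,E)$; $\mathcal M_0(G,E)$ is the set of $M\in\mathcal M(G,E)$ containing a minimal element $v$ with $vE^1M=\emptyset$; $\mathcal M_\infty(G,E)=\mathcal M_\gamma(G,E)\setminus\mathcal M_0(G,E)$. A $G$-circuit is a pair $(g,\gamma)$, $g\in G$, $\gamma\in E^*$, $|\gamma|>0$, $s(\gamma)=g\cdot r(\gamma)$; if its vertices lie in $M$, it has no entry in $M$ if $|vE^1M|=1$ for every vertex $v$ of $\gamma$. $\mathcal{BV}(G,E)$ is the set of $v\in E^{\mathrm{sing}}$ with $0<|vE^1\mathrm M_G(v)|<\infty$ ($G$-breaking vertices), and $E^{\mathrm{sing}}_0(G)=\{v\in E^{\mathrm{sing}}:vE^1\mathrm M_G(v)=\emptyset\}$; for $v\in E^{\mathrm{sing}}$ one has $vE^1\mathrm M_G(v)=\{e\in E^1:r(e)=v,\ s(e)\ge g\cdot v\text{ for some }g\in G\}$. *)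

theory Defs
  imports "HOL-Analysis.Analysis" "HOL-Algebra.Algebra" "HOL-Library.Extended_Nat"
    "Graph_Theory.Digraph"
begin

section \<open>Essentially central isotropy of graded topological groupoids\<close>

text \<open>
  Units and arrows are kept in separate types; \<open>idt\<close> is the identification of a unit
  with the corresponding identity arrow. The value of \<open>gcomp\<close> is relevant only on
  composable pairs.
\<close>

record ('u, 'a) top_groupoid =
  units :: "'u set"
  units_top :: "'u topology"
  arrows :: "'a set"
  arrows_top :: "'a topology"
  rg :: "'a \<Rightarrow> 'u"
  sr :: "'a \<Rightarrow> 'u"
  idt :: "'u \<Rightarrow> 'a"
  gcomp :: "'a \<Rightarrow> 'a \<Rightarrow> 'a"

definition gpd_orbit :: "('u, 'a) top_groupoid \<Rightarrow> 'u \<Rightarrow> 'u set" where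
  "gpd_orbit \<G> x = {rg \<G> a | a. a \<in> arrows \<G> \<and> sr \<G> a = x}"

definition gpd_reduction :: "('u, 'a) top_groupoid \<Rightarrow> 'u set \<Rightarrow> 'a set" where
  "gpd_reduction \<G> C = {a \<in> arrows \<G>. rg \<G> a \<in> C}"

definition iso_bundle :: "('u, 'a) top_groupoid \<Rightarrow> 'u set \<Rightarrow> 'a set" where
  "iso_bundle \<G> C = {a \<in> gpd_reduction \<G> C. rg \<G> a = sr \<G> a}"

definition iso_interior_fiber :: "('u, 'a) top_groupoid \<Rightarrow> 'u set \<Rightarrow> 'u \<Rightarrow> 'a set" where
  "iso_interior_fiber \<G> C x =
     {a \<in> subtopology (arrows_top \<G>) (gpd_reduction \<G> C) interior_of iso_bundle \<G> C.
        rg \<G> a = x}"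

definition group_center :: "('c, 'd) monoid_scheme \<Rightarrow> 'c set" where
  "group_center \<Gamma> = {z \<in> carrier \<Gamma>. \<forall>h \<in> carrier \<Gamma>. z \<otimes>\<^bsub>\<Gamma>\<^esub> h = h \<otimes>\<^bsub>\<Gamma>\<^esub> z}"

definition essentially_central_isotropy ::
    "('c, 'd) monoid_scheme \<Rightarrow> ('u, 'a) top_groupoid \<Rightarrow> ('a \<Rightarrow> 'c) \<Rightarrow> bool" where
  "essentially_central_isotropy \<Gamma> \<G> \<Phi> \<longleftrightarrow>
     (\<forall>x \<in> units \<G>.
        let A = iso_interior_fiber \<G> (units_top \<G> closure_of gpd_orbit \<G> x) x
        in inj_on \<Phi> A \<and> \<Phi> ` A \<subseteq> group_center \<Gamma>)"


section \<open>Paths\<close>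

text \<open>
  The range and source maps of a graph are its \<open>head\<close> and \<open>tail\<close>. A finite path is stored as
  a pair of its range and its list of edges, so that the vertex \<open>v\<close> is the path \<open>(v, [])\<close>.
  Consecutive edges \<open>e\<close>, \<open>f\<close> of a path satisfy \<open>tail E e = head E f\<close>, which is opposite to
  the convention for walks in \<open>Graph_Theory\<close>.
\<close>

type_synonym ('v, 'e) path = "'v \<times> 'e list"

definition vtx :: "'v \<Rightarrow> ('v, 'e) path" where
  "vtx v = (v, [])"

definition prng :: "('v, 'e) path \<Rightarrow> 'v" where
  "prng \<mu> = fst \<mu>"

definition psrc :: "('v, 'e) pre_digraph \<Rightarrow> ('v, 'e) path \<Rightarrow> 'v" where
  "psrc E \<mu> = (if snd \<mu> = [] then fst \<mu> else tail E (last (snd \<mu>)))"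

definition plen :: "('v, 'e) path \<Rightarrow> nat" where
  "plen \<mu> = length (snd \<mu>)"

definition fpaths :: "('v, 'e) pre_digraph \<Rightarrow> ('v, 'e) path set" where
  "fpaths E = {(v, es). v \<in> verts E \<and> set es \<subseteq> arcs E \<and> (es \<noteq> [] \<longrightarrow> head E (hd es) = v) \<and>
     (\<forall>i. Suc i < length es \<longrightarrow> tail E (es ! i) = head E (es ! Suc i))}"

definition pcat :: "('v, 'e) path \<Rightarrow> ('v, 'e) path \<Rightarrow> ('v, 'e) path" where
  "pcat \<mu> \<nu> = (fst \<mu>, snd \<mu> @ snd \<nu>)"

definition paths_from :: "('v, 'e) pre_digraph \<Rightarrow> 'v \<Rightarrow> 'v set \<Rightarrow> ('v, 'e) path set" where
  "paths_from E v M = {\<mu> \<in> fpaths E. prng \<mu> = v \<and> psrc E \<mu> \<in> M}"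

definition edges_from :: "('v, 'e) pre_digraph \<Rightarrow> 'v \<Rightarrow> 'v set \<Rightarrow> 'e set" where
  "edges_from E v M = {e \<in> arcs E. head E e = v \<and> tail E e \<in> M}"

definition singular :: "('v, 'e) pre_digraph \<Rightarrow> 'v set" where
  "singular E = {v \<in> verts E.
     edges_from E v (verts E) = {} \<or> infinite (edges_from E v (verts E))}"

definition path_vertices :: "('v, 'e) pre_digraph \<Rightarrow> ('v, 'e) path \<Rightarrow> 'v set" where
  "path_vertices E \<mu> = insert (prng \<mu>) (head E ` set (snd \<mu>) \<union> tail E ` set (snd \<mu>))"


section \<open>The boundary path space\<close>

datatype ('v, 'e) bpath = FinP "('v, 'e) path" | InfP "nat \<Rightarrow> 'e"

definition inf_paths :: "('v, 'e) pre_digraph \<Rightarrow> (nat \<Rightarrow> 'e) set" where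
  "inf_paths E = {x. \<forall>n. x n \<in> arcs E \<and> tail E (x n) = head E (x (Suc n))}"

definition boundary :: "('v, 'e) pre_digraph \<Rightarrow> ('v, 'e) bpath set" where
  "boundary E = InfP ` inf_paths E \<union> FinP ` {\<alpha> \<in> fpaths E. psrc E \<alpha> \<in> singular E}"

fun brng :: "('v, 'e) pre_digraph \<Rightarrow> ('v, 'e) bpath \<Rightarrow> 'v" where
  "brng E (FinP \<alpha>) = prng \<alpha>"
| "brng E (InfP x) = head E (x 0)"

fun blen :: "('v, 'e) bpath \<Rightarrow> enat" where
  "blen (FinP \<alpha>) = enat (plen \<alpha>)"
| "blen (InfP x) = \<infinity>"

text \<open>The initial segment of length \<open>min n |x|\<close>.\<close>

fun bseg :: "('v, 'e) pre_digraph \<Rightarrow> ('v, 'e) bpath \<Rightarrow> nat \<Rightarrow> ('v, 'e) path" where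
  "bseg E (FinP \<alpha>) n = (fst \<alpha>, take n (snd \<alpha>))"
| "bseg E (InfP x) n = (head E (x 0), map x [0..<n])"

fun bcat :: "('v, 'e) path \<Rightarrow> ('v, 'e) bpath \<Rightarrow> ('v, 'e) bpath" where
  "bcat \<mu> (FinP \<alpha>) = FinP (pcat \<mu> \<alpha>)"
| "bcat \<mu> (InfP x) = InfP (\<lambda>n. if n < plen \<mu> then snd \<mu> ! n else x (n - plen \<mu>))"

text \<open>The shift; its value at a path of length 0 is a dummy.\<close>

fun bshift :: "('v, 'e) pre_digraph \<Rightarrow> ('v, 'e) bpath \<Rightarrow> ('v, 'e) bpath" where
  "bshift E (FinP (v, [])) = FinP (v, [])"
| "bshift E (FinP (v, e # es)) = FinP (tail E e, es)"
| "bshift E (InfP x) = InfP (\<lambda>n. x (Suc n))"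

definition cyl :: "('v, 'e) pre_digraph \<Rightarrow> ('v, 'e) path \<Rightarrow> ('v, 'e) bpath set" where
  "cyl E \<alpha> = {x \<in> boundary E. bseg E x (plen \<alpha>) = \<alpha>}"

definition cyl_minus ::
    "('v, 'e) pre_digraph \<Rightarrow> ('v, 'e) path set \<Rightarrow> ('v, 'e) path \<Rightarrow> ('v, 'e) bpath set" where
  "cyl_minus E F \<alpha> = cyl E \<alpha> - (\<Union>\<beta>\<in>F. cyl E (pcat \<alpha> \<beta>))"

definition boundary_top :: "('v, 'e) pre_digraph \<Rightarrow> ('v, 'e) bpath topology" where
  "boundary_top E = topology_generated_by
     {cyl_minus E F \<alpha> | F \<alpha>. \<alpha> \<in> fpaths E \<and> finite F \<and> F \<subseteq> paths_from E (psrc E \<alpha>) (verts E)}"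


section \<open>Self-similar graphs\<close>

text \<open>
  \<open>act\<close> is the action on finite paths and \<open>res g \<mu>\<close> is the restriction of \<open>g\<close> to \<open>\<mu>\<close>.
  \<open>vact\<close> is the action on vertices, that is, on paths of length 0.
\<close>

definition vact :: "('g \<Rightarrow> ('v, 'e) path \<Rightarrow> ('v, 'e) path) \<Rightarrow> 'g \<Rightarrow> 'v \<Rightarrow> 'v" where
  "vact act g v = prng (act g (vtx v))"

text \<open>
  Since \<open>pcat\<close> is defined for arbitrary pairs, the requirement implicit in the formula for
  \<open>act g (pcat \<mu> \<nu>)\<close>, that its right hand side is a product of composable paths, is
  stated separately (\<open>act_composable\<close>). It is not redundant if \<open>\<nu>\<close> is a vertex.
\<close>

locale self_similar_graph =
  gph: wf_digraph E + act: group_action G "fpaths E" act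
  for G :: "('g, 'm) monoid_scheme"
    and E :: "('v, 'e) pre_digraph"
    and act :: "'g \<Rightarrow> ('v, 'e) path \<Rightarrow> ('v, 'e) path" +
  fixes res :: "'g \<Rightarrow> ('v, 'e) path \<Rightarrow> 'g"
  assumes plen_act: "\<lbrakk>g \<in> carrier G; \<mu> \<in> fpaths E\<rbrakk> \<Longrightarrow> plen (act g \<mu>) = plen \<mu>"
    and prng_act: "\<lbrakk>g \<in> carrier G; \<mu> \<in> fpaths E\<rbrakk> \<Longrightarrow> prng (act g \<mu>) = vact act g (prng \<mu>)"
    and psrc_act: "\<lbrakk>g \<in> carrier G; \<mu> \<in> fpaths E\<rbrakk> \<Longrightarrow> psrc E (act g \<mu>) = vact act g (psrc E \<mu>)"
    and res_closed: "\<lbrakk>g \<in> carrier G; \<mu> \<in> fpaths E\<rbrakk> \<Longrightarrow> res g \<mu> \<in> carrier G"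
    and act_composable:
      "\<lbrakk>g \<in> carrier G; \<mu> \<in> fpaths E; \<nu> \<in> fpaths E; psrc E \<mu> = prng \<nu>\<rbrakk>
         \<Longrightarrow> psrc E (act g \<mu>) = prng (act (res g \<mu>) \<nu>)"
    and act_pcat:
      "\<lbrakk>g \<in> carrier G; \<mu> \<in> fpaths E; \<nu> \<in> fpaths E; psrc E \<mu> = prng \<nu>\<rbrakk>
         \<Longrightarrow> act g (pcat \<mu> \<nu>) = pcat (act g \<mu>) (act (res g \<mu>) \<nu>)"
    and res_pcat:
      "\<lbrakk>g \<in> carrier G; \<mu> \<in> fpaths E; \<nu> \<in> fpaths E; psrc E \<mu> = prng \<nu>\<rbrakk>
         \<Longrightarrow> res g (pcat \<mu> \<nu>) = res (res g \<mu>) \<nu>"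
    and res_mult:
      "\<lbrakk>g \<in> carrier G; h \<in> carrier G; \<mu> \<in> fpaths E\<rbrakk>
         \<Longrightarrow> res (g \<otimes>\<^bsub>G\<^esub> h) \<mu> = res g (act h \<mu>) \<otimes>\<^bsub>G\<^esub> res h \<mu>"
    and res_vtx: "\<lbrakk>g \<in> carrier G; v \<in> verts E\<rbrakk> \<Longrightarrow> res g (vtx v) = g"

definition pseudo_free where
  "pseudo_free G E act res \<longleftrightarrow>
     (\<forall>g \<in> carrier G. \<forall>\<mu> \<in> fpaths E. act g \<mu> = \<mu> \<and> res g \<mu> = \<one>\<^bsub>G\<^esub> \<longrightarrow> g = \<one>\<^bsub>G\<^esub>)"

definition countable_ssg :: "('g, 'm) monoid_scheme \<Rightarrow> ('v, 'e) pre_digraph \<Rightarrow> bool" where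
  "countable_ssg G E \<longleftrightarrow> countable (carrier G) \<and> countable (verts E) \<and> countable (arcs E)"

fun bact :: "('v, 'e) pre_digraph \<Rightarrow> ('g \<Rightarrow> ('v, 'e) path \<Rightarrow> ('v, 'e) path) \<Rightarrow>
    'g \<Rightarrow> ('v, 'e) bpath \<Rightarrow> ('v, 'e) bpath" where
  "bact E act g (FinP \<alpha>) = FinP (act g \<alpha>)"
| "bact E act g (InfP x) = InfP (\<lambda>n. snd (act g (bseg E (InfP x) (Suc n))) ! n)"


section \<open>The Exel-Pardo groupoid\<close>

definition seq_eq :: "('g, 'm) monoid_scheme \<Rightarrow> ((nat \<Rightarrow> 'g) \<times> (nat \<Rightarrow> 'g)) set" where
  "seq_eq G = {(f, f'). f \<in> UNIV \<rightarrow> carrier G \<and> f' \<in> UNIV \<rightarrow> carrier G \<and>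
     (\<forall>\<^sub>F n in sequentially. f n = f' n)}"

definition seq_class :: "('g, 'm) monoid_scheme \<Rightarrow> (nat \<Rightarrow> 'g) \<Rightarrow> (nat \<Rightarrow> 'g) set" where
  "seq_class G f = seq_eq G `` {f}"

definition seq_quot :: "('g, 'm) monoid_scheme \<Rightarrow> (nat \<Rightarrow> 'g) set monoid" where
  "seq_quot G =
     \<lparr>carrier = (UNIV \<rightarrow> carrier G) // seq_eq G,
      monoid.mult = (\<lambda>p q. \<Union>f\<in>p. \<Union>h\<in>q. seq_class G (\<lambda>n. f n \<otimes>\<^bsub>G\<^esub> h n)),
      one = seq_class G (\<lambda>n. \<one>\<^bsub>G\<^esub>)\<rparr>"

definition seq_shift :: "('g, 'm) monoid_scheme \<Rightarrow> int \<Rightarrow> (nat \<Rightarrow> 'g) set \<Rightarrow> (nat \<Rightarrow> 'g) set" where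
  "seq_shift G m q =
     (\<Union>f\<in>q. seq_class G (\<lambda>n. if int n \<ge> m then f (nat (int n - m)) else \<one>\<^bsub>G\<^esub>))"

definition res_class ::
    "('g, 'm) monoid_scheme \<Rightarrow> ('v, 'e) pre_digraph \<Rightarrow> ('g \<Rightarrow> ('v, 'e) path \<Rightarrow> 'g) \<Rightarrow>
     'g \<Rightarrow> ('v, 'e) bpath \<Rightarrow> (nat \<Rightarrow> 'g) set" where
  "res_class G E res g x = seq_class G (\<lambda>n. res g (bseg E x n))"

type_synonym ('g, 'v, 'e) ep_arrow =
  "('v, 'e) bpath \<times> (nat \<Rightarrow> 'g) set \<times> int \<times> ('v, 'e) bpath"

definition ep_elem ::
    "('g, 'm) monoid_scheme \<Rightarrow> ('v, 'e) pre_digraph \<Rightarrow> ('g \<Rightarrow> ('v, 'e) path \<Rightarrow> ('v, 'e) path) \<Rightarrow>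
     ('g \<Rightarrow> ('v, 'e) path \<Rightarrow> 'g) \<Rightarrow>
     ('v, 'e) path \<Rightarrow> 'g \<Rightarrow> ('v, 'e) path \<Rightarrow> ('v, 'e) bpath \<Rightarrow> ('g, 'v, 'e) ep_arrow" where
  "ep_elem G E act res \<mu> g \<nu> x =
     (bcat \<mu> (bact E act g x), seq_shift G (int (plen \<mu>)) (res_class G E res g x),
      int (plen \<mu>) - int (plen \<nu>), bcat \<nu> x)"

definition ep_arrows ::
    "('g, 'm) monoid_scheme \<Rightarrow> ('v, 'e) pre_digraph \<Rightarrow> ('g \<Rightarrow> ('v, 'e) path \<Rightarrow> ('v, 'e) path) \<Rightarrow>
     ('g \<Rightarrow> ('v, 'e) path \<Rightarrow> 'g) \<Rightarrow> ('g, 'v, 'e) ep_arrow set" where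
  "ep_arrows G E act res =
     {ep_elem G E act res \<mu> g \<nu> x | \<mu> g \<nu> x.
        x \<in> boundary E \<and> g \<in> carrier G \<and> \<mu> \<in> fpaths E \<and> \<nu> \<in> fpaths E \<and>
        psrc E \<nu> = brng E x \<and> psrc E \<mu> = vact act g (brng E x)}"

definition ep_basis ::
    "('g, 'm) monoid_scheme \<Rightarrow> ('v, 'e) pre_digraph \<Rightarrow> ('g \<Rightarrow> ('v, 'e) path \<Rightarrow> ('v, 'e) path) \<Rightarrow>
     ('g \<Rightarrow> ('v, 'e) path \<Rightarrow> 'g) \<Rightarrow> ('g, 'v, 'e) ep_arrow set set" where
  "ep_basis G E act res =
     {ep_elem G E act res \<mu> g \<nu> ` cyl_minus E F (vtx (psrc E \<nu>)) | \<mu> g \<nu> F.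
        g \<in> carrier G \<and> \<mu> \<in> fpaths E \<and> \<nu> \<in> fpaths E \<and> psrc E \<mu> = vact act g (psrc E \<nu>) \<and>
        finite F \<and> F \<subseteq> paths_from E (psrc E \<nu>) (verts E)}"

definition ep_groupoid ::
    "('g, 'm) monoid_scheme \<Rightarrow> ('v, 'e) pre_digraph \<Rightarrow> ('g \<Rightarrow> ('v, 'e) path \<Rightarrow> ('v, 'e) path) \<Rightarrow>
     ('g \<Rightarrow> ('v, 'e) path \<Rightarrow> 'g) \<Rightarrow> (('v, 'e) bpath, ('g, 'v, 'e) ep_arrow) top_groupoid" where
  "ep_groupoid G E act res =
     \<lparr>units = boundary E,
      units_top = boundary_top E,
      arrows = ep_arrows G E act res,
      arrows_top = topology_generated_by (ep_basis G E act res),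
      rg = (\<lambda>(x, q, m, y). x),
      sr = (\<lambda>(x, q, m, y). y),
      idt = (\<lambda>x. (x, \<one>\<^bsub>seq_quot G\<^esub>, 0, x)),
      gcomp = (\<lambda>(x, q, m, y) (y', q', n, z). (x, q \<otimes>\<^bsub>seq_quot G\<^esub> seq_shift G m q', m + n, z))\<rparr>"

definition ep_degree :: "('g, 'v, 'e) ep_arrow \<Rightarrow> int" where
  "ep_degree = (\<lambda>(y, q, n, z). n)"


section \<open>Maximal tails\<close>

definition vge :: "('v, 'e) pre_digraph \<Rightarrow> 'v \<Rightarrow> 'v \<Rightarrow> bool" where
  "vge E v w \<longleftrightarrow> paths_from E v {w} \<noteq> {}"

definition veq :: "('v, 'e) pre_digraph \<Rightarrow> 'v \<Rightarrow> 'v \<Rightarrow> bool" where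
  "veq E v w \<longleftrightarrow> vge E v w \<and> vge E w v"

definition max_tails ::
    "('g, 'm) monoid_scheme \<Rightarrow> ('v, 'e) pre_digraph \<Rightarrow> ('g \<Rightarrow> ('v, 'e) path \<Rightarrow> ('v, 'e) path) \<Rightarrow>
     'v set set" where
  "max_tails G E act = {M. M \<noteq> {} \<and> M \<subseteq> verts E \<and>
     (\<forall>g \<in> carrier G. \<forall>v \<in> M. vact act g v \<in> M) \<and>
     (\<forall>v w. vge E v w \<and> w \<in> M \<longrightarrow> v \<in> M) \<and>
     (\<forall>v \<in> M. v \<notin> singular E \<longrightarrow> edges_from E v M \<noteq> {}) \<and>
     (\<forall>v \<in> M. \<forall>w \<in> M. \<exists>g \<in> carrier G. \<exists>u \<in> M. vge E v u \<and> vge E w (vact act g u))}"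

definition minimal_in :: "('v, 'e) pre_digraph \<Rightarrow> 'v set \<Rightarrow> 'v \<Rightarrow> bool" where
  "minimal_in E M v \<longleftrightarrow> v \<in> M \<and> (\<forall>w \<in> M. vge E v w \<longrightarrow> veq E w v)"

definition point_tail ::
    "('g, 'm) monoid_scheme \<Rightarrow> ('v, 'e) pre_digraph \<Rightarrow> ('g \<Rightarrow> ('v, 'e) path \<Rightarrow> ('v, 'e) path) \<Rightarrow>
     ('g \<Rightarrow> ('v, 'e) path \<Rightarrow> 'g) \<Rightarrow> ('v, 'e) bpath \<Rightarrow> 'v set" where
  "point_tail G E act res x = brng E ` gpd_orbit (ep_groupoid G E act res) x"

text \<open>
  The set \<open>A\<^bsub>G,E\<^esub>\<close>. The length conditions say that the iterated shifts are defined.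
\<close>

definition aperiodic ::
    "('g, 'm) monoid_scheme \<Rightarrow> ('v, 'e) pre_digraph \<Rightarrow> ('g \<Rightarrow> ('v, 'e) path \<Rightarrow> ('v, 'e) path) \<Rightarrow>
     ('v, 'e) bpath set" where
  "aperiodic G E act = {x \<in> boundary E. \<forall>g \<in> carrier G. \<forall>n m.
     enat n \<le> blen x \<and> enat m \<le> blen x \<and>
     (bshift E ^^ n) x = bact E act g ((bshift E ^^ m) x) \<longrightarrow> n = m}"

definition inf_no_entry :: "('v, 'e) pre_digraph \<Rightarrow> 'v set \<Rightarrow> (nat \<Rightarrow> 'e) \<Rightarrow> bool" where
  "inf_no_entry E M x \<longleftrightarrow> (\<forall>n. edges_from E (head E (x n)) M = {x n})"

definition tails_L where
  "tails_L G E act = {M \<in> max_tails G E act. \<exists>x \<in> inf_paths E.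
     InfP x \<notin> aperiodic G E act \<and> (\<forall>n. head E (x n) \<in> M) \<and> inf_no_entry E M x}"

definition tails_gamma where
  "tails_gamma G E act = max_tails G E act - tails_L G E act"

definition tails_0 where
  "tails_0 G E act = {M \<in> max_tails G E act. \<exists>v. minimal_in E M v \<and> edges_from E v M = {}}"

definition tails_inf where
  "tails_inf G E act = tails_gamma G E act - tails_0 G E act"

definition is_G_circuit where
  "is_G_circuit G E act g \<gamma> \<longleftrightarrow>
     g \<in> carrier G \<and> \<gamma> \<in> fpaths E \<and> plen \<gamma> > 0 \<and> psrc E \<gamma> = vact act g (prng \<gamma>)"

definition no_entry :: "('v, 'e) pre_digraph \<Rightarrow> 'v set \<Rightarrow> ('v, 'e) path \<Rightarrow> bool" where
  "no_entry E M \<gamma> \<longleftrightarrow> (\<forall>v \<in> path_vertices E \<gamma>. card (edges_from E v M) = 1)"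

definition breaking_vertices where
  "breaking_vertices G E act res = {v \<in> singular E.
     finite (edges_from E v (point_tail G E act res (FinP (vtx v)))) \<and>
     0 < card (edges_from E v (point_tail G E act res (FinP (vtx v))))}"

definition singular_0 where
  "singular_0 G E act res = {v \<in> singular E.
     edges_from E v (point_tail G E act res (FinP (vtx v))) = {}}"

end

theory Submission
  imports Defs
begin

text \<open>
  Write \<open>M(x)\<close> for the set of ranges of the elements of the orbit \<open>[x]\<close>, and \<open>C(x)\<close> for the
  closure of \<open>[x]\<close>. Since the grading group is abelian, only the injectivity of the degree on the
  fibers of the interior of the isotropy matters. Two arrows in one fiber with the same degree can
  be written with the same finite paths \<open>\<mu>\<close>, \<open>\<nu>\<close> and the same \<open>x\<close>, so that they differ in the
  group element only, and by pseudo-freeness they are equal only if the group elements are. Hence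
  essentially central isotropy fails if and only if some \<open>h \<noteq> 1\<close> fixes all points of \<open>C(x)\<close> near
  some \<open>x\<close>. Replacing \<open>x\<close> by a tail and \<open>h\<close> by a restriction, one may assume that either \<open>x\<close> is
  infinite and \<open>h\<close> fixes every orbit element with the same range as \<open>x\<close>, or \<open>x\<close> is a singular vertex
  \<open>v\<close> and \<open>h\<close> fixes all orbit elements at \<open>v\<close> whose first edge avoids a finite set \<open>D\<close>
  (\<open>fixing_element_cases\<close>; \<open>not_inj_fiber\<close> is the converse). It remains to compare these two
  situations with the conditions.

  Suppose that such an \<open>h\<close> exists. In the infinite case \<open>h\<close> acts trivially on the paths from the
  range of \<open>x\<close> into the maximal tail \<open>M(x)\<close>, so (iii) excludes it unless \<open>M(x)\<close> has a non-aperiodic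
  path without entry (it has no vertex without incoming edge from \<open>M(x)\<close>). But every path into \<open>M(x)\<close> that
  starts on such a path follows it, so some vertex of that path has, up to the action, a
  nontrivial restriction of \<open>h\<close> in its stabilizer, and it lies on a \<open>G\<close>-circuit without entry; this
  contradicts (ii). In the singular case \<open>h\<close> fixes \<open>v\<close>. If \<open>v\<close> receives finitely many edges from
  \<open>M(v)\<close>, this contradicts (i). Otherwise there is an edge outside \<open>D\<close> that leads back to the
  \<open>G\<close>-orbit of \<open>v\<close>, and the restriction of \<open>h\<close> along this return path acts trivially without any
  exceptional set; as every vertex of \<open>M(v)\<close> reaches a translate of \<open>v\<close>, which receives infinitely
  many edges from \<open>M(v)\<close>, there is neither a path without entry in \<open>M(v)\<close> nor a vertex without edges
  from \<open>M(v)\<close>, and (iii) applies.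

  Conversely, let one of the conditions fail. The vertices of every path in \<open>C(x)\<close> lie in \<open>M(x)\<close>, and
  a finite path belongs to \<open>C(x)\<close> without belonging to \<open>[x]\<close> only if its source receives infinitely
  many edges from \<open>M(x)\<close> (\<open>closure_vertices\<close>, \<open>closure_finite_path\<close>). Hence if (i) fails at \<open>v\<close>,
  then \<open>v\<close> is an isolated point of \<open>C(v)\<close>; if (ii) fails, the path without entry that runs through
  translates of the circuit is an isolated point of the closure of its orbit; and if (iii) fails at \<open>v\<close> and \<open>h\<close>, then \<open>h\<close>
  fixes all points of \<open>C(x)\<close> at \<open>v\<close> for an arbitrary boundary path \<open>x\<close> from \<open>v\<close> with vertices in
  \<open>M\<close>. In all cases a nontrivial \<open>h\<close> fixes \<open>C(x)\<close> near \<open>x\<close>.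
\<close>


section \<open>Finite and boundary paths\<close>

lemma prng_pcat [simp]: "prng (pcat \<mu> \<nu>) = prng \<mu>"
  and plen_pcat [simp]: "plen (pcat \<mu> \<nu>) = plen \<mu> + plen \<nu>"
  and snd_pcat [simp]: "snd (pcat \<mu> \<nu>) = snd \<mu> @ snd \<nu>"
  and fst_pcat [simp]: "fst (pcat \<mu> \<nu>) = fst \<mu>"
  and pcat_assoc: "pcat (pcat \<mu> \<nu>) \<kappa> = pcat \<mu> (pcat \<nu> \<kappa>)"
  by (simp_all add: pcat_def prng_def plen_def)

lemma prng_vtx [simp]: "prng (vtx v) = v"
  and psrc_vtx [simp]: "psrc E (vtx v) = v"
  and plen_vtx [simp]: "plen (vtx v) = 0"
  and snd_vtx [simp]: "snd (vtx v) = []"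
  and fst_vtx [simp]: "fst (vtx v) = v"
  and vtx_eq [simp]: "vtx v = vtx w \<longleftrightarrow> v = w"
  by (simp_all add: vtx_def prng_def psrc_def plen_def)

lemma pcat_vtx [simp]: "pcat \<mu> (vtx v) = \<mu>" "pcat (vtx (prng \<mu>)) \<mu> = \<mu>"
  by (simp_all add: vtx_def pcat_def prng_def)

lemma bcat_vtx [simp]: "bcat (vtx (brng E x)) x = x"
  by (cases x) simp_all

lemma bcat_pcat: "bcat (pcat \<mu> \<nu>) x = bcat \<mu> (bcat \<nu> x)"
  by (cases x) (auto simp: pcat_assoc nth_append plen_def less_diff_conv2)

lemma bseg_0 [simp]: "bseg E x 0 = vtx (brng E x)"
  by (cases x) (auto simp: vtx_def prng_def)

lemma prng_bseg [simp]: "prng (bseg E x n) = brng E x"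
  by (cases x) (auto simp: prng_def)

lemma plen_bseg: "enat (plen (bseg E x n)) = min (enat n) (blen x)"
  by (cases x) (auto simp: plen_def min_def)

lemma plen_bseg_eq: "enat n \<le> blen x \<Longrightarrow> plen (bseg E x n) = n"
  by (metis enat.inject min.absorb1 plen_bseg)

lemma take_bseg: "k \<le> n \<Longrightarrow> bseg E x k = (brng E x, take k (snd (bseg E x n)))"
  by (cases x) (auto simp: prng_def take_map min_def)

text \<open>
  Initial segments determine a boundary path, including its length, because \<open>bseg\<close> stops growing
  at the end of a finite path. Identities between boundary paths are proved in this way below, which
  avoids the distinction of finite and infinite paths.
\<close>

lemma bseg_ext:
  assumes "\<And>n. bseg E x n = bseg E y n"
  shows "x = y"
proof (cases x; cases y)
  fix a b assume ab: "x = FinP a" "y = FinP b"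
  have "(fst a, take n (snd a)) = (fst b, take n (snd b))" for n
    using assms[of n] ab by simp
  from this[of "max (length (snd a)) (length (snd b))"] show "x = y"
    using ab by (simp add: prod_eq_iff)
next
  fix a b assume ab: "x = InfP a" "y = InfP b"
  have "a n = b n" for n
    using assms[of "Suc n"] ab by simp
  then show "x = y" using ab by auto
next
  fix a b assume ab: "x = FinP a" "y = InfP b"
  have "length (snd (bseg E x (Suc (plen a)))) = length (snd (bseg E y (Suc (plen a))))"
    using assms by simp
  then show "x = y" using ab by (simp add: plen_def)
next
  fix a b assume ab: "x = InfP a" "y = FinP b"
  have "length (snd (bseg E x (Suc (plen b)))) = length (snd (bseg E y (Suc (plen b))))"
    using assms by simp
  then show "x = y" using ab by (simp add: plen_def)
qed

lemma psrc_Cons: "psrc E (v, e # es) = psrc E (tail E e, es)"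
  by (simp add: psrc_def)

lemma psrc_append: "psrc E (v, es @ fs) = psrc E (psrc E (v, es), fs)"
  by (simp add: psrc_def)

lemma psrc_pcat: "psrc E \<mu> = prng \<nu> \<Longrightarrow> psrc E (pcat \<mu> \<nu>) = psrc E \<nu>"
  using psrc_append[of E "fst \<mu>" "snd \<mu>" "snd \<nu>"] by (simp add: pcat_def prng_def)

context wf_digraph
begin

lemma fpaths_Nil: "(v, []) \<in> fpaths G \<longleftrightarrow> v \<in> verts G"
  by (simp add: fpaths_def)

text \<open>
  The definition of paths constrains consecutive indices; inductions over edge lists need the
  recursive form.
\<close>

lemma fpaths_Cons: 
  "(v, e # es) \<in> fpaths G \<longleftrightarrow> e \<in> arcs G \<and> head G e = v \<and> (tail G e, es) \<in> fpaths G"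
proof -
  have "(\<forall>i. Suc i < length (e # es) \<longrightarrow> tail G ((e # es) ! i) = head G ((e # es) ! Suc i)) \<longleftrightarrow>
      (es \<noteq> [] \<longrightarrow> head G (hd es) = tail G e) \<and> 
      (\<forall>i. Suc i < length es \<longrightarrow> tail G (es ! i) = head G (es ! Suc i))" (is "?l \<longleftrightarrow> ?r")
  proof
    assume l: ?l
    have "es \<noteq> [] \<longrightarrow> head G (hd es) = tail G e"
      using l[rule_format, of 0] by (auto simp: hd_conv_nth)
    moreover have "Suc i < length es \<longrightarrow> tail G (es ! i) = head G (es ! Suc i)" for i
      using l[rule_format, of "Suc i"] by simp
    ultimately show ?r by blast
  next
    assume r: ?r
    show ?l
    proof (intro allI impI)
      fix i assume "Suc i < length (e # es)"
      then show "tail G ((e # es) ! i) = head G ((e # es) ! Suc i)"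
        using r by (cases i) (auto simp: hd_conv_nth)
    qed
  qed
  then show ?thesis
    unfolding fpaths_def by auto
qed

lemma fpaths_append:
  "(v, es @ fs) \<in> fpaths G \<longleftrightarrow> (v, es) \<in> fpaths G \<and> (psrc G (v, es), fs) \<in> fpaths G"
proof (induction es arbitrary: v)
  case Nil
  have "(v, fs) \<in> fpaths G \<Longrightarrow> v \<in> verts G" by (auto simp: fpaths_def)
  then show ?case by (auto simp: fpaths_Nil psrc_def)
next
  case (Cons e es)
  then show ?case by (auto simp: fpaths_Cons psrc_Cons)
qed

lemma vtx_in [simp]: "vtx v \<in> fpaths G \<longleftrightarrow> v \<in> verts G"
  by (simp add: vtx_def fpaths_Nil)

lemma prng_in: "\<mu> \<in> fpaths G \<Longrightarrow> prng \<mu> \<in> verts G"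
  by (auto simp: fpaths_def prng_def)

lemma psrc_in: "\<mu> \<in> fpaths G \<Longrightarrow> psrc G \<mu> \<in> verts G"
  by (cases "snd \<mu> = []")
    (auto simp: fpaths_def psrc_def dest!: last_in_set intro!: tail_in_verts)

lemma pcat_in:
  assumes "\<mu> \<in> fpaths G" "\<nu> \<in> fpaths G" "psrc G \<mu> = prng \<nu>"
  shows "pcat \<mu> \<nu> \<in> fpaths G"
  using assms fpaths_append[of "fst \<mu>" "snd \<mu>" "snd \<nu>"] by (simp add: pcat_def prng_def)

lemma pcat_inD:
  assumes "pcat \<mu> \<nu> \<in> fpaths G" "psrc G \<mu> = prng \<nu>"
  shows "\<mu> \<in> fpaths G" "\<nu> \<in> fpaths G"
  using assms fpaths_append[of "fst \<mu>" "snd \<mu>" "snd \<nu>"] by (simp_all add: pcat_def prng_def)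

lemma edge_path:
  assumes "e \<in> arcs G"
  shows "(head G e, [e]) \<in> fpaths G" "psrc G (v, [e]) = tail G e"
  using assms by (auto simp: fpaths_Cons fpaths_Nil psrc_def)

lemma take_in: 
  assumes "\<alpha> \<in> fpaths G"
  shows "(prng \<alpha>, take n (snd \<alpha>)) \<in> fpaths G"
proof -
  have "(prng \<alpha>, take n (snd \<alpha>) @ drop n (snd \<alpha>)) \<in> fpaths G"
    using assms by (simp add: prng_def)
  then show ?thesis unfolding fpaths_append by blast
qed

lemma path_split:
  assumes "\<alpha> \<in> fpaths G" "n \<le> plen \<alpha>"
  obtains \<beta> \<delta> where "\<beta> \<in> fpaths G" "\<delta> \<in> fpaths G" "psrc G \<beta> = prng \<delta>" "\<alpha> = pcat \<beta> \<delta>" 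
    "psrc G \<delta> = psrc G \<alpha>" "plen \<beta> = n"
proof -
  let ?b = "(prng \<alpha>, take n (snd \<alpha>))"
  let ?d = "(psrc G ?b, drop n (snd \<alpha>))"
  have 1: "\<alpha> = pcat ?b ?d" by (simp add: pcat_def prng_def)
  have 2: "psrc G ?b = prng ?d" by (simp add: prng_def)
  have 3: "pcat ?b ?d \<in> fpaths G"
    by (subst 1[symmetric]) (rule assms)
  have 4: "psrc G ?d = psrc G \<alpha>"
    by (rule psrc_pcat[OF 2, folded 1, symmetric])
  have 5: "plen ?b = n" using assms(2) by (simp add: plen_def)
  show ?thesis by (rule that[OF pcat_inD[OF 3 2] 2 1 4 5])
qed

lemma inf_paths_iff: "x \<in> inf_paths G \<longleftrightarrow> (\<forall>n. (head G (x 0), map x [0..<n]) \<in> fpaths G)"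
proof
  assume x: "x \<in> inf_paths G"
  have e: "x n \<in> arcs G" "tail G (x n) = head G (x (Suc n))" for n
    using x unfolding inf_paths_def by blast+
  show "\<forall>n. (head G (x 0), map x [0..<n]) \<in> fpaths G"
  proof
    fix n
    have "head G (x 0) \<in> verts G" "set (map x [0..<n]) \<subseteq> arcs G"
      using e(1) by auto
    moreover have "map x [0..<n] \<noteq> [] \<longrightarrow> head G (hd (map x [0..<n])) = head G (x 0)"
      by (simp add: hd_map)
    moreover have "\<forall>i. Suc i < length (map x [0..<n]) \<longrightarrow> 
        tail G (map x [0..<n] ! i) = head G (map x [0..<n] ! Suc i)"
    proof (intro allI impI)
      fix i assume "Suc i < length (map x [0..<n])"
      then show "tail G (map x [0..<n] ! i) = head G (map x [0..<n] ! Suc i)"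
        using e(2)[of i] by simp
    qed
    ultimately show "(head G (x 0), map x [0..<n]) \<in> fpaths G"
      unfolding fpaths_def by blast
  qed
next
  assume r: "\<forall>n. (head G (x 0), map x [0..<n]) \<in> fpaths G"
  show "x \<in> inf_paths G"
    unfolding inf_paths_def
  proof (intro CollectI allI)
    fix n
    have *: "(head G (x 0), map x [0..<n] @ [x n, x (Suc n)]) \<in> fpaths G"
      using r[rule_format, of "Suc (Suc n)"] by simp
    then show "x n \<in> arcs G \<and> tail G (x n) = head G (x (Suc n))"
      by (simp add: fpaths_append fpaths_Cons)
  qed
qed

lemma boundary_FinP: "FinP \<alpha> \<in> boundary G \<longleftrightarrow> \<alpha> \<in> fpaths G \<and> psrc G \<alpha> \<in> singular G"
  and boundary_InfP: "InfP x \<in> boundary G \<longleftrightarrow> x \<in> inf_paths G"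
  by (auto simp: boundary_def)

lemma bseg_in: "x \<in> boundary G \<Longrightarrow> bseg G x n \<in> fpaths G"
proof (cases x)
  case (FinP \<alpha>)
  assume "x \<in> boundary G"
  with FinP have "\<alpha> \<in> fpaths G" by (simp add: boundary_FinP)
  then show ?thesis using FinP take_in[of \<alpha> n] by (simp add: prng_def)
next
  case (InfP y)
  assume "x \<in> boundary G"
  then show ?thesis using InfP by (simp add: boundary_InfP inf_paths_iff)
qed

lemma brng_in: "x \<in> boundary G \<Longrightarrow> brng G x \<in> verts G"
  using bseg_in[of x 0] by simp

lemma psrc_bseg_InfP:
  assumes "x \<in> inf_paths G"
  shows "psrc G (bseg G (InfP x) n) = head G (x n)"
proof (cases n)
  case (Suc m)
  have "tail G (x m) = head G (x (Suc m))"
    using assms unfolding inf_paths_def by blast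
  then show ?thesis using Suc by (simp add: psrc_def)
qed (simp add: psrc_def)

lemma brng_bcat:
  assumes "\<mu> \<in> fpaths G" "psrc G \<mu> = brng G x"
  shows "brng G (bcat \<mu> x) = prng \<mu>"
proof (cases x)
  case (InfP y)
  show ?thesis
  proof (cases "snd \<mu> = []")
    case True
    then show ?thesis using InfP assms(2) by (simp add: plen_def psrc_def prng_def)
  next
    case False
    then have "head G (snd \<mu> ! 0) = prng \<mu>" "0 < plen \<mu>"
      using assms(1) by (auto simp: fpaths_def prng_def plen_def hd_conv_nth)
    then show ?thesis using InfP by simp
  qed
qed simp

lemma bseg_bcat_le:
  assumes "\<mu> \<in> fpaths G" "psrc G \<mu> = brng G x" "n \<le> plen \<mu>"
  shows "bseg G (bcat \<mu> x) n = (prng \<mu>, take n (snd \<mu>))"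
proof -
  have "snd (bseg G (bcat \<mu> x) n) = take n (snd \<mu>)"
    using assms by (cases x) (auto simp: plen_def intro!: nth_equalityI)
  moreover have "fst (bseg G (bcat \<mu> x) n) = prng \<mu>"
    using brng_bcat[OF assms(1,2)] prng_bseg by (metis prng_def)
  ultimately show ?thesis by (simp add: prod_eq_iff)
qed

lemma bseg_bcat_plen:
  assumes "\<mu> \<in> fpaths G" "psrc G \<mu> = brng G x"
  shows "bseg G (bcat \<mu> x) (plen \<mu>) = \<mu>"
  using bseg_bcat_le[OF assms, of "plen \<mu>"] by (simp add: prng_def plen_def)

lemma bseg_bcat_add:
  assumes "\<mu> \<in> fpaths G" "psrc G \<mu> = brng G x"
  shows "bseg G (bcat \<mu> x) (plen \<mu> + n) = pcat \<mu> (bseg G x n)"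
proof -
  have "snd (bseg G (bcat \<mu> x) (plen \<mu> + n)) = snd \<mu> @ snd (bseg G x n)"
  proof (cases x)
    case (InfP y)
    have "map (\<lambda>n. if n < plen \<mu> then snd \<mu> ! n else y (n - plen \<mu>)) [0..<plen \<mu> + n]
       = snd \<mu> @ map y [0..<n]"
      by (rule nth_equalityI) (auto simp: plen_def nth_append)
    then show ?thesis using InfP by simp
  qed (simp add: plen_def)
  moreover have "fst (bseg G (bcat \<mu> x) (plen \<mu> + n)) = prng \<mu>"
    using brng_bcat[OF assms(1,2)] prng_bseg by (metis prng_def)
  ultimately show ?thesis by (simp add: prod_eq_iff prng_def)
qed

lemma bcat_in:
  assumes "\<mu> \<in> fpaths G" "x \<in> boundary G" "psrc G \<mu> = brng G x"
  shows "bcat \<mu> x \<in> boundary G"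
proof (cases x)
  case (FinP \<alpha>)
  then show ?thesis using assms pcat_in[of \<mu> \<alpha>] psrc_pcat[of G \<mu> \<alpha>] by (auto simp: boundary_FinP)
next
  case (InfP y)
  have *: "bseg G (bcat \<mu> x) n \<in> fpaths G" for n
  proof (cases "n \<le> plen \<mu>")
    case True
    then show ?thesis
      using bseg_bcat_le[OF assms(1,3) True] take_in[OF assms(1)] by simp
  next
    case False
    then obtain k where "n = plen \<mu> + k" by (metis le_iff_add nat_le_linear)
    then show ?thesis using bseg_bcat_add[OF assms(1,3)] pcat_in[OF assms(1)] bseg_in[OF assms(2)] assms(3)
      by simp
  qed
  then show ?thesis using InfP by (simp add: boundary_InfP inf_paths_iff)
qed

lemma boundary_split:
  assumes "x \<in> boundary G" "enat n \<le> blen x"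
  obtains y where "y \<in> boundary G" "brng G y = psrc G (bseg G x n)" "x = bcat (bseg G x n) y"
    "plen (bseg G x n) = n"
proof (cases x)
  case (FinP \<alpha>)
  with assms have a: "\<alpha> \<in> fpaths G" "psrc G \<alpha> \<in> singular G" by (auto simp: boundary_FinP)
  have n: "n \<le> plen \<alpha>" using assms(2) FinP by simp
  obtain \<beta> \<delta> where bd: "\<beta> \<in> fpaths G" "\<delta> \<in> fpaths G" "psrc G \<beta> = prng \<delta>" "\<alpha> = pcat \<beta> \<delta>"
    "psrc G \<delta> = psrc G \<alpha>" "plen \<beta> = n"
    by (rule path_split[OF a(1) n])
  have s: "bseg G x n = \<beta>" using bd(4,6) FinP by (simp add: plen_def)
  show ?thesis
    using that[of "FinP \<delta>"] bd a FinP plen_bseg_eq[OF assms(2), of G]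
    unfolding s by (simp add: boundary_FinP)
next
  case (InfP y)
  with assms have y: "y \<in> inf_paths G" by (simp add: boundary_InfP)
  let ?z = "InfP (\<lambda>i. y (n + i))"
  have "?z \<in> boundary G" using y by (simp add: boundary_InfP inf_paths_def)
  moreover have "brng G ?z = psrc G (bseg G x n)"
    using psrc_bseg_InfP[OF y, of n] InfP by simp
  moreover have "x = bcat (bseg G x n) ?z"
    using InfP by (auto simp: plen_def)
  ultimately show ?thesis using that plen_bseg_eq[OF assms(2), of G] by blast
qed

text \<open>
  Both \<open>\<mu>\<close> and \<open>\<alpha>\<close> are initial segments of the same boundary path, so the longer one extends the
  shorter one, and cancelling the common part gives the tails.
\<close>

lemma bcat_compare:
  assumes "\<mu> \<in> fpaths G" "\<alpha> \<in> fpaths G"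
    and "psrc G \<mu> = brng G w" "psrc G \<alpha> = brng G y" "bcat \<mu> w = bcat \<alpha> y" "plen \<alpha> \<le> plen \<mu>"
  obtains \<beta> where "\<beta> \<in> fpaths G" "psrc G \<alpha> = prng \<beta>" "\<mu> = pcat \<alpha> \<beta>" "y = bcat \<beta> w"
    "psrc G \<beta> = brng G w"
proof -
  obtain \<gamma> \<delta> where bd: "\<gamma> \<in> fpaths G" "\<delta> \<in> fpaths G" "psrc G \<gamma> = prng \<delta>" "\<mu> = pcat \<gamma> \<delta>"
    "psrc G \<delta> = psrc G \<mu>" "plen \<gamma> = plen \<alpha>"
    by (rule path_split[OF assms(1,6)])
  have "\<gamma> = bseg G (bcat \<mu> w) (plen \<alpha>)"
    using bseg_bcat_le[OF assms(1,3,6)] bd(4,6) by (simp add: plen_def prng_def)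
  also have "\<dots> = \<alpha>" using bseg_bcat_plen[OF assms(2,4)] assms(5) by simp
  finally have ga: "\<gamma> = \<alpha>" .
  have dw: "brng G (bcat \<delta> w) = prng \<delta>" 
    using brng_bcat[of \<delta> w] bd(2,5) assms(3) by simp
  have "bseg G y n = bseg G (bcat \<delta> w) n" for n
  proof -
    have "bcat \<alpha> (bcat \<delta> w) = bcat \<alpha> y"
      using assms(5) unfolding bd(4) ga bcat_pcat .
    then have "pcat \<alpha> (bseg G y n) = pcat \<alpha> (bseg G (bcat \<delta> w) n)"
      using bseg_bcat_add[OF assms(2), of y n] bseg_bcat_add[OF assms(2), of "bcat \<delta> w" n]
        assms(4) dw bd(3) ga by simp
    then have "snd (bseg G y n) = snd (bseg G (bcat \<delta> w) n)"
      by (metis same_append_eq snd_pcat)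
    moreover have "prng (bseg G y n) = prng (bseg G (bcat \<delta> w) n)"
      using dw bd(3) ga assms(4) by simp
    ultimately show ?thesis by (simp add: prod_eq_iff prng_def)
  qed
  then have "y = bcat \<delta> w" by (rule bseg_ext)
  moreover have "psrc G \<alpha> = prng \<delta>" "psrc G \<delta> = brng G w" "\<mu> = pcat \<alpha> \<delta>"
    using bd(3-5) ga assms(3) by simp_all
  ultimately show ?thesis using that[OF bd(2)] by blast
qed

lemma bcat_cancel:
  assumes "\<mu> \<in> fpaths G" "\<alpha> \<in> fpaths G"
    and "psrc G \<mu> = brng G w" "psrc G \<alpha> = brng G y" "bcat \<mu> w = bcat \<alpha> y" "plen \<alpha> = plen \<mu>"
  shows "\<alpha> = \<mu>" "y = w"
proof -
  have le: "plen \<alpha> \<le> plen \<mu>" using assms(6) by simp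
  obtain \<beta> where b: "\<beta> \<in> fpaths G" "psrc G \<alpha> = prng \<beta>" "\<mu> = pcat \<alpha> \<beta>" "y = bcat \<beta> w"
    "psrc G \<beta> = brng G w"
    by (rule bcat_compare[OF assms(1-5) le])
  have "snd \<beta> = []" using b(3) assms(6) by (simp add: plen_def)
  then have "\<beta> = vtx (brng G w)" using b(5) by (cases \<beta>) (simp add: vtx_def psrc_def)
  then show "\<alpha> = \<mu>" "y = w" using b(3,4) by simp_all
qed

lemma cyl_iff:
  assumes "\<alpha> \<in> fpaths G"
  shows "x \<in> cyl G \<alpha> \<longleftrightarrow> (\<exists>y\<in>boundary G. psrc G \<alpha> = brng G y \<and> x = bcat \<alpha> y)"
proof
  assume "x \<in> cyl G \<alpha>"
  then have x: "x \<in> boundary G" "bseg G x (plen \<alpha>) = \<alpha>"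
    unfolding cyl_def by blast+
  have "enat (plen \<alpha>) = min (enat (plen \<alpha>)) (blen x)"
    using plen_bseg[of G x "plen \<alpha>"] unfolding x(2) .
  then have "enat (plen \<alpha>) \<le> blen x" by (metis min.cobounded2)
  from boundary_split[OF x(1) this, unfolded x(2)] obtain y where
    "y \<in> boundary G" "brng G y = psrc G \<alpha>" "x = bcat \<alpha> y" .
  then show "\<exists>y\<in>boundary G. psrc G \<alpha> = brng G y \<and> x = bcat \<alpha> y"
    by (intro bexI[of _ y] conjI) simp_all
next
  assume "\<exists>y\<in>boundary G. psrc G \<alpha> = brng G y \<and> x = bcat \<alpha> y"
  then obtain y where y: "y \<in> boundary G" "psrc G \<alpha> = brng G y" and x: "x = bcat \<alpha> y"
    by blast
  show "x \<in> cyl G \<alpha>"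
    unfolding x cyl_def using bcat_in[OF assms y] bseg_bcat_plen[OF assms y(2)] by blast
qed

lemma cyl_vtx: "x \<in> cyl G (vtx v) \<longleftrightarrow> x \<in> boundary G \<and> brng G x = v"
  by (simp add: cyl_def)

end


section \<open>The action on boundary paths\<close>

context self_similar_graph
begin

sublocale grp: group G
  using act.group_hom group_hom.axioms(1) by blast

lemmas grp_simps [simp] = grp.inv_closed grp.m_closed grp.one_closed

lemma act_in [simp]: "\<lbrakk>g \<in> carrier G; \<mu> \<in> fpaths E\<rbrakk> \<Longrightarrow> act g \<mu> \<in> fpaths E"
  using act.element_image by blast

lemma act_one [simp]: "\<mu> \<in> fpaths E \<Longrightarrow> act \<one>\<^bsub>G\<^esub> \<mu> = \<mu>"
  using act.id_eq_one by (metis restrict_apply')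

lemma act_mult:
  "\<lbrakk>g \<in> carrier G; h \<in> carrier G; \<mu> \<in> fpaths E\<rbrakk> \<Longrightarrow> act (g \<otimes>\<^bsub>G\<^esub> h) \<mu> = act g (act h \<mu>)"
  by (rule act.composition_rule)

lemma act_inv [simp]:
  "\<lbrakk>g \<in> carrier G; \<mu> \<in> fpaths E\<rbrakk> \<Longrightarrow> act (inv\<^bsub>G\<^esub> g) (act g \<mu>) = \<mu>"
  "\<lbrakk>g \<in> carrier G; \<mu> \<in> fpaths E\<rbrakk> \<Longrightarrow> act g (act (inv\<^bsub>G\<^esub> g) \<mu>) = \<mu>"
  using act_mult[of "inv\<^bsub>G\<^esub> g" g \<mu>] act_mult[of g "inv\<^bsub>G\<^esub> g" \<mu>] by simp_all

lemma act_vtx: "\<lbrakk>g \<in> carrier G; v \<in> verts E\<rbrakk> \<Longrightarrow> act g (vtx v) = vtx (vact act g v)"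
  using plen_act[of g "vtx v"] unfolding vact_def
  by (cases "act g (vtx v)") (simp add: plen_def vtx_def prng_def gph.fpaths_Nil)

lemma vact_in [simp]: "\<lbrakk>g \<in> carrier G; v \<in> verts E\<rbrakk> \<Longrightarrow> vact act g v \<in> verts E"
  unfolding vact_def by (rule gph.prng_in) simp

lemma vact_one [simp]: "v \<in> verts E \<Longrightarrow> vact act \<one>\<^bsub>G\<^esub> v = v"
  by (simp add: vact_def)

lemma vact_mult:
  "\<lbrakk>g \<in> carrier G; h \<in> carrier G; v \<in> verts E\<rbrakk> \<Longrightarrow> vact act (g \<otimes>\<^bsub>G\<^esub> h) v = vact act g (vact act h v)"
  using act_mult[of g h "vtx v"] by (simp add: act_vtx)

lemma vact_inv [simp]:
  "\<lbrakk>g \<in> carrier G; v \<in> verts E\<rbrakk> \<Longrightarrow> vact act (inv\<^bsub>G\<^esub> g) (vact act g v) = v"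
  "\<lbrakk>g \<in> carrier G; v \<in> verts E\<rbrakk> \<Longrightarrow> vact act g (vact act (inv\<^bsub>G\<^esub> g) v) = v"
  using vact_mult[of "inv\<^bsub>G\<^esub> g" g v] vact_mult[of g "inv\<^bsub>G\<^esub> g" v] by simp_all

text \<open>
  Restrictions act on vertices like the original element. This follows from composability of \<open>g \<cdot> \<mu>\<close>
  with the image of the path of length 0 at the source of \<open>\<mu>\<close>.
\<close>

lemma vact_res:
  assumes "g \<in> carrier G" "\<mu> \<in> fpaths E"
  shows "vact act (res g \<mu>) (psrc E \<mu>) = vact act g (psrc E \<mu>)"
  using act_composable[of g \<mu> "vtx (psrc E \<mu>)"] psrc_act[of g \<mu>] gph.psrc_in[of \<mu>] assms
  by (simp add: act_vtx res_closed)

lemma res_one: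
  assumes "\<mu> \<in> fpaths E" shows "res \<one>\<^bsub>G\<^esub> \<mu> = \<one>\<^bsub>G\<^esub>"
  using res_mult[of "\<one>\<^bsub>G\<^esub>" "\<one>\<^bsub>G\<^esub>" \<mu>] res_closed[of "\<one>\<^bsub>G\<^esub>" \<mu>] assms by simp

lemma act_take:
  assumes "g \<in> carrier G" "\<alpha> \<in> fpaths E"
  shows "act g (prng \<alpha>, take n (snd \<alpha>)) = (prng (act g \<alpha>), take n (snd (act g \<alpha>)))"
proof (cases "n \<le> plen \<alpha>")
  case True
  obtain \<beta> \<delta> where bd: "\<beta> \<in> fpaths E" "\<delta> \<in> fpaths E" "psrc E \<beta> = prng \<delta>" "\<alpha> = pcat \<beta> \<delta>"
    "psrc E \<delta> = psrc E \<alpha>" "plen \<beta> = n"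
    by (rule gph.path_split[OF assms(2) True])
  have 1: "(prng \<alpha>, take n (snd \<alpha>)) = \<beta>" using bd(4,6) by (simp add: plen_def prng_def)
  have 2: "act g \<alpha> = pcat (act g \<beta>) (act (res g \<beta>) \<delta>)"
    using act_pcat[OF assms(1) bd(1-3)] bd(4) by simp
  have "plen (act g \<beta>) = n" using plen_act[OF assms(1) bd(1)] bd(6) by simp
  then show ?thesis unfolding 1 2 by (simp add: plen_def prng_def)
next
  case False
  then have "take n (snd \<alpha>) = snd \<alpha>" "take n (snd (act g \<alpha>)) = snd (act g \<alpha>)"
    using plen_act[OF assms] by (simp_all add: plen_def)
  then show ?thesis by (simp add: prng_def)
qed

text \<open>
  The action on edges, read off from the action on paths of length 1.
\<close>

definition eact :: "'g \<Rightarrow> 'e \<Rightarrow> 'e" where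
  "eact g e = hd (snd (act g (head E e, [e])))"

lemma act_edge:
  assumes "g \<in> carrier G" "e \<in> arcs E"
  shows "act g (head E e, [e]) = (vact act g (head E e), [eact g e])" (is ?a)
    and "eact g e \<in> arcs E" "head E (eact g e) = vact act g (head E e)"
    and "tail E (eact g e) = vact act g (tail E e)"
proof -
  note p = gph.edge_path[OF assms(2)]
  have "length (snd (act g (head E e, [e]))) = 1" 
    using plen_act[OF assms(1) p(1)] by (simp add: plen_def)
  then have "snd (act g (head E e, [e])) = [eact g e]"
    unfolding eact_def by (cases "snd (act g (head E e, [e]))") auto
  moreover have "fst (act g (head E e, [e])) = vact act g (head E e)"
    using prng_act[OF assms(1) p(1)] by (simp add: prng_def)
  ultimately show a: ?a by (simp add: prod_eq_iff)
  have "act g (head E e, [e]) \<in> fpaths E" using assms p by simp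
  then show "eact g e \<in> arcs E" "head E (eact g e) = vact act g (head E e)"
    unfolding a by (simp_all add: gph.fpaths_Cons)
  show "tail E (eact g e) = vact act g (tail E e)"
    using psrc_act[OF assms(1) p(1)] unfolding a by (simp add: psrc_def)
qed

lemma eact_inv:
  assumes "g \<in> carrier G" "e \<in> arcs E"
  shows "eact (inv\<^bsub>G\<^esub> g) (eact g e) = e"
proof -
  have "act (inv\<^bsub>G\<^esub> g) (act g (head E e, [e])) = (head E e, [e])"
    using assms gph.edge_path by simp
  then have "act (inv\<^bsub>G\<^esub> g) (head E (eact g e), [eact g e]) = (head E e, [e])"
    using act_edge[OF assms] by simp
  then show ?thesis unfolding eact_def[of "inv\<^bsub>G\<^esub> g"] by simp
qed

definition G_invariant :: "'v set \<Rightarrow> bool" where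
  "G_invariant M \<longleftrightarrow> M \<subseteq> verts E \<and> (\<forall>g\<in>carrier G. \<forall>v\<in>M. vact act g v \<in> M)"

lemma edges_from_vact:
  assumes "g \<in> carrier G" "v \<in> verts E" "G_invariant M"
  shows "edges_from E (vact act g v) M = eact g ` edges_from E v M" "inj_on (eact g) (arcs E)"
proof -
  have 1: "eact h ` edges_from E w M \<subseteq> edges_from E (vact act h w) M" if "h \<in> carrier G" for h w
    using that act_edge(2-4) assms(3) by (auto simp: edges_from_def G_invariant_def)
  show "edges_from E (vact act g v) M = eact g ` edges_from E v M"
  proof
    show "edges_from E (vact act g v) M \<subseteq> eact g ` edges_from E v M"
    proof
      fix e assume e: "e \<in> edges_from E (vact act g v) M"
      then have "eact (inv\<^bsub>G\<^esub> g) e \<in> edges_from E v M"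
        using 1[of "inv\<^bsub>G\<^esub> g" "vact act g v"] assms by auto
      moreover have "eact g (eact (inv\<^bsub>G\<^esub> g) e) = e"
        using eact_inv[of "inv\<^bsub>G\<^esub> g" e] assms(1) e by (simp add: edges_from_def)
      ultimately show "e \<in> eact g ` edges_from E v M" by (metis imageI)
    qed
  qed (rule 1[OF assms(1)])
  show "inj_on (eact g) (arcs E)"
    using eact_inv[OF assms(1)] by (metis inj_onI)
qed

lemma edges_from_vact_card:
  assumes "g \<in> carrier G" "v \<in> verts E" "G_invariant M"
  shows "edges_from E (vact act g v) M = {} \<longleftrightarrow> edges_from E v M = {}"
    and "finite (edges_from E (vact act g v) M) \<longleftrightarrow> finite (edges_from E v M)"
    and "card (edges_from E (vact act g v) M) = card (edges_from E v M)"
proof -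
  have "inj_on (eact g) (edges_from E v M)"
    using edges_from_vact(2)[OF assms] by (rule inj_on_subset) (auto simp: edges_from_def)
  then show "edges_from E (vact act g v) M = {} \<longleftrightarrow> edges_from E v M = {}"
    and "finite (edges_from E (vact act g v) M) \<longleftrightarrow> finite (edges_from E v M)"
    and "card (edges_from E (vact act g v) M) = card (edges_from E v M)"
    unfolding edges_from_vact(1)[OF assms] by (auto simp: finite_image_iff card_image)
qed

lemma singular_vact:
  assumes "g \<in> carrier G" "v \<in> singular E"
  shows "vact act g v \<in> singular E"
  using edges_from_vact_card(1,2)[of g v "verts E"] assms
  by (auto simp: singular_def G_invariant_def)

text \<open>
  For an infinite path the action is defined edge by edge, the \<open>n\<close>-th edge being taken from the
  image of the segment of length \<open>n + 1\<close>. The images of longer segments extend those of shorter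
  ones (\<open>act_take\<close>), so the edges fit together.
\<close>

lemma bseg_bact:
  assumes "g \<in> carrier G" "x \<in> boundary E"
  shows "bseg E (bact E act g x) n = act g (bseg E x n)"
proof (cases x)
  case (FinP \<alpha>)
  then have "\<alpha> \<in> fpaths E" using assms by (simp add: gph.boundary_FinP)
  then show ?thesis using act_take[OF assms(1), of \<alpha> n] FinP by (simp add: prng_def)
next
  case (InfP y)
  let ?s = "\<lambda>n. bseg E x n"
  let ?z = "\<lambda>n. snd (act g (?s (Suc n))) ! n"
  have p: "?s n \<in> fpaths E" for n using gph.bseg_in[OF assms(2)] .
  have len: "plen (?s n) = n" for n using InfP by (simp add: plen_def)
  have t: "snd (act g (?s k)) = take k (snd (act g (?s n)))" if "k \<le> n" for k n
    unfolding take_bseg[OF that, of E x]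
    using act_take[OF assms(1) p[of n], of k] by simp
  have z: "?z i = snd (act g (?s n)) ! i" if "i < n" for i n
    using t[of "Suc i" n] that by simp
  have "length (snd (act g (?s n))) = n"
    using plen_act[OF assms(1) p, of n] len[of n] by (simp add: plen_def)
  then have 1: "snd (act g (?s n)) = map ?z [0..<n]"
    by (intro nth_equalityI) (simp_all add: z)
  have e: "act g (?s 1) \<in> fpaths E" "plen (act g (?s 1)) = 1"
    using p plen_act[OF assms(1) p] len assms(1) by simp_all
  then obtain f where f: "snd (act g (?s 1)) = [f]"
    by (cases "snd (act g (?s 1))") (auto simp: plen_def)
  have "head E f = prng (act g (?s 1))"
    using e(1) f gph.fpaths_Cons[of "prng (act g (?s 1))" f "[]"]
    by (cases "act g (?s 1)") (simp add: prng_def)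
  also have "\<dots> = prng (act g (?s n))"
    using prng_act[OF assms(1) p] by simp
  finally have 2: "head E (?z 0) = fst (act g (?s n))"
    using f by (simp add: prng_def)
  have "bact E act g x = InfP ?z" using InfP by simp
  then have "bseg E (bact E act g x) n = (head E (?z 0), map ?z [0..<n])" by simp
  also have "\<dots> = act g (?s n)" unfolding 2 1[symmetric] by simp
  finally show ?thesis .
qed

lemma brng_bact [simp]:
  assumes "g \<in> carrier G" "x \<in> boundary E"
  shows "brng E (bact E act g x) = vact act g (brng E x)"
  using bseg_bact[OF assms, of 0] gph.brng_in[OF assms(2)] assms(1) by (simp add: act_vtx)

lemma bact_in [simp]:
  assumes "g \<in> carrier G" "x \<in> boundary E"
  shows "bact E act g x \<in> boundary E"
proof (cases x)
  case (FinP \<alpha>)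
  then show ?thesis
    using assms singular_vact psrc_act by (simp add: gph.boundary_FinP)
next
  case (InfP y)
  have "bseg E (bact E act g x) n \<in> fpaths E" for n
    using bseg_bact[OF assms] gph.bseg_in[OF assms(2)] assms(1) by simp
  then show ?thesis using InfP by (simp add: gph.boundary_InfP gph.inf_paths_iff)
qed

lemma bact_one [simp]: "x \<in> boundary E \<Longrightarrow> bact E act \<one>\<^bsub>G\<^esub> x = x"
  by (rule bseg_ext[of E]) (simp add: bseg_bact gph.bseg_in)

lemma bact_mult:
  "\<lbrakk>g \<in> carrier G; h \<in> carrier G; x \<in> boundary E\<rbrakk>
    \<Longrightarrow> bact E act (g \<otimes>\<^bsub>G\<^esub> h) x = bact E act g (bact E act h x)"
  by (rule bseg_ext[of E]) (simp add: bseg_bact gph.bseg_in act_mult)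

lemma bact_inv [simp]:
  "\<lbrakk>g \<in> carrier G; x \<in> boundary E\<rbrakk> \<Longrightarrow> bact E act (inv\<^bsub>G\<^esub> g) (bact E act g x) = x"
  "\<lbrakk>g \<in> carrier G; x \<in> boundary E\<rbrakk> \<Longrightarrow> bact E act g (bact E act (inv\<^bsub>G\<^esub> g) x) = x"
  using bact_mult[of "inv\<^bsub>G\<^esub> g" g x] bact_mult[of g "inv\<^bsub>G\<^esub> g" x] by simp_all

lemma psrc_act_bact:
  assumes "g \<in> carrier G" "\<mu> \<in> fpaths E" "x \<in> boundary E" "psrc E \<mu> = brng E x"
  shows "psrc E (act g \<mu>) = brng E (bact E act (res g \<mu>) x)"
  using vact_res[OF assms(1,2)] psrc_act[OF assms(1,2)] assms by (simp add: res_closed)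

lemma bact_bcat:
  assumes "g \<in> carrier G" "\<mu> \<in> fpaths E" "x \<in> boundary E" "psrc E \<mu> = brng E x"
  shows "bact E act g (bcat \<mu> x) = bcat (act g \<mu>) (bact E act (res g \<mu>) x)"
proof (rule bseg_ext[of E])
  fix n
  have r: "res g \<mu> \<in> carrier G" using assms res_closed by simp
  have am: "act g \<mu> \<in> fpaths E" and pl: "plen (act g \<mu>) = plen \<mu>"
    using assms plen_act by simp_all
  note s = psrc_act_bact[OF assms]
  have bx: "bcat \<mu> x \<in> boundary E" using gph.bcat_in assms by simp
  have L: "bseg E (bact E act g (bcat \<mu> x)) n = act g (bseg E (bcat \<mu> x) n)"
    using bseg_bact[OF assms(1) bx] .
  show "bseg E (bact E act g (bcat \<mu> x)) n = bseg E (bcat (act g \<mu>) (bact E act (res g \<mu>) x)) n"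
  proof (cases "n \<le> plen \<mu>")
    case True
    then show ?thesis
      unfolding L using gph.bseg_bcat_le[OF assms(2,4) True] gph.bseg_bcat_le[OF am s, of n]
        act_take[OF assms(1,2), of n] pl by simp
  next
    case False
    then obtain k where k: "n = plen \<mu> + k" by (metis le_iff_add nat_le_linear)
    have "act g (bseg E (bcat \<mu> x) n) = act g (pcat \<mu> (bseg E x k))"
      unfolding k gph.bseg_bcat_add[OF assms(2,4)] ..
    also have "\<dots> = pcat (act g \<mu>) (act (res g \<mu>) (bseg E x k))"
      using act_pcat[OF assms(1,2) gph.bseg_in[OF assms(3)]] assms(4) by simp
    also have "\<dots> = pcat (act g \<mu>) (bseg E (bact E act (res g \<mu>) x) k)"
      using bseg_bact[OF r assms(3)] by simp
    also have "\<dots> = bseg E (bcat (act g \<mu>) (bact E act (res g \<mu>) x)) n"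
      unfolding k using gph.bseg_bcat_add[OF am s, of k] pl by simp
    finally show ?thesis unfolding L .
  qed
qed

end


section \<open>Arrows and orbits\<close>

context self_similar_graph
begin

abbreviation elem where
  "elem \<equiv> ep_elem G E act res"

abbreviation orb where
  "orb \<equiv> gpd_orbit (ep_groupoid G E act res)"

text \<open>
  The side conditions under which \<open>ep_elem\<close> yields an arrow. An arrow has many such parametrisations.
\<close>

definition admissible :: "('v, 'e) path \<Rightarrow> 'g \<Rightarrow> ('v, 'e) path \<Rightarrow> ('v, 'e) bpath \<Rightarrow> bool" where
  "admissible \<mu> g \<nu> x \<longleftrightarrow> x \<in> boundary E \<and> g \<in> carrier G \<and> \<mu> \<in> fpaths E \<and> \<nu> \<in> fpaths E \<and>
     psrc E \<nu> = brng E x \<and> psrc E \<mu> = vact act g (brng E x)"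

lemma admissibleD:
  assumes "admissible \<mu> g \<nu> x"
  shows "x \<in> boundary E" "g \<in> carrier G" "\<mu> \<in> fpaths E" "\<nu> \<in> fpaths E" "psrc E \<nu> = brng E x"
    "psrc E \<mu> = brng E (bact E act g x)" "bact E act g x \<in> boundary E"
    "bcat \<nu> x \<in> boundary E" "bcat \<mu> (bact E act g x) \<in> boundary E"
proof -
  show 1: "x \<in> boundary E" "g \<in> carrier G" "\<mu> \<in> fpaths E" "\<nu> \<in> fpaths E" "psrc E \<nu> = brng E x"
    "psrc E \<mu> = brng E (bact E act g x)" "bact E act g x \<in> boundary E"
    using assms by (simp_all add: admissible_def)
  show "bcat \<nu> x \<in> boundary E" "bcat \<mu> (bact E act g x) \<in> boundary E"
    by (rule gph.bcat_in; rule 1)+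
qed

lemma admissible_vtx:
  assumes "x \<in> boundary E" "g \<in> carrier G" "vact act g (brng E x) = brng E x"
  shows "admissible (vtx (brng E x)) g (vtx (brng E x)) x"
  using assms gph.brng_in[OF assms(1)] by (simp add: admissible_def)

lemma admissible_cong: "admissible \<mu> g \<nu> x \<Longrightarrow> z \<in> boundary E \<Longrightarrow> brng E z = brng E x \<Longrightarrow> admissible \<mu> g \<nu> z"
  by (simp add: admissible_def)

lemma ep_arrows_iff: "a \<in> ep_arrows G E act res \<longleftrightarrow> (\<exists>\<mu> g \<nu> x. admissible \<mu> g \<nu> x \<and> a = elem \<mu> g \<nu> x)"
  unfolding ep_arrows_def admissible_def by blast

lemma elem_proj:
  "rg (ep_groupoid G E act res) (elem \<mu> g \<nu> x) = bcat \<mu> (bact E act g x)"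
  "sr (ep_groupoid G E act res) (elem \<mu> g \<nu> x) = bcat \<nu> x"
  "ep_degree (elem \<mu> g \<nu> x) = int (plen \<mu>) - int (plen \<nu>)"
  by (simp_all add: ep_groupoid_def ep_elem_def ep_degree_def)

lemma seq_class_eq:
  assumes "f \<in> UNIV \<rightarrow> carrier G" "f' \<in> UNIV \<rightarrow> carrier G"
  shows "seq_class G f = seq_class G f' \<longleftrightarrow> (\<forall>\<^sub>F n in sequentially. f n = f' n)"
proof
  assume "seq_class G f = seq_class G f'"
  moreover have "f' \<in> seq_class G f'" using assms by (simp add: seq_class_def seq_eq_def)
  ultimately have "f' \<in> seq_class G f" by simp
  then show "\<forall>\<^sub>F n in sequentially. f n = f' n" by (simp add: seq_class_def seq_eq_def)
next
  assume ev: "\<forall>\<^sub>F n in sequentially. f n = f' n"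
  have "(\<forall>\<^sub>F n in sequentially. f n = h n) \<longleftrightarrow> (\<forall>\<^sub>F n in sequentially. f' n = h n)" for h
    using ev by (auto elim: eventually_elim2)
  then show "seq_class G f = seq_class G f'"
    using assms by (simp add: seq_class_def seq_eq_def)
qed

text \<open>
  The shift is defined by a union over all representatives of a class; since shifting respects
  eventual equality, a single representative suffices.
\<close>

lemma seq_shift_class:
  assumes "f \<in> UNIV \<rightarrow> carrier G"
  shows "seq_shift G (int k) (seq_class G f) =
    seq_class G (\<lambda>n. if k \<le> n then f (n - k) else \<one>\<^bsub>G\<^esub>)"
proof -
  let ?s = "\<lambda>f n. if k \<le> n then f (n - k) else \<one>\<^bsub>G\<^esub>"
  have s: "(\<lambda>n. if int n \<ge> int k then f' (nat (int n - int k)) else \<one>\<^bsub>G\<^esub>) = ?s f'" for f'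
    by (auto simp: nat_diff_distrib)
  have eq: "seq_class G (?s f') = seq_class G (?s f)" if "f' \<in> seq_class G f" for f'
  proof -
    have f': "f' \<in> UNIV \<rightarrow> carrier G" "\<forall>\<^sub>F n in sequentially. f n = f' n"
      using that by (auto simp: seq_class_def seq_eq_def)
    then obtain N where "\<And>n. n \<ge> N \<Longrightarrow> f n = f' n"
      unfolding eventually_sequentially by blast
    then have "\<forall>\<^sub>F n in sequentially. ?s f' n = ?s f n"
      unfolding eventually_sequentially by (intro exI[of _ "N + k"]) auto
    moreover have "?s f' \<in> UNIV \<rightarrow> carrier G" "?s f \<in> UNIV \<rightarrow> carrier G"
      using f'(1) assms by auto
    ultimately show ?thesis by (simp add: seq_class_eq)
  qed
  have "f \<in> seq_class G f" using assms by (simp add: seq_class_def seq_eq_def)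
  then show ?thesis unfolding seq_shift_def s using eq by blast
qed

lemma res_seq: "\<lbrakk>g \<in> carrier G; x \<in> boundary E\<rbrakk> \<Longrightarrow> (\<lambda>n. res g (bseg E x n)) \<in> UNIV \<rightarrow> carrier G"
  by (simp add: res_closed gph.bseg_in)

lemma shift_res_class:
  assumes "g \<in> carrier G" "x \<in> boundary E"
  shows "seq_shift G (int k) (res_class G E res g x) =
    seq_class G (\<lambda>n. if k \<le> n then res g (bseg E x (n - k)) else \<one>\<^bsub>G\<^esub>)"
  unfolding res_class_def by (rule seq_shift_class[OF res_seq[OF assms]])

text \<open>
  An initial segment \<open>\<beta>\<close> of the boundary path can be moved into both finite paths if \<open>g\<close> is replaced
  by its restriction to \<open>\<beta>\<close>. The sequences that define the second coordinates agree from
  \<open>|\<mu>| + |\<beta>|\<close> on, because \<open>g\<close> restricted to \<open>\<beta>\<close> followed by a segment is the restriction of \<open>g|\<^sub>\<beta>\<close> to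
  that segment.
\<close>

lemma admissible_extend:
  assumes "admissible \<mu> g \<nu> (bcat \<beta> x)" "\<beta> \<in> fpaths E" "x \<in> boundary E" "psrc E \<beta> = brng E x"
  shows "admissible (pcat \<mu> (act g \<beta>)) (res g \<beta>) (pcat \<nu> \<beta>) x"
    and "elem \<mu> g \<nu> (bcat \<beta> x) = elem (pcat \<mu> (act g \<beta>)) (res g \<beta>) (pcat \<nu> \<beta>) x"
proof -
  have r: "g \<in> carrier G" "\<mu> \<in> fpaths E" "\<nu> \<in> fpaths E"
    using assms(1) by (auto simp: admissible_def)
  have br: "brng E (bcat \<beta> x) = prng \<beta>" using gph.brng_bcat assms by simp
  have rg: "res g \<beta> \<in> carrier G" using res_closed r assms by simp
  have sn: "psrc E \<nu> = prng \<beta>" "psrc E \<mu> = prng (act g \<beta>)"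
    using assms(1,2) br prng_act[OF r(1) assms(2)] by (auto simp: admissible_def)
  have ga: "act g \<beta> \<in> fpaths E" using r assms by simp
  have "psrc E (act g \<beta>) = vact act (res g \<beta>) (brng E x)"
    using vact_res[OF r(1) assms(2)] psrc_act[OF r(1) assms(2)] assms(4) by simp
  then show "admissible (pcat \<mu> (act g \<beta>)) (res g \<beta>) (pcat \<nu> \<beta>) x"
    unfolding admissible_def using assms sn rg ga r by (simp add: gph.pcat_in psrc_pcat)
  have pl: "plen (act g \<beta>) = plen \<beta>" using plen_act r assms by simp
  have bb: "bcat \<beta> x \<in> boundary E" using gph.bcat_in assms by simp
  let ?f = "\<lambda>n. if plen \<mu> \<le> n then res g (bseg E (bcat \<beta> x) (n - plen \<mu>)) else \<one>\<^bsub>G\<^esub>"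
  let ?k = "plen \<mu> + plen \<beta>"
  let ?h = "\<lambda>n. if ?k \<le> n then res (res g \<beta>) (bseg E x (n - ?k)) else \<one>\<^bsub>G\<^esub>"
  have "?f n = ?h n" if "n \<ge> ?k" for n
  proof -
    have n: "n - plen \<mu> = plen \<beta> + (n - ?k)" using that by simp
    have "bseg E (bcat \<beta> x) (n - plen \<mu>) = pcat \<beta> (bseg E x (n - ?k))"
      unfolding n by (rule gph.bseg_bcat_add[OF assms(2,4)])
    then show ?thesis
      using that res_pcat[OF r(1) assms(2) gph.bseg_in[OF assms(3)], of "n - ?k"] assms(4) by simp
  qed
  then have ev: "\<forall>\<^sub>F n in sequentially. ?f n = ?h n"
    unfolding eventually_sequentially by blast
  have "?f \<in> UNIV \<rightarrow> carrier G" "?h \<in> UNIV \<rightarrow> carrier G"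
    using res_closed r rg assms bb by (auto simp: gph.bseg_in)
  then have "seq_shift G (int (plen \<mu>)) (res_class G E res g (bcat \<beta> x)) =
      seq_shift G (int ?k) (res_class G E res (res g \<beta>) x)"
    unfolding shift_res_class[OF r(1) bb] shift_res_class[OF rg assms(3)]
    using ev seq_class_eq by blast
  moreover have "bact E act g (bcat \<beta> x) = bcat (act g \<beta>) (bact E act (res g \<beta>) x)"
    using bact_bcat r assms by simp
  ultimately show "elem \<mu> g \<nu> (bcat \<beta> x) = elem (pcat \<mu> (act g \<beta>)) (res g \<beta>) (pcat \<nu> \<beta>) x"
    unfolding ep_elem_def by (simp add: bcat_pcat pl)
qed

lemma orb_iff: "y \<in> orb x \<longleftrightarrow> (\<exists>\<mu> g \<nu> z. admissible \<mu> g \<nu> z \<and> x = bcat \<nu> z \<and> y = bcat \<mu> (bact E act g z))"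
proof -
  have a: "arrows (ep_groupoid G E act res) = ep_arrows G E act res"
    by (simp add: ep_groupoid_def)
  have "y \<in> orb x \<longleftrightarrow> (\<exists>\<mu> g \<nu> z. admissible \<mu> g \<nu> z \<and> sr (ep_groupoid G E act res) (elem \<mu> g \<nu> z) = x \<and>
      y = rg (ep_groupoid G E act res) (elem \<mu> g \<nu> z))"
    unfolding gpd_orbit_def a ep_arrows_iff by blast
  then show ?thesis unfolding elem_proj by blast
qed

lemma orbI: "admissible \<mu> g \<nu> z \<Longrightarrow> bcat \<mu> (bact E act g z) \<in> orb (bcat \<nu> z)"
  unfolding orb_iff by blast

lemma orbE:
  assumes "y \<in> orb x"
  obtains \<mu> g \<nu> z where "admissible \<mu> g \<nu> z" "x = bcat \<nu> z" "y = bcat \<mu> (bact E act g z)"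
  using assms unfolding orb_iff by blast

lemma orb_refl [simp]: "x \<in> boundary E \<Longrightarrow> x \<in> orb x"
  using orbI[of "vtx (brng E x)" "\<one>\<^bsub>G\<^esub>" "vtx (brng E x)" x] gph.brng_in[of x]
  by (simp add: admissible_def)

lemma orb_boundary: "y \<in> orb x \<Longrightarrow> y \<in> boundary E"
  by (elim orbE) (simp add: admissibleD)

lemma orb_bcat:
  assumes "y \<in> orb x" "\<alpha> \<in> fpaths E" "psrc E \<alpha> = brng E y"
  shows "bcat \<alpha> y \<in> orb x"
proof -
  obtain \<mu> g \<nu> z where r: "admissible \<mu> g \<nu> z" "x = bcat \<nu> z" "y = bcat \<mu> (bact E act g z)"
    by (rule orbE[OF assms(1)])
  have "brng E y = prng \<mu>" using gph.brng_bcat admissibleD[OF r(1)] r(3) by simp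
  then have "admissible (pcat \<alpha> \<mu>) g \<nu> z"
    using r(1) assms gph.pcat_in[of \<alpha> \<mu>] by (simp add: admissible_def psrc_pcat)
  from orbI[OF this] show ?thesis unfolding r(2,3) bcat_pcat .
qed

lemma orb_bact:
  assumes "y \<in> orb x" "h \<in> carrier G"
  shows "bact E act h y \<in> orb x"
proof -
  obtain \<mu> g \<nu> z where r: "admissible \<mu> g \<nu> z" "x = bcat \<nu> z" "y = bcat \<mu> (bact E act g z)"
    by (rule orbE[OF assms(1)])
  note rd = admissibleD[OF r(1)]
  let ?k = "res h \<mu>"
  have k: "?k \<in> carrier G" using assms rd res_closed by simp
  have eq: "bact E act h y = bcat (act h \<mu>) (bact E act (?k \<otimes>\<^bsub>G\<^esub> g) z)"
    unfolding r(3) using bact_bcat[OF assms(2) rd(3,7,6)] bact_mult[OF k rd(2,1)] by simp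
  have "psrc E (act h \<mu>) = brng E (bact E act (?k \<otimes>\<^bsub>G\<^esub> g) z)"
    using psrc_act_bact[OF assms(2) rd(3,7,6)] bact_mult[OF k rd(2,1)] by simp
  then have "admissible (act h \<mu>) (?k \<otimes>\<^bsub>G\<^esub> g) \<nu> z"
    using rd k assms(2) by (simp add: admissible_def)
  from orbI[OF this] show ?thesis unfolding r(2) eq .
qed

text \<open>
  If the cut is made inside \<open>\<mu>\<close>, the rest of \<open>\<mu>\<close> parametrises the tail. Otherwise it falls into
  \<open>g \<cdot> z\<close>, and by applying the inverse of \<open>g\<close> the tail is seen to be the image, under a restriction
  of \<open>g\<close>, of a tail of \<open>z\<close>.
\<close>

lemma orb_tail:
  assumes "bcat \<alpha> y \<in> orb x" "\<alpha> \<in> fpaths E" "y \<in> boundary E" "psrc E \<alpha> = brng E y"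
  shows "y \<in> orb x"
proof -
  obtain \<mu> g \<nu> z where r: "admissible \<mu> g \<nu> z" "x = bcat \<nu> z" "bcat \<alpha> y = bcat \<mu> (bact E act g z)"
    by (rule orbE[OF assms(1)])
  note rd = admissibleD[OF r(1)]
  show ?thesis
  proof (cases "plen \<alpha> \<le> plen \<mu>")
    case True
    obtain \<beta> where b: "\<beta> \<in> fpaths E" "psrc E \<alpha> = prng \<beta>" "\<mu> = pcat \<alpha> \<beta>" 
      "y = bcat \<beta> (bact E act g z)" "psrc E \<beta> = brng E (bact E act g z)"
      by (rule gph.bcat_compare[OF rd(3) assms(2) rd(6) assms(4) r(3)[symmetric] True])
    then have "admissible \<beta> g \<nu> z" using rd by (simp add: admissible_def)
    from orbI[OF this] show ?thesis unfolding r(2) b(4) .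
  next
    case False
    then have le: "plen \<mu> \<le> plen \<alpha>" by simp
    obtain \<beta> where b: "\<beta> \<in> fpaths E" "psrc E \<mu> = prng \<beta>" "\<alpha> = pcat \<mu> \<beta>" 
      "bact E act g z = bcat \<beta> y" "psrc E \<beta> = brng E y"
      by (rule gph.bcat_compare[OF assms(2) rd(3) assms(4) rd(6) r(3) le])
    let ?i = "inv\<^bsub>G\<^esub> g" and ?k = "res (inv\<^bsub>G\<^esub> g) \<beta>"
    have i: "?i \<in> carrier G" using rd by simp
    have k: "?k \<in> carrier G" using i b res_closed by simp
    have z: "z = bcat (act ?i \<beta>) (bact E act ?k y)"
      using bact_bcat[OF i b(1) assms(3) b(5)] rd(1,2) b(4) by (metis bact_inv(1))
    have s: "psrc E (act ?i \<beta>) = brng E (bact E act ?k y)"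
      by (rule psrc_act_bact[OF i b(1) assms(3) b(5)])
    have ab: "act ?i \<beta> \<in> fpaths E" using i b by simp
    have "brng E z = prng (act ?i \<beta>)" unfolding z by (rule gph.brng_bcat[OF ab s])
    then have n: "psrc E \<nu> = prng (act ?i \<beta>)" using rd(5) by simp
    have "admissible (vtx (brng E y)) (inv\<^bsub>G\<^esub> ?k) (pcat \<nu> (act ?i \<beta>)) (bact E act ?k y)"
      unfolding admissible_def using n s ab rd(4) k assms(3) gph.brng_in[OF assms(3)]
      by (simp add: gph.pcat_in psrc_pcat)
    from orbI[OF this] have "y \<in> orb (bcat (pcat \<nu> (act ?i \<beta>)) (bact E act ?k y))"
      using k assms(3) by simp
    then show ?thesis unfolding r(2) bcat_pcat using z by simp
  qed
qed

lemma orb_subset: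
  assumes "y \<in> orb z" "z \<in> boundary E" "\<nu> \<in> fpaths E" "psrc E \<nu> = brng E z"
  shows "y \<in> orb (bcat \<nu> z)"
proof -
  obtain \<mu> g \<kappa> w where r: "admissible \<mu> g \<kappa> w" "z = bcat \<kappa> w" "y = bcat \<mu> (bact E act g w)"
    by (rule orbE[OF assms(1)])
  have "brng E z = prng \<kappa>" using gph.brng_bcat admissibleD[OF r(1)] r(2) by simp
  then have "admissible \<mu> g (pcat \<nu> \<kappa>) w"
    using r(1) assms gph.pcat_in[of \<nu> \<kappa>] by (simp add: admissible_def psrc_pcat)
  from orbI[OF this] show ?thesis unfolding r(2,3) bcat_pcat .
qed

end

locale pseudo_free_ssg = self_similar_graph G E act res
  for G :: "('g, 'm) monoid_scheme"
    and E :: "('v, 'e) pre_digraph"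
    and act :: "'g \<Rightarrow> ('v, 'e) path \<Rightarrow> ('v, 'e) path"
    and res :: "'g \<Rightarrow> ('v, 'e) path \<Rightarrow> 'g" +
  assumes pseudo_free: "pseudo_free G E act res"
begin

lemma pseudo_free_eq:
  assumes "g \<in> carrier G" "h \<in> carrier G" "\<mu> \<in> fpaths E" "act g \<mu> = act h \<mu>" "res g \<mu> = res h \<mu>"
  shows "g = h"
proof -
  let ?k = "inv\<^bsub>G\<^esub> g \<otimes>\<^bsub>G\<^esub> h"
  have i: "inv\<^bsub>G\<^esub> g \<in> carrier G" using assms(1) by simp
  have "act ?k \<mu> = act (inv\<^bsub>G\<^esub> g) (act g \<mu>)" 
    unfolding act_mult[OF i assms(2,3)] assms(4) ..
  then have "act ?k \<mu> = \<mu>" using act_inv(1)[OF assms(1,3)] by simp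
  moreover have "res ?k \<mu> = res (inv\<^bsub>G\<^esub> g \<otimes>\<^bsub>G\<^esub> g) \<mu>"
    unfolding res_mult[OF i assms(2,3)] res_mult[OF i assms(1,3)] assms(4,5) ..
  then have "res ?k \<mu> = \<one>\<^bsub>G\<^esub>" using res_one[OF assms(3)] assms(1) by simp
  moreover have "?k \<in> carrier G" using i assms(2) by simp
  ultimately have "?k = \<one>\<^bsub>G\<^esub>" using pseudo_free assms(3) unfolding pseudo_free_def by blast
  then have "\<one>\<^bsub>G\<^esub> = ?k" by (rule sym)
  then show ?thesis unfolding grp.inv_solve_left[OF grp.one_closed assms(1,2)] 
    using assms(1) by simp
qed

lemma res_ne_one:
  assumes "g \<in> carrier G" "\<mu> \<in> fpaths E" "act g \<mu> = \<mu>" "g \<noteq> \<one>\<^bsub>G\<^esub>"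
  shows "res g \<mu> \<noteq> \<one>\<^bsub>G\<^esub>"
  using assms pseudo_free unfolding pseudo_free_def by blast

text \<open>
  Equality in \<open>Q(G)\<close> gives equal restrictions of \<open>g\<close> and \<open>h\<close> to some long segment of \<open>x\<close>. As \<open>g\<close>
  and \<open>h\<close> also agree on that segment, pseudo-freeness applies.
\<close>

lemma elem_inj:
  assumes "admissible \<mu> g \<nu> x" "admissible \<mu> h \<nu> x" "elem \<mu> g \<nu> x = elem \<mu> h \<nu> x"
  shows "g = h"
proof -
  note g = admissibleD[OF assms(1)] and h = admissibleD[OF assms(2)]
  let ?s = "\<lambda>g n. if plen \<mu> \<le> n then res g (bseg E x (n - plen \<mu>)) else \<one>\<^bsub>G\<^esub>"
  have s: "?s g \<in> UNIV \<rightarrow> carrier G" "?s h \<in> UNIV \<rightarrow> carrier G"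
    using g(1,2) h(2) by (auto simp: res_closed gph.bseg_in)
  have 1: "bcat \<mu> (bact E act g x) = bcat \<mu> (bact E act h x)"
    and 2: "seq_class G (?s g) = seq_class G (?s h)"
    using assms(3) shift_res_class[OF g(2,1)] shift_res_class[OF h(2,1)] by (simp_all add: ep_elem_def)
  have 3: "bact E act g x = bact E act h x"
    by (rule gph.bcat_cancel(2)[OF h(3) g(3) h(6) g(6) 1[symmetric] refl])
  from 2 s have "\<forall>\<^sub>F n in sequentially. ?s g n = ?s h n" by (simp add: seq_class_eq)
  then obtain N where "\<And>n. n \<ge> N \<Longrightarrow> ?s g n = ?s h n" unfolding eventually_sequentially by blast
  from this[of "N + plen \<mu>"] have "res g (bseg E x N) = res h (bseg E x N)" by simp
  moreover have "act g (bseg E x N) = act h (bseg E x N)"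
    using bseg_bact[OF g(2,1), of N] bseg_bact[OF h(2,1), of N] 3 by simp
  ultimately show ?thesis using pseudo_free_eq[OF g(2) h(2) gph.bseg_in[OF g(1)]] by blast
qed

text \<open>
  All coincidences between parametrisations come from extension. This is what makes intersections of
  basic open sets of arrows tractable.
\<close>

lemma elem_compare:
  assumes "admissible \<mu> g \<nu> x" "admissible \<mu>' g' \<nu>' x'" "elem \<mu> g \<nu> x = elem \<mu>' g' \<nu>' x'" "plen \<nu> \<le> plen \<nu>'"
  obtains \<beta> where "\<beta> \<in> fpaths E" "psrc E \<nu> = prng \<beta>" "psrc E \<beta> = brng E x'" "x = bcat \<beta> x'"
    "\<nu>' = pcat \<nu> \<beta>" "\<mu>' = pcat \<mu> (act g \<beta>)" "g' = res g \<beta>"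
proof -
  note r = admissibleD[OF assms(1)] and r' = admissibleD[OF assms(2)]
  have eq: "bcat \<mu> (bact E act g x) = bcat \<mu>' (bact E act g' x')" "bcat \<nu>' x' = bcat \<nu> x"
    "int (plen \<mu>) - int (plen \<nu>) = int (plen \<mu>') - int (plen \<nu>')"
    using assms(3) by (simp_all add: ep_elem_def)
  obtain \<beta> where b: "\<beta> \<in> fpaths E" "psrc E \<nu> = prng \<beta>" "\<nu>' = pcat \<nu> \<beta>" "x = bcat \<beta> x'" 
    "psrc E \<beta> = brng E x'"
    by (rule gph.bcat_compare[OF r'(4) r(4) r'(5) r(5) eq(2) assms(4)])
  note ext = admissible_extend[OF assms(1)[unfolded b(4)] b(1) r'(1) b(5)]
  let ?m = "pcat \<mu> (act g \<beta>)"
  have el: "elem ?m (res g \<beta>) \<nu>' x' = elem \<mu>' g' \<nu>' x'"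
    using ext(2) assms(3) b(3,4) by simp
  have rp: "admissible ?m (res g \<beta>) \<nu>' x'" using ext(1) b(3) by simp
  note e = admissibleD[OF rp]
  have pl: "plen \<mu>' = plen ?m" using eq(3) b(3) plen_act[OF r(2) b(1)] by simp
  have "bcat ?m (bact E act (res g \<beta>) x') = bcat \<mu>' (bact E act g' x')"
    using el by (simp add: ep_elem_def)
  from gph.bcat_cancel(1)[OF e(3) r'(3) e(6) r'(6) this pl] have m: "\<mu>' = ?m" .
  have "g' = res g \<beta>" using elem_inj[of ?m "res g \<beta>" \<nu>' x' g'] rp assms(2) el m by simp
  then show ?thesis using that[OF b(1,2,5,4,3) m] by blast
qed

end


section \<open>Neighbourhoods of arrows and orbit closures\<close>

lemma bseg_plen: "bseg E x (plen (bseg E x n)) = bseg E x n"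
  by (cases x) (simp_all add: plen_def min_def)

context wf_digraph
begin

lemma boundary_first_edge:
  assumes "z \<in> boundary G" "z \<noteq> FinP (vtx (brng G z))"
  obtains e w where "e \<in> arcs G" "head G e = brng G z" "w \<in> boundary G" "brng G w = tail G e"
    "z = bcat (head G e, [e]) w" "bseg G z 1 = (head G e, [e])"
proof -
  have "enat 1 \<le> blen z"
  proof (cases z)
    case (FinP \<alpha>)
    have "snd \<alpha> \<noteq> []" using assms(2) FinP by (auto simp: vtx_def prng_def prod_eq_iff)
    then have "1 \<le> plen \<alpha>" by (simp add: plen_def Suc_le_eq)
    then show ?thesis using FinP by simp
  qed simp
  from boundary_split[OF assms(1) this] obtain w where w: "w \<in> boundary G" 
    "brng G w = psrc G (bseg G z 1)" "z = bcat (bseg G z 1) w" "plen (bseg G z 1) = 1" .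
  obtain v e where ve: "bseg G z 1 = (v, [e])"
    using w(4) by (cases "bseg G z 1"; cases "snd (bseg G z 1)") (auto simp: plen_def)
  have "(v, [e]) \<in> fpaths G" using bseg_in[OF assms(1), of 1] ve by simp
  then have e: "e \<in> arcs G" "head G e = v" by (simp_all add: fpaths_Cons)
  have "v = brng G z" using prng_bseg[of G z 1] ve by (simp add: prng_def)
  moreover have "brng G w = tail G e" using w(2) unfolding ve by (simp add: psrc_def)
  moreover have "z = bcat (head G e, [e]) w" "bseg G z 1 = (head G e, [e])"
    using w(3) unfolding ve e(2) by blast+
  ultimately show ?thesis using that[OF e(1) _ w(1)] e(2) by blast
qed

lemma edge_paths_from:
  assumes "e \<in> edges_from G v M"
  shows "(v, [e]) \<in> paths_from G v (verts G)"
proof -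
  have e: "e \<in> arcs G" "head G e = v" using assms by (auto simp: edges_from_def)
  show ?thesis
    unfolding paths_from_def using edge_path(1)[OF e(1)] edge_path(2)[OF e(1), of v] e by (simp add: prng_def)
qed

lemma bcat_cyl:
  assumes "\<beta> \<in> fpaths G" "z \<in> boundary G" "psrc G \<beta> = brng G z" "prng \<phi> = brng G z"
  shows "bcat \<beta> z \<in> cyl G (pcat \<beta> \<phi>) \<longleftrightarrow> z \<in> cyl G \<phi>"
proof -
  have "pcat \<beta> (bseg G z (plen \<phi>)) = pcat \<beta> \<phi> \<longleftrightarrow> bseg G z (plen \<phi>) = \<phi>"
    using prng_bseg[of G z "plen \<phi>"] assms(4) by (auto simp: pcat_def prng_def prod_eq_iff)
  then show ?thesis
    unfolding cyl_def using assms bcat_in[OF assms(1-3)] bseg_bcat_add[OF assms(1,3), of "plen \<phi>"]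
    by simp
qed

lemma cyl_cong:
  assumes "z \<in> boundary G" "x \<in> boundary G" "bseg G z (plen \<phi>) = bseg G x (plen \<phi>)"
  shows "z \<in> cyl G \<phi> \<longleftrightarrow> x \<in> cyl G \<phi>"
  using assms by (simp add: cyl_def)

lemma cyl_minus_vtx:
  assumes "F \<subseteq> paths_from G w (verts G)"
  shows "z \<in> cyl_minus G F (vtx w) \<longleftrightarrow> 
    z \<in> boundary G \<and> brng G z = w \<and> (\<forall>\<phi>\<in>F. z \<notin> cyl G \<phi>)"
proof -
  have "pcat (vtx w) \<phi> = \<phi>" if "\<phi> \<in> F" for \<phi>
    using assms that pcat_vtx(2)[of \<phi>] by (auto simp: paths_from_def)
  then show ?thesis by (auto simp: cyl_minus_def cyl_vtx)
qed

lemma openin_cyl_minus: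
  assumes "\<alpha> \<in> fpaths G" "finite F" "F \<subseteq> paths_from G (psrc G \<alpha>) (verts G)"
  shows "openin (boundary_top G) (cyl_minus G F \<alpha>)"
  unfolding boundary_top_def by (rule topology_generated_by_Basis) (use assms in blast)

lemma cyl_minus_empty: "cyl_minus G {} \<alpha> = cyl G \<alpha>"
  by (simp add: cyl_minus_def)

lemma boundary_subset_topspace: "boundary G \<subseteq> topspace (boundary_top G)"
proof
  fix x assume x: "x \<in> boundary G"
  have "openin (boundary_top G) (cyl_minus G {} (vtx (brng G x)))"
    using brng_in[OF x] by (intro openin_cyl_minus) simp_all
  moreover have "x \<in> cyl_minus G {} (vtx (brng G x))"
    unfolding cyl_minus_empty cyl_vtx using x by simp
  ultimately show "x \<in> topspace (boundary_top G)" using openin_subset by blast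
qed

end

context self_similar_graph
begin

abbreviation orb_closure where
  "orb_closure x \<equiv> boundary_top E closure_of orb x"

abbreviation ptail where
  "ptail \<equiv> point_tail G E act res"

lemma orb_subset_closure: "orb x \<subseteq> orb_closure x"
  by (rule closure_of_subset) (use gph.boundary_subset_topspace orb_boundary in blast)

lemma closure_meets:
  assumes "y \<in> orb_closure x" "\<alpha> \<in> fpaths E" "finite F" "F \<subseteq> paths_from E (psrc E \<alpha>) (verts E)"
    "y \<in> cyl_minus E F \<alpha>"
  obtains z where "z \<in> orb x" "z \<in> cyl_minus E F \<alpha>"
  using assms gph.openin_cyl_minus[OF assms(2-4)] unfolding in_closure_of by blast

lemma closure_boundary:
  assumes "y \<in> orb_closure x" shows "y \<in> boundary E"
proof -
  have "topspace (boundary_top E) \<subseteq> boundary E"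
    unfolding boundary_top_def topology_generated_by_topspace 
    by (auto simp: cyl_minus_def cyl_def)
  then show ?thesis using assms unfolding in_closure_of by blast
qed

text \<open>
  The cylinder set of an initial segment is a neighbourhood, so it contains an orbit element, and
  the tail of that element at the end of the segment lies in the orbit as well.
\<close>

lemma closure_vertices:
  assumes "y \<in> orb_closure x"
  shows "psrc E (bseg E y n) \<in> ptail x"
proof -
  let ?a = "bseg E y n"
  have y: "y \<in> boundary E" by (rule closure_boundary[OF assms])
  then have a: "?a \<in> fpaths E" by (rule gph.bseg_in)
  have "y \<in> cyl_minus E {} ?a"
    unfolding gph.cyl_minus_empty cyl_def using y bseg_plen by blast
  from closure_meets[OF assms a _ _ this] obtain z where z: "z \<in> orb x" "z \<in> cyl_minus E {} ?a"
    by blast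
  then have "z \<in> cyl E ?a" unfolding gph.cyl_minus_empty by blast
  then obtain w where w: "w \<in> boundary E" "psrc E ?a = brng E w" "z = bcat ?a w"
    unfolding gph.cyl_iff[OF a] by blast
  have "w \<in> orb x" using orb_tail[of ?a w x] z(1) w a by simp
  then show ?thesis unfolding point_tail_def w(2) by blast
qed

lemma ptail_vertices: "y \<in> orb x \<Longrightarrow> psrc E (bseg E y n) \<in> ptail x"
  using closure_vertices orb_subset_closure by blast

lemma brng_ptail: "y \<in> orb x \<Longrightarrow> brng E y \<in> ptail x"
  unfolding point_tail_def by blast

text \<open>
  If the source of \<open>\<alpha>\<close> received only finitely many edges from the tail, then excluding them would
  give a neighbourhood of \<open>\<alpha>\<close> whose only possible orbit element is \<open>\<alpha>\<close> itself.
\<close>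

lemma closure_finite_path:
  assumes "FinP \<alpha> \<in> orb_closure x" "FinP \<alpha> \<notin> orb x"
  shows "infinite (edges_from E (psrc E \<alpha>) (ptail x))"
proof
  let ?w = "psrc E \<alpha>"
  assume fin: "finite (edges_from E ?w (ptail x))"
  let ?F = "(\<lambda>e. (?w, [e])) ` edges_from E ?w (ptail x)"
  have bd: "FinP \<alpha> \<in> boundary E" by (rule closure_boundary[OF assms(1)])
  then have a: "\<alpha> \<in> fpaths E" by (simp add: gph.boundary_FinP)
  have F: "?F \<subseteq> paths_from E ?w (verts E)"
    using gph.edge_paths_from by blast
  have "FinP \<alpha> \<in> cyl_minus E ?F \<alpha>"
    using bd by (auto simp: cyl_minus_def cyl_def plen_def pcat_def prod_eq_iff)
  from closure_meets[OF assms(1) a _ F this] fin obtain z where z: "z \<in> orb x" 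
    "z \<in> cyl_minus E ?F \<alpha>" by blast
  then have "z \<in> cyl E \<alpha>" unfolding cyl_minus_def by blast
  then obtain w where w: "w \<in> boundary E" "?w = brng E w" "z = bcat \<alpha> w"
    unfolding gph.cyl_iff[OF a] by blast
  have wo: "w \<in> orb x" using orb_tail[of \<alpha> w x] z(1) w a by simp
  show False
  proof (cases "w = FinP (vtx (brng E w))")
    case True
    have "z = FinP \<alpha>" unfolding w(3) by (subst True) simp
    then show False using z(1) assms(2) by simp
  next
    case False
    obtain e u where e: "e \<in> arcs E" "head E e = brng E w" "u \<in> boundary E" 
      "brng E u = tail E e" "w = bcat (head E e, [e]) u" "bseg E w 1 = (head E e, [e])"
      by (rule gph.boundary_first_edge[OF w(1) False])
    have "tail E e \<in> ptail x"
      using ptail_vertices[OF wo, of 1] unfolding e(6) by (simp add: psrc_def)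
    then have "(?w, [e]) \<in> ?F" using e(1,2) w(2) by (auto simp: edges_from_def)
    moreover have "w \<in> cyl E (?w, [e])" using w(1,2) e(2,6) by (simp add: cyl_def plen_def)
    then have "z \<in> cyl E (pcat \<alpha> (?w, [e]))"
      unfolding w(3) using gph.bcat_cyl[OF a w(1,2), of "(?w, [e])"] w(2) by (simp add: prng_def)
    ultimately show False using z(2) unfolding cyl_minus_def by blast
  qed
qed

lemma bact_bcat_fixed:
  assumes "h \<in> carrier G" "\<beta> \<in> fpaths E" "z \<in> boundary E" "psrc E \<beta> = brng E z"
    "bact E act h (bcat \<beta> z) = bcat \<beta> z"
  shows "act h \<beta> = \<beta>" "bact E act (res h \<beta>) z = z"
proof -
  have eq: "bcat (act h \<beta>) (bact E act (res h \<beta>) z) = bcat \<beta> z"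
    using bact_bcat[OF assms(1-4)] assms(5) by simp
  have 1: "act h \<beta> \<in> fpaths E" "plen \<beta> = plen (act h \<beta>)" using assms plen_act by simp_all
  note s = psrc_act_bact[OF assms(1-4)]
  show "act h \<beta> = \<beta>" using gph.bcat_cancel(1)[OF 1(1) assms(2) s assms(4) eq 1(2)] by simp
  show "bact E act (res h \<beta>) z = z" 
    using gph.bcat_cancel(2)[OF 1(1) assms(2) s assms(4) eq 1(2)] by simp
qed

text \<open>
  The inclusion of the arrows of \<open>U\<close> with range in \<open>C\<close> in the isotropy bundle, in terms of
  parametrisations.
\<close>

definition isotropic_on where
  "isotropic_on U C \<longleftrightarrow> (\<forall>\<mu> g \<nu> y. admissible \<mu> g \<nu> y \<longrightarrow> elem \<mu> g \<nu> y \<in> U \<longrightarrow>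
     bcat \<mu> (bact E act g y) \<in> C \<longrightarrow> bcat \<mu> (bact E act g y) = bcat \<nu> y)"

lemma isotropic_onD:
  "\<lbrakk>isotropic_on U C; admissible \<mu> g \<nu> y; elem \<mu> g \<nu> y \<in> U; bcat \<mu> (bact E act g y) \<in> C\<rbrakk>
    \<Longrightarrow> bcat \<mu> (bact E act g y) = bcat \<nu> y"
  unfolding isotropic_on_def by blast

lemma interior_fiberE:
  assumes "a \<in> iso_interior_fiber (ep_groupoid G E act res) C x"
  obtains U \<mu> g \<nu> y where "openin (arrows_top (ep_groupoid G E act res)) U" "a \<in> U" 
    "admissible \<mu> g \<nu> y" "a = elem \<mu> g \<nu> y" "bcat \<nu> y = x" "bcat \<mu> (bact E act g y) = x"
    "isotropic_on U C"
proof -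
  let ?EP = "ep_groupoid G E act res"
  have ar: "arrows ?EP = ep_arrows G E act res" by (simp add: ep_groupoid_def)
  obtain T where T: "openin (subtopology (arrows_top ?EP) (gpd_reduction ?EP C)) T" "a \<in> T"
    "T \<subseteq> iso_bundle ?EP C" and rga: "rg ?EP a = x"
    using assms unfolding iso_interior_fiber_def interior_of_def by blast
  obtain U where U: "openin (arrows_top ?EP) U" "T = U \<inter> gpd_reduction ?EP C"
    using T(1) unfolding openin_subtopology by blast
  have iso0: "bcat \<mu> (bact E act g y) = bcat \<nu> y"
    if "admissible \<mu> g \<nu> y" "elem \<mu> g \<nu> y \<in> U" "bcat \<mu> (bact E act g y) \<in> C" for \<mu> g \<nu> y
  proof -
    have "elem \<mu> g \<nu> y \<in> ep_arrows G E act res" unfolding ep_arrows_iff using that(1) by blast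
    then have "elem \<mu> g \<nu> y \<in> T"
      unfolding U(2) gpd_reduction_def ar using that by (simp add: elem_proj)
    then have "rg ?EP (elem \<mu> g \<nu> y) = sr ?EP (elem \<mu> g \<nu> y)"
      using T(3) unfolding iso_bundle_def by blast
    then show ?thesis unfolding elem_proj .
  qed
  then have iso: "isotropic_on U C" unfolding isotropic_on_def by blast
  have red: "a \<in> gpd_reduction ?EP C" using T(2) U(2) by blast
  then obtain \<mu> g \<nu> y where r: "admissible \<mu> g \<nu> y" "a = elem \<mu> g \<nu> y"
    unfolding gpd_reduction_def ar ep_arrows_iff by blast
  have mx: "bcat \<mu> (bact E act g y) = x" using rga unfolding r(2) elem_proj .
  have "x \<in> C" using red rga unfolding gpd_reduction_def by blast
  then have "bcat \<nu> y = x" using isotropic_onD[OF iso r(1)] r(2) T(2) U(2) mx by simp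
  then show ?thesis using that[OF U(1) _ r _ mx iso] T(2) U(2) by blast
qed

end

context pseudo_free_ssg
begin

text \<open>
  The arrows near \<open>elem \<mu> g \<nu> x\<close> are the \<open>elem \<mu> g \<nu> z\<close> with \<open>z\<close> near \<open>x\<close>. Nearness is expressed
  by finitely many cylinder sets each of which contains both or neither of \<open>x\<close> and \<open>z\<close>: in this form
  neighbourhoods are stable under intersections, so that only subbasic sets have to be examined. For
  these, the given parametrisation and that of the subbasic set are compared by extension.
\<close>

lemma arrow_neighbourhood:
  assumes "openin (arrows_top (ep_groupoid G E act res)) U" "admissible \<mu> g \<nu> x" "elem \<mu> g \<nu> x \<in> U"
  obtains S where "finite S" 
    "\<And>z. \<lbrakk>z \<in> boundary E; brng E z = brng E x; \<forall>\<alpha>\<in>S. z \<in> cyl E \<alpha> \<longleftrightarrow> x \<in> cyl E \<alpha>\<rbrakk>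
       \<Longrightarrow> elem \<mu> g \<nu> z \<in> U"
proof -
  have "generate_topology_on (ep_basis G E act res) U"
    using assms(1) by (simp add: ep_groupoid_def openin_topology_generated_by_iff)
  then have "elem \<mu> g \<nu> x \<in> U \<Longrightarrow> \<exists>S. finite S \<and> (\<forall>z\<in>boundary E. brng E z = brng E x \<longrightarrow>
      (\<forall>\<alpha>\<in>S. z \<in> cyl E \<alpha> \<longleftrightarrow> x \<in> cyl E \<alpha>) \<longrightarrow> elem \<mu> g \<nu> z \<in> U)"
  proof (induction rule: generate_topology_on.induct)
    case (Int U V)
    then obtain S T where "finite S" "finite T"
      "\<forall>z\<in>boundary E. brng E z = brng E x \<longrightarrow>
         (\<forall>\<alpha>\<in>S. z \<in> cyl E \<alpha> \<longleftrightarrow> x \<in> cyl E \<alpha>) \<longrightarrow> elem \<mu> g \<nu> z \<in> U"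
      "\<forall>z\<in>boundary E. brng E z = brng E x \<longrightarrow>
         (\<forall>\<alpha>\<in>T. z \<in> cyl E \<alpha> \<longleftrightarrow> x \<in> cyl E \<alpha>) \<longrightarrow> elem \<mu> g \<nu> z \<in> V"
      by blast
    then show ?case by (intro exI[of _ "S \<union> T"]) blast
  next
    case (UN K)
    then obtain k where "k \<in> K" "elem \<mu> g \<nu> x \<in> k" by blast
    with UN.IH[OF this] show ?case by blast
  next
    case (Basis B)
    then obtain \<mu>' g' \<nu>' F where B: "B = elem \<mu>' g' \<nu>' ` cyl_minus E F (vtx (psrc E \<nu>'))"
      "g' \<in> carrier G" "\<mu>' \<in> fpaths E" "\<nu>' \<in> fpaths E" "psrc E \<mu>' = vact act g' (psrc E \<nu>')"
      "finite F" "F \<subseteq> paths_from E (psrc E \<nu>') (verts E)"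
      unfolding ep_basis_def by blast
    then obtain x' where x': "x' \<in> cyl_minus E F (vtx (psrc E \<nu>'))" 
      "elem \<mu> g \<nu> x = elem \<mu>' g' \<nu>' x'" using Basis(2) by blast
    have x'b: "x' \<in> boundary E" "brng E x' = psrc E \<nu>'" "\<And>\<phi>. \<phi> \<in> F \<Longrightarrow> x' \<notin> cyl E \<phi>"
      using x'(1) unfolding gph.cyl_minus_vtx[OF B(7)] by auto
    have r': "admissible \<mu>' g' \<nu>' x'" using B x'b by (simp add: admissible_def)
    have xb: "x \<in> boundary E" using admissibleD[OF assms(2)] by simp
    have Fr: "prng \<phi> = psrc E \<nu>'" if "\<phi> \<in> F" for \<phi>
      using B(7) that by (auto simp: paths_from_def)
    show ?case
    proof (cases "plen \<nu> \<le> plen \<nu>'")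
      case True
      obtain \<beta> where b: "\<beta> \<in> fpaths E" "psrc E \<nu> = prng \<beta>" "psrc E \<beta> = brng E x'" 
        "x = bcat \<beta> x'" "\<nu>' = pcat \<nu> \<beta>" "\<mu>' = pcat \<mu> (act g \<beta>)" "g' = res g \<beta>"
        by (rule elem_compare[OF assms(2) r' x'(2) True])
      have xc: "x \<in> cyl E \<beta>" unfolding gph.cyl_iff[OF b(1)] using b x'b by blast
      show ?thesis
      proof (intro exI[of _ "insert \<beta> (pcat \<beta> ` F)"] conjI ballI impI)
        show "finite (insert \<beta> (pcat \<beta> ` F))" using B by simp
        fix z assume z: "z \<in> boundary E" "brng E z = brng E x" 
          "\<forall>\<alpha>\<in>insert \<beta> (pcat \<beta> ` F). z \<in> cyl E \<alpha> \<longleftrightarrow> x \<in> cyl E \<alpha>"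
        then have "z \<in> cyl E \<beta>" using xc by blast
        then obtain w where w: "w \<in> boundary E" "psrc E \<beta> = brng E w" "z = bcat \<beta> w"
          unfolding gph.cyl_iff[OF b(1)] by blast
        have wb: "brng E w = psrc E \<nu>'" using w(2) b(3) x'b(2) by simp
        have rz: "admissible \<mu> g \<nu> (bcat \<beta> w)" using admissible_cong[OF assms(2) z(1,2)] w(3) by simp
        have el: "elem \<mu> g \<nu> z = elem \<mu>' g' \<nu>' w"
          using admissible_extend(2)[OF rz b(1) w(1,2)] w(3) b(5-7) by simp
        have "w \<notin> cyl E \<phi>" if "\<phi> \<in> F" for \<phi>
        proof
          assume "w \<in> cyl E \<phi>"
          then have "z \<in> cyl E (pcat \<beta> \<phi>)"
            unfolding w(3) using gph.bcat_cyl[OF b(1) w(1,2)] Fr[OF that] wb by simp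
          then have "x \<in> cyl E (pcat \<beta> \<phi>)" using z(3) that by blast
          then have "x' \<in> cyl E \<phi>"
            using gph.bcat_cyl[OF b(1) x'b(1) b(3)] Fr[OF that] x'b(2) b(4) by simp
          then show False using x'b(3) that by blast
        qed
        then have "w \<in> cyl_minus E F (vtx (psrc E \<nu>'))"
          unfolding gph.cyl_minus_vtx[OF B(7)] using w(1) wb by blast
        then show "elem \<mu> g \<nu> z \<in> B" unfolding B(1) el by blast
      qed
    next
      case False
      then have le: "plen \<nu>' \<le> plen \<nu>" by simp
      obtain \<beta> where b: "\<beta> \<in> fpaths E" "psrc E \<nu>' = prng \<beta>" "psrc E \<beta> = brng E x" 
        "x' = bcat \<beta> x" "\<nu> = pcat \<nu>' \<beta>" "\<mu> = pcat \<mu>' (act g' \<beta>)" "g = res g' \<beta>"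
        by (rule elem_compare[OF r' assms(2) x'(2)[symmetric] le])
      let ?S = "(\<lambda>\<phi>. (brng E x, drop (plen \<beta>) (snd \<phi>))) ` F"
      show ?thesis
      proof (intro exI[of _ ?S] conjI ballI impI)
        show "finite ?S" using B by simp
        fix z assume z: "z \<in> boundary E" "brng E z = brng E x" 
          "\<forall>\<alpha>\<in>?S. z \<in> cyl E \<alpha> \<longleftrightarrow> x \<in> cyl E \<alpha>"
        have bz: "psrc E \<beta> = brng E z" using b(3) z(2) by simp
        have bzb: "bcat \<beta> z \<in> boundary E" by (rule gph.bcat_in[OF b(1) z(1) bz])
        have br: "brng E (bcat \<beta> z) = psrc E \<nu>'" using gph.brng_bcat[OF b(1) bz] b(2) by simp
        have rz: "admissible \<mu>' g' \<nu>' (bcat \<beta> z)" using admissible_cong[OF r' bzb] br x'b(2) by simp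
        have el: "elem \<mu> g \<nu> z = elem \<mu>' g' \<nu>' (bcat \<beta> z)"
          using admissible_extend(2)[OF rz b(1) z(1) bz] b(5-7) by simp
        have "bcat \<beta> z \<notin> cyl E \<phi>" if \<phi>: "\<phi> \<in> F" for \<phi>
        proof
          assume c: "bcat \<beta> z \<in> cyl E \<phi>"
          have "bcat \<beta> x \<in> cyl E \<phi>"
          proof (cases "plen \<phi> \<le> plen \<beta>")
            case True
            have "bseg E (bcat \<beta> z) (plen \<phi>) = bseg E (bcat \<beta> x) (plen \<phi>)"
              using gph.bseg_bcat_le[OF b(1) bz True] gph.bseg_bcat_le[OF b(1,3) True] by simp
            from gph.cyl_cong[OF bzb _ this] x'b(1) b(4) c show ?thesis by simp
          next
            case False
            let ?\<psi> = "(brng E x, drop (plen \<beta>) (snd \<phi>))"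
            have ph: "\<phi> = bseg E (bcat \<beta> z) (plen \<phi>)" using c by (simp add: cyl_def)
            have k: "plen \<phi> = plen \<beta> + plen ?\<psi>" using False by (simp add: plen_def)
            have sn: "snd \<phi> = snd \<beta> @ snd (bseg E z (plen ?\<psi>))"
              using arg_cong[OF ph, of snd] gph.bseg_bcat_add[OF b(1) bz, of "plen ?\<psi>"] k by simp
            have "snd \<phi> = snd \<beta> @ drop (plen \<beta>) (snd \<phi>)"
              using sn by (metis append_eq_conv_conj plen_def)
            moreover have "fst \<phi> = fst \<beta>" using Fr[OF \<phi>] b(2) by (simp add: prng_def)
            ultimately have pp: "\<phi> = pcat \<beta> ?\<psi>"
              unfolding pcat_def snd_conv by (metis prod.collapse)
            have "z \<in> cyl E ?\<psi>"
              using c gph.bcat_cyl[OF b(1) z(1) bz, of ?\<psi>] z(2) unfolding pp[symmetric]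
              by (simp add: prng_def)
            moreover have "?\<psi> \<in> ?S" using \<phi> by blast
            ultimately have "x \<in> cyl E ?\<psi>" using z(3) by blast
            then show ?thesis
              using gph.bcat_cyl[OF b(1) xb b(3), of ?\<psi>] unfolding pp[symmetric]
              by (simp add: prng_def)
          qed
          then show False using x'b(3)[OF \<phi>] b(4) by simp
        qed
        then have "bcat \<beta> z \<in> cyl_minus E F (vtx (psrc E \<nu>'))"
          unfolding gph.cyl_minus_vtx[OF B(7)] using bzb br by blast
        then show "elem \<mu> g \<nu> z \<in> B" unfolding B(1) el by blast
      qed
    qed
  qed simp
  then show ?thesis using assms(3) that by blast
qed

end


section \<open>Essentially central isotropy as absence of locally trivial elements\<close>

context self_similar_graph
begin

abbreviation fiber where
  "fiber x \<equiv> iso_interior_fiber (ep_groupoid G E act res) (orb_closure x) x"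

text \<open>
  The group of integers is its own center, which leaves the injectivity.
\<close>

lemma eci_iff:
  "essentially_central_isotropy integer_group (ep_groupoid G E act res) ep_degree \<longleftrightarrow>
    (\<forall>x\<in>boundary E. inj_on ep_degree (fiber x))"
proof -
  have "group_center integer_group = UNIV"
    by (simp add: group_center_def integer_group_def)
  moreover have "units (ep_groupoid G E act res) = boundary E"
    "units_top (ep_groupoid G E act res) = boundary_top E"
    by (simp_all add: ep_groupoid_def)
  ultimately show ?thesis by (simp add: essentially_central_isotropy_def Let_def)
qed

end

context pseudo_free_ssg
begin

text \<open>
  After extension of the shorter parametrisation, the two arrows become \<open>elem \<mu>' k \<nu>' y'\<close> and
  \<open>elem \<mu>' g' \<nu>' y'\<close>. Isotropy of the arrows nearby, with \<open>w\<close> in place of \<open>y'\<close>, says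
  \<open>\<mu>' (k \<cdot> w) = \<nu>' w = \<mu>' (g' \<cdot> w)\<close>, so that \<open>k\<^sup>-\<^sup>1 g'\<close> fixes \<open>w\<close>. It suffices to consider \<open>w\<close> in
  the orbit of \<open>y'\<close>, for which the range condition of the reduction is automatic.
\<close>

lemma fixing_element_ordered:
  assumes x: "x \<in> boundary E"
    and U: "openin (arrows_top (ep_groupoid G E act res)) U" "elem \<mu> g \<nu> y \<in> U" "admissible \<mu> g \<nu> y" 
      "bcat \<nu> y = x" "bcat \<mu> (bact E act g y) = x"
      "isotropic_on U (orb_closure x)"
    and V: "openin (arrows_top (ep_groupoid G E act res)) V" "elem \<mu>' g' \<nu>' y' \<in> V" "admissible \<mu>' g' \<nu>' y'" 
      "bcat \<nu>' y' = x" "bcat \<mu>' (bact E act g' y') = x"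
      "isotropic_on V (orb_closure x)"
    and ne: "elem \<mu> g \<nu> y \<noteq> elem \<mu>' g' \<nu>' y'"
    and deg: "ep_degree (elem \<mu> g \<nu> y) = ep_degree (elem \<mu>' g' \<nu>' y')"
    and le: "plen \<nu> \<le> plen \<nu>'"
  shows "\<exists>z\<in>boundary E. \<exists>h\<in>carrier G. \<exists>S. h \<noteq> \<one>\<^bsub>G\<^esub> \<and> finite S \<and>
    (\<forall>w\<in>orb z. brng E w = brng E z \<longrightarrow> (\<forall>\<alpha>\<in>S. w \<in> cyl E \<alpha> \<longleftrightarrow> z \<in> cyl E \<alpha>) \<longrightarrow> bact E act h w = w)"
proof -
  note r = admissibleD[OF U(3)] and r' = admissibleD[OF V(3)]
  have eq: "bcat \<nu>' y' = bcat \<nu> y" using U(4) V(4) by simp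
  obtain \<beta> where b: "\<beta> \<in> fpaths E" "psrc E \<nu> = prng \<beta>" "\<nu>' = pcat \<nu> \<beta>" "y = bcat \<beta> y'" 
    "psrc E \<beta> = brng E y'"
    by (rule gph.bcat_compare[OF r'(4) r(4) r'(5) r(5) eq le])
  let ?g = "res g \<beta>"
  note ext = admissible_extend[OF U(3)[unfolded b(4)] b(1) r'(1) b(5)]
  have rp: "admissible (pcat \<mu> (act g \<beta>)) ?g \<nu>' y'" using ext(1) b(3) by simp
  have el: "elem \<mu> g \<nu> y = elem (pcat \<mu> (act g \<beta>)) ?g \<nu>' y'" using ext(2) b(3,4) by simp
  have pl: "plen \<mu>' = plen (pcat \<mu> (act g \<beta>))"
    using deg plen_act[OF r(2) b(1)] b(3) by (simp add: elem_proj)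
  have "bcat (pcat \<mu> (act g \<beta>)) (bact E act ?g y') = bcat \<mu> (bact E act g y)"
    using arg_cong[OF el, of fst] by (simp add: ep_elem_def)
  then have "bcat (pcat \<mu> (act g \<beta>)) (bact E act ?g y') = bcat \<mu>' (bact E act g' y')"
    using U(5) V(5) by simp
  from gph.bcat_cancel(1)[OF admissibleD(3)[OF rp] r'(3) admissibleD(6)[OF rp] r'(6) this pl]
  have m: "pcat \<mu> (act g \<beta>) = \<mu>'" by simp
  have rep1: "admissible \<mu>' ?g \<nu>' y'" and el1: "elem \<mu> g \<nu> y = elem \<mu>' ?g \<nu>' y'"
    using rp el m by simp_all
  have gc: "?g \<in> carrier G" "g' \<in> carrier G" using admissibleD[OF rep1] r' by simp_all
  have gne: "?g \<noteq> g'" using ne el1 by auto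
  obtain S where S: "finite S" "\<And>z. \<lbrakk>z \<in> boundary E; brng E z = brng E y'; 
      \<forall>\<alpha>\<in>S. z \<in> cyl E \<alpha> \<longleftrightarrow> y' \<in> cyl E \<alpha>\<rbrakk> \<Longrightarrow> elem \<mu>' ?g \<nu>' z \<in> U"
    using arrow_neighbourhood[OF U(1) rep1] U(2) unfolding el1 by blast
  obtain T where T: "finite T" "\<And>z. \<lbrakk>z \<in> boundary E; brng E z = brng E y'; 
      \<forall>\<alpha>\<in>T. z \<in> cyl E \<alpha> \<longleftrightarrow> y' \<in> cyl E \<alpha>\<rbrakk> \<Longrightarrow> elem \<mu>' g' \<nu>' z \<in> V"
    using arrow_neighbourhood[OF V(1) V(3) V(2)] by blast
  let ?h = "inv\<^bsub>G\<^esub> ?g \<otimes>\<^bsub>G\<^esub> g'"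
  have hc: "?h \<in> carrier G" using gc by simp
  have "?h \<noteq> \<one>\<^bsub>G\<^esub>"
  proof
    assume "?h = \<one>\<^bsub>G\<^esub>"
    then have "\<one>\<^bsub>G\<^esub> = ?h" by (rule sym)
    then show False 
      using gne gc unfolding grp.inv_solve_left[OF grp.one_closed gc] by simp
  qed
  moreover have "bact E act ?h w = w" if w: "w \<in> orb y'" "brng E w = brng E y'"
    "\<forall>\<alpha>\<in>S \<union> T. w \<in> cyl E \<alpha> \<longleftrightarrow> y' \<in> cyl E \<alpha>" for w
  proof -
    have wb: "w \<in> boundary E" by (rule orb_boundary[OF w(1)])
    \<comment> \<open>The ranges of the nearby arrows stay in the orbit of \<open>x\<close>, hence in its closure.\<close>
    have in_cl: "bcat \<mu>' (bact E act k w) \<in> orb_closure x" if "admissible \<mu>' k \<nu>' w" for k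
    proof -
      note rk = admissibleD[OF that]
      have "bcat \<mu>' (bact E act k w) \<in> orb y'"
        by (rule orb_bcat[OF orb_bact[OF w(1) rk(2)] rk(3,6)])
      then have "bcat \<mu>' (bact E act k w) \<in> orb (bcat \<nu>' y')"
        by (rule orb_subset[OF _ r'(1,4,5)])
      then show ?thesis using orb_subset_closure V(4) by blast
    qed
    have rw: "admissible \<mu>' ?g \<nu>' w" "admissible \<mu>' g' \<nu>' w"
      using admissible_cong[OF rep1 wb w(2)] admissible_cong[OF V(3) wb w(2)] by blast+
    have "elem \<mu>' ?g \<nu>' w \<in> U" "elem \<mu>' g' \<nu>' w \<in> V"
      using S(2)[OF wb w(2)] T(2)[OF wb w(2)] w(3) by blast+
    from isotropic_onD[OF U(6) rw(1) this(1) in_cl[OF rw(1)]] isotropic_onD[OF V(6) rw(2) this(2) in_cl[OF rw(2)]]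
    have e: "bcat \<mu>' (bact E act ?g w) = bcat \<mu>' (bact E act g' w)" by simp
    have "bact E act g' w = bact E act ?g w"
      by (rule gph.bcat_cancel(2)[OF r'(3) r'(3) admissibleD(6)[OF rw(1)] admissibleD(6)[OF rw(2)] e refl])
    then show ?thesis using bact_mult[of "inv\<^bsub>G\<^esub> ?g" g' w] gc wb by simp
  qed
  ultimately show ?thesis using r'(1) hc S(1) T(1) 
    by (intro bexI[of _ y'] bexI[of _ ?h] exI[of _ "S \<union> T"] conjI) auto
qed

lemma fixing_element:
  assumes "x \<in> boundary E" "\<not> inj_on ep_degree (fiber x)"
  obtains z h S where "z \<in> boundary E" "h \<in> carrier G" "h \<noteq> \<one>\<^bsub>G\<^esub>" "finite S" 
    "\<And>w. \<lbrakk>w \<in> orb z; brng E w = brng E z; \<forall>\<alpha>\<in>S. w \<in> cyl E \<alpha> \<longleftrightarrow> z \<in> cyl E \<alpha>\<rbrakk> \<Longrightarrow> bact E act h w = w"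
proof -
  obtain a b where ab: "a \<in> fiber x" "b \<in> fiber x" "a \<noteq> b" "ep_degree a = ep_degree b"
    using assms(2) unfolding inj_on_def by blast
  obtain U \<mu> g \<nu> y where a: "openin (arrows_top (ep_groupoid G E act res)) U" "a \<in> U" 
    "admissible \<mu> g \<nu> y" "a = elem \<mu> g \<nu> y" "bcat \<nu> y = x" "bcat \<mu> (bact E act g y) = x"
    "isotropic_on U (orb_closure x)"
    by (rule interior_fiberE[OF ab(1)])
  obtain V \<mu>' g' \<nu>' y' where b: "openin (arrows_top (ep_groupoid G E act res)) V" "b \<in> V" 
    "admissible \<mu>' g' \<nu>' y'" "b = elem \<mu>' g' \<nu>' y'" "bcat \<nu>' y' = x" "bcat \<mu>' (bact E act g' y') = x"
    "isotropic_on V (orb_closure x)"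
    by (rule interior_fiberE[OF ab(2)])
  have "\<exists>z\<in>boundary E. \<exists>h\<in>carrier G. \<exists>S. h \<noteq> \<one>\<^bsub>G\<^esub> \<and> finite S \<and>
    (\<forall>w\<in>orb z. brng E w = brng E z \<longrightarrow> (\<forall>\<alpha>\<in>S. w \<in> cyl E \<alpha> \<longleftrightarrow> z \<in> cyl E \<alpha>) \<longrightarrow> bact E act h w = w)"
  proof (cases "plen \<nu> \<le> plen \<nu>'")
    case True
    show ?thesis
      by (rule fixing_element_ordered[OF assms(1) a(1) a(2)[unfolded a(4)] a(3,5-7)
        b(1) b(2)[unfolded b(4)] b(3,5-7) ab(3,4)[unfolded a(4) b(4)] True])
  next
    case False
    then have le: "plen \<nu>' \<le> plen \<nu>" by simp
    show ?thesis
      by (rule fixing_element_ordered[OF assms(1) b(1) b(2)[unfolded b(4)] b(3,5-7)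
        a(1) a(2)[unfolded a(4)] a(3,5-7) ab(3,4)[unfolded a(4) b(4), symmetric] le])
  qed
  then show ?thesis using that by blast
qed

text \<open>
  A nontrivial element that fixes the orbit near a boundary path can be moved along that path by
  restriction. An infinite path can be shortened until the whole cylinder set at its range is small
  enough. A finite path is shortened to its source \<open>v\<close>; the cylinder sets that define nearness then
  become the condition that the first edge avoids a finite set \<open>D\<close>.
\<close>

lemma fixing_element_cases:
  assumes "x \<in> boundary E" "\<not> inj_on ep_degree (fiber x)"
  obtains (infinite) p h where "p \<in> inf_paths E" "h \<in> carrier G" "h \<noteq> \<one>\<^bsub>G\<^esub>"
      "\<And>z. z \<in> orb (InfP p) \<Longrightarrow> brng E z = head E (p 0) \<Longrightarrow> bact E act h z = z"
  | (singular) v h D where "v \<in> singular E" "h \<in> carrier G" "h \<noteq> \<one>\<^bsub>G\<^esub>" "finite D"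
      "\<And>z. z \<in> orb (FinP (vtx v)) \<Longrightarrow> brng E z = v \<Longrightarrow> set (snd (bseg E z 1)) \<inter> D = {} \<Longrightarrow> bact E act h z = z"
proof -
  obtain y h S where y: "y \<in> boundary E" "h \<in> carrier G" "h \<noteq> \<one>\<^bsub>G\<^esub>" "finite S" 
    "\<And>w. \<lbrakk>w \<in> orb y; brng E w = brng E y; \<forall>\<alpha>\<in>S. w \<in> cyl E \<alpha> \<longleftrightarrow> y \<in> cyl E \<alpha>\<rbrakk> \<Longrightarrow> bact E act h w = w"
    using fixing_element[OF assms] by blast
  have descend: "res h \<beta> \<in> carrier G \<and> res h \<beta> \<noteq> \<one>\<^bsub>G\<^esub> \<and> 
      (\<forall>w\<in>orb z. brng E w = brng E z \<longrightarrow>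
      (\<forall>\<alpha>\<in>S. bcat \<beta> w \<in> cyl E \<alpha> \<longleftrightarrow> y \<in> cyl E \<alpha>) \<longrightarrow> bact E act (res h \<beta>) w = w)"
    if z: "z \<in> boundary E" "\<beta> \<in> fpaths E" "psrc E \<beta> = brng E z" "y = bcat \<beta> z" for \<beta> z
  proof (intro conjI ballI impI)
    have "bact E act h (bcat \<beta> z) = bcat \<beta> z"
      using y(5)[OF orb_refl[OF y(1)]] unfolding z(4) by blast
    from bact_bcat_fixed(1)[OF y(2) z(2,1,3) this] have "act h \<beta> = \<beta>" .
    then show "res h \<beta> \<noteq> \<one>\<^bsub>G\<^esub>" by (rule res_ne_one[OF y(2) z(2) _ y(3)])
    show "res h \<beta> \<in> carrier G" by (rule res_closed[OF y(2) z(2)])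
    fix w assume w: "w \<in> orb z" "brng E w = brng E z" 
      "\<forall>\<alpha>\<in>S. bcat \<beta> w \<in> cyl E \<alpha> \<longleftrightarrow> y \<in> cyl E \<alpha>"
    have s: "psrc E \<beta> = brng E w" using w(2) z(3) by simp
    have wb: "w \<in> boundary E" by (rule orb_boundary[OF w(1)])
    have "bcat \<beta> w \<in> orb y"
      unfolding z(4) by (rule orb_subset[OF orb_bcat[OF w(1) z(2) s] z(1-3)])
    moreover have "brng E (bcat \<beta> w) = brng E y"
      unfolding z(4) gph.brng_bcat[OF z(2) s] gph.brng_bcat[OF z(2,3)] ..
    ultimately have "bact E act h (bcat \<beta> w) = bcat \<beta> w" using y(5) w(3) by blast
    then show "bact E act (res h \<beta>) w = w" by (rule bact_bcat_fixed(2)[OF y(2) z(2) wb s])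
  qed
  show ?thesis
  proof (cases y)
    case (InfP q)
    obtain n where n: "\<And>\<alpha>. \<alpha> \<in> S \<Longrightarrow> plen \<alpha> \<le> n"
      using finite_nat_set_iff_bounded_le[of "plen ` S"] y(4) by auto
    let ?\<beta> = "bseg E y n"
    have "enat n \<le> blen y" using InfP by simp
    from gph.boundary_split[OF y(1) this] obtain z where z: "z \<in> boundary E" 
      "brng E z = psrc E ?\<beta>" "y = bcat ?\<beta> z" "plen ?\<beta> = n" .
    have bp: "?\<beta> \<in> fpaths E" by (rule gph.bseg_in[OF y(1)])
    obtain p where p: "z = InfP p" using z(3) InfP by (cases z) auto
    note d = descend[OF z(1) bp z(2)[symmetric] z(3)]
    have "bact E act (res h ?\<beta>) w = w" if w: "w \<in> orb z" "brng E w = brng E z" for w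
    proof -
      have s: "psrc E ?\<beta> = brng E w" using w(2) z(2) by simp
      have bw: "bcat ?\<beta> w \<in> boundary E" by (rule gph.bcat_in[OF bp orb_boundary[OF w(1)] s])
      have "bcat ?\<beta> w \<in> cyl E \<alpha> \<longleftrightarrow> y \<in> cyl E \<alpha>" if "\<alpha> \<in> S" for \<alpha>
      proof (rule gph.cyl_cong[OF bw y(1)])
        have k: "plen \<alpha> \<le> plen ?\<beta>" using n[OF that] z(4) by simp
        show "bseg E (bcat ?\<beta> w) (plen \<alpha>) = bseg E y (plen \<alpha>)"
          using gph.bseg_bcat_le[OF bp s k] gph.bseg_bcat_le[OF bp z(2)[symmetric] k]
          unfolding z(3)[symmetric] by simp
      qed
      then show ?thesis using d w by blast
    qed
    then show ?thesis using infinite[of p "res h ?\<beta>"] d z(1) unfolding p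
      by (simp add: gph.boundary_InfP)
  next
    case (FinP \<beta>)
    let ?v = "psrc E \<beta>" and ?D = "\<Union>\<alpha>\<in>S. set (snd \<alpha>)"
    let ?z = "FinP (vtx ?v) :: ('v, 'e) bpath"
    have b: "\<beta> \<in> fpaths E" "?v \<in> singular E" using y(1) FinP by (simp_all add: gph.boundary_FinP)
    have z: "?z \<in> boundary E" using b gph.psrc_in[OF b(1)] by (simp add: gph.boundary_FinP)
    have s: "psrc E \<beta> = brng E ?z" by simp
    have yz: "y = bcat \<beta> ?z" using FinP by simp
    note d = descend[OF z b(1) s yz]
    have "bact E act (res h \<beta>) w = w" 
      if w: "w \<in> orb ?z" "brng E w = ?v" "set (snd (bseg E w 1)) \<inter> ?D = {}" for w
    proof -
      have sw: "psrc E \<beta> = brng E w" using w(2) by simp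
      have wb: "w \<in> boundary E" by (rule orb_boundary[OF w(1)])
      have bw: "bcat \<beta> w \<in> boundary E" by (rule gph.bcat_in[OF b(1) wb sw])
      have "bcat \<beta> w \<in> cyl E \<alpha> \<longleftrightarrow> y \<in> cyl E \<alpha>" if \<alpha>: "\<alpha> \<in> S" for \<alpha>
      proof (cases "plen \<alpha> \<le> plen \<beta>")
        case True
        show ?thesis
        proof (rule gph.cyl_cong[OF bw y(1)])
          show "bseg E (bcat \<beta> w) (plen \<alpha>) = bseg E y (plen \<alpha>)"
            using gph.bseg_bcat_le[OF b(1) sw True] gph.bseg_bcat_le[OF b(1) s True] 
            unfolding yz[symmetric] by simp
        qed
      next
        case False
        define k where "k = plen \<alpha> - plen \<beta>"
        have k: "plen \<alpha> = plen \<beta> + k" "1 \<le> k" using False by (simp_all add: k_def)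
        have "y \<notin> cyl E \<alpha>"
        proof
          assume "y \<in> cyl E \<alpha>"
          then have "plen (bseg E y (plen \<alpha>)) = plen \<alpha>" by (simp add: cyl_def)
          then show False using False FinP by (simp add: plen_def)
        qed
        moreover have "bcat \<beta> w \<notin> cyl E \<alpha>"
        proof
          assume "bcat \<beta> w \<in> cyl E \<alpha>"
          then have e: "pcat \<beta> (bseg E w k) = \<alpha>"
            using gph.bseg_bcat_add[OF b(1) sw, of k] k(1) by (simp add: cyl_def)
          have "plen (pcat \<beta> (bseg E w k)) = plen \<beta> + k" unfolding e k(1) ..
          then have pk: "plen (bseg E w k) = k" by simp
          have t1: "snd (bseg E w 1) = take 1 (snd (bseg E w k))"
            using arg_cong[OF take_bseg[OF k(2), of E w], of snd] by simp
          obtain f fs where f: "snd (bseg E w k) = f # fs"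
            using pk k(2) by (cases "snd (bseg E w k)") (auto simp: plen_def)
          have "f \<in> set (snd (bseg E w 1))" unfolding t1 f by simp
          moreover have "f \<in> set (snd \<alpha>)" unfolding e[symmetric] snd_pcat f by simp
          then have "f \<in> ?D" using \<alpha> by blast
          ultimately show False using w(3) unfolding disjoint_iff by blast
        qed
        ultimately show ?thesis by blast
      qed
      then show ?thesis using d w by simp
    qed
    then show ?thesis using singular[of ?v "res h \<beta>" ?D] d b(2) y(4) by simp
  qed
qed

text \<open>
  The element \<open>h\<close> and the neutral element give two arrows of degree 0 at \<open>x\<close>, and both are interior
  points of the isotropy of the reduction.
\<close>

lemma not_inj_fiber:
  assumes "x \<in> boundary E" "h \<in> carrier G" "h \<noteq> \<one>\<^bsub>G\<^esub>" "bact E act h x = x" "finite D"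
    "set (snd (bseg E x 1)) \<inter> D = {}"
    "\<And>z. \<lbrakk>z \<in> boundary E; brng E z = brng E x; set (snd (bseg E z 1)) \<inter> D = {}; 
      bact E act h z \<in> orb_closure x\<rbrakk> \<Longrightarrow> bact E act h z = z"
  shows "\<not> inj_on ep_degree (fiber x)"
proof
  assume inj: "inj_on ep_degree (fiber x)"
  let ?EP = "ep_groupoid G E act res"
  let ?v = "brng E x"
  \<comment> \<open>Excluded paths must start at \<open>?v\<close>, whereas \<open>D\<close> is an arbitrary set of edges.\<close>
  let ?F = "(\<lambda>e. (?v, [e])) ` (D \<inter> edges_from E ?v (verts E))"
  let ?Z = "cyl_minus E ?F (vtx ?v)"
  have v: "?v \<in> verts E" by (rule gph.brng_in[OF assms(1)])
  have F: "?F \<subseteq> paths_from E ?v (verts E)" using gph.edge_paths_from by blast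
  have Z: "z \<in> ?Z \<longleftrightarrow> z \<in> boundary E \<and> brng E z = ?v \<and> set (snd (bseg E z 1)) \<inter> D = {}" for z
  proof -
    have "(\<forall>\<phi>\<in>?F. z \<notin> cyl E \<phi>) \<longleftrightarrow> set (snd (bseg E z 1)) \<inter> D = {}"
      if z: "z \<in> boundary E" "brng E z = ?v"
    proof (cases "z = FinP (vtx (brng E z))")
      case True
      have "bseg E z 1 = vtx (brng E z)" by (subst True) (simp add: vtx_def)
      then show ?thesis by (simp add: cyl_def plen_def vtx_def)
    next
      case False
      obtain e where e: "e \<in> arcs E" "head E e = brng E z" "bseg E z 1 = (head E e, [e])"
        by (rule gph.boundary_first_edge[OF z(1) False])
      have "z \<in> cyl E (?v, [f]) \<longleftrightarrow> f = e" for f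
        using z e by (auto simp: cyl_def plen_def)
      moreover have "e \<in> edges_from E ?v (verts E)"
        using e z by (simp add: edges_from_def)
      ultimately show ?thesis unfolding e(3) by auto
    qed
    then show ?thesis unfolding gph.cyl_minus_vtx[OF F] by blast
  qed
  have hv: "vact act h ?v = ?v" using brng_bact[OF assms(2,1)] assms(4) by simp
  have fib: "elem (vtx ?v) k (vtx ?v) x \<in> fiber x"
    if k: "k \<in> carrier G" "bact E act k x = x" 
      "\<And>z. z \<in> ?Z \<Longrightarrow> bact E act k z \<in> orb_closure x \<Longrightarrow> bact E act k z = z" for k
  proof -
    have kv: "vact act k ?v = ?v" using brng_bact[OF k(1) assms(1)] k(2) by simp
    let ?U = "elem (vtx ?v) k (vtx ?v) ` ?Z"
    let ?R = "gpd_reduction ?EP (orb_closure x)"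
    have ar: "arrows ?EP = ep_arrows G E act res" by (simp add: ep_groupoid_def)
    have "?U \<in> ep_basis G E act res"
      unfolding ep_basis_def mem_Collect_eq
      by (rule exI[of _ "vtx ?v"], rule exI[of _ k], rule exI[of _ "vtx ?v"], rule exI[of _ ?F])
        (use k(1) v kv F assms(5) in simp)
    then have "openin (arrows_top ?EP) ?U"
      by (simp add: ep_groupoid_def topology_generated_by_Basis)
    then have op: "openin (subtopology (arrows_top ?EP) ?R) (?U \<inter> ?R)"
      unfolding openin_subtopology by blast
    have rgsr: "rg ?EP (elem (vtx ?v) k (vtx ?v) z) = bact E act k z"
      "sr ?EP (elem (vtx ?v) k (vtx ?v) z) = z" if "z \<in> ?Z" for z
    proof -
      have z: "z \<in> boundary E" "brng E z = ?v" using that unfolding Z by auto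
      then have "brng E (bact E act k z) = ?v" using brng_bact[OF k(1) z(1)] kv by simp
      then show "rg ?EP (elem (vtx ?v) k (vtx ?v) z) = bact E act k z"
        "sr ?EP (elem (vtx ?v) k (vtx ?v) z) = z"
        unfolding elem_proj using bcat_vtx[of E z] bcat_vtx[of E "bact E act k z"] z(2) by simp_all
    qed
    have sub: "?U \<inter> ?R \<subseteq> iso_bundle ?EP (orb_closure x)"
    proof
      fix a assume a: "a \<in> ?U \<inter> ?R"
      then obtain z where z: "z \<in> ?Z" "a = elem (vtx ?v) k (vtx ?v) z" by blast
      have "bact E act k z \<in> orb_closure x"
        using a rgsr[OF z(1)] z(2) by (simp add: gpd_reduction_def)
      then have "rg ?EP a = sr ?EP a" using k(3)[OF z(1)] rgsr[OF z(1)] z(2) by simp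
      then show "a \<in> iso_bundle ?EP (orb_closure x)" using a by (simp add: iso_bundle_def)
    qed
    have xZ: "x \<in> ?Z" unfolding Z using assms(1,6) by simp
    have "elem (vtx ?v) k (vtx ?v) x \<in> ep_arrows G E act res"
      unfolding ep_arrows_iff using admissible_vtx[OF assms(1) k(1) kv] by blast
    then have aR: "elem (vtx ?v) k (vtx ?v) x \<in> ?R"
      unfolding gpd_reduction_def ar using rgsr[OF xZ] k(2) orb_subset_closure[of x] orb_refl[OF assms(1)] by auto
    have "elem (vtx ?v) k (vtx ?v) x \<in> ?U \<inter> ?R" using xZ aR by (intro IntI imageI)
    then have "elem (vtx ?v) k (vtx ?v) x \<in>
        subtopology (arrows_top ?EP) ?R interior_of iso_bundle ?EP (orb_closure x)"
      unfolding interior_of_def mem_Collect_eq using op sub by (intro exI conjI)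
    then show ?thesis
      unfolding iso_interior_fiber_def mem_Collect_eq rgsr(1)[OF xZ] k(2) by (intro conjI refl)
  qed
  have "elem (vtx ?v) h (vtx ?v) x \<in> fiber x"
    by (rule fib[OF assms(2,4)]) (use assms(7) Z in blast)
  moreover have "elem (vtx ?v) \<one>\<^bsub>G\<^esub> (vtx ?v) x \<in> fiber x"
    by (rule fib) (use assms(1) Z in auto)
  ultimately have "elem (vtx ?v) h (vtx ?v) x = elem (vtx ?v) \<one>\<^bsub>G\<^esub> (vtx ?v) x"
    using inj by (auto simp: inj_on_def elem_proj)
  then have "h = \<one>\<^bsub>G\<^esub>"
    using elem_inj[OF admissible_vtx[OF assms(1,2) hv] admissible_vtx[OF assms(1) grp.one_closed]] v by simp
  then show False using assms(3) by simp
qed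

end


section \<open>Maximal tails and paths without entry\<close>

context wf_digraph
begin

lemma vgeI: "\<mu> \<in> fpaths G \<Longrightarrow> vge G (prng \<mu>) (psrc G \<mu>)"
  unfolding vge_def paths_from_def by blast

lemma vgeE:
  assumes "vge G v w"
  obtains \<mu> where "\<mu> \<in> fpaths G" "prng \<mu> = v" "psrc G \<mu> = w"
  using assms unfolding vge_def paths_from_def by blast

lemma inf_path_exists:
  assumes "v \<in> S" "\<And>w. w \<in> S \<Longrightarrow> \<exists>e\<in>arcs G. head G e = w \<and> tail G e \<in> S"
  obtains x where "x \<in> inf_paths G" "head G (x 0) = v" "\<And>n. head G (x n) \<in> S"
proof -
  obtain f where f: "\<And>w. w \<in> S \<Longrightarrow> f w \<in> arcs G \<and> head G (f w) = w \<and> tail G (f w) \<in> S"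
    using assms(2) by metis
  define u where "u n = ((tail G \<circ> f) ^^ n) v" for n
  have u: "u n \<in> S" for n
    by (induction n) (use assms(1) f in \<open>auto simp: u_def\<close>)
  have "u (Suc n) = tail G (f (u n))" for n by (simp add: u_def)
  then have p: "(\<lambda>n. f (u n)) \<in> inf_paths G"
    using f u by (simp add: inf_paths_def)
  have h: "head G (f (u n)) = u n" for n using f[OF u[of n]] by blast
  have u0: "u 0 = v" by (simp add: u_def)
  have h0: "head G (f (u 0)) = v" using h[of 0] unfolding u0 .
  show ?thesis by (rule that[OF p h0]) (simp add: h u)
qed

text \<open>
  All vertices of \<open>\<beta>\<close> lie in \<open>M\<close>, because its source does. At a vertex of \<open>y\<close> the only edge with
  source in \<open>M\<close> is the one of \<open>y\<close>, so \<open>\<beta>\<close> is a segment of \<open>y\<close>.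
\<close>

lemma no_entry_path:
  assumes "inf_no_entry G M y" "y \<in> inf_paths G"
    and cl: "\<forall>v w. vge G v w \<and> w \<in> M \<longrightarrow> v \<in> M"
    and "\<beta> \<in> fpaths G" "prng \<beta> = head G (y k)" "psrc G \<beta> \<in> M"
  shows "psrc G \<beta> = head G (y (k + plen \<beta>))"
proof -
  have "(head G (y k), es) \<in> fpaths G \<Longrightarrow> psrc G (head G (y k), es) \<in> M \<Longrightarrow>
      psrc G (head G (y k), es) = head G (y (k + length es))" for es
  proof (induction es arbitrary: k)
    case Nil
    show ?case by (simp add: psrc_def)
  next
    case (Cons e es)
    have e: "e \<in> arcs G" "head G e = head G (y k)" "(tail G e, es) \<in> fpaths G"
      using Cons.prems(1) by (simp_all add: fpaths_Cons)
    have s: "psrc G (tail G e, es) \<in> M" using Cons.prems(2) by (simp add: psrc_Cons)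
    then have "tail G e \<in> M" using cl vgeI[OF e(3)] by (auto simp: prng_def)
    then have "e \<in> edges_from G (head G (y k)) M" using e by (simp add: edges_from_def)
    then have "e = y k" using assms(1) by (simp add: inf_no_entry_def)
    then have t: "tail G e = head G (y (Suc k))" using assms(2) by (simp add: inf_paths_def)
    have "psrc G (head G (y (Suc k)), es) = head G (y (Suc k + length es))"
      by (rule Cons.IH) (use e(3) s in \<open>simp_all only: t\<close>)
    then show ?case by (simp add: psrc_Cons t)
  qed
  from this[of "snd \<beta>"] show ?thesis
    using assms(4-6) by (cases \<beta>) (simp add: prng_def plen_def)
qed

end

lemma max_tailsD:
  assumes "M \<in> max_tails G E act"
  shows "M \<subseteq> verts E" "\<forall>g\<in>carrier G. \<forall>v\<in>M. vact act g v \<in> M"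
    "\<forall>v w. vge E v w \<and> w \<in> M \<longrightarrow> v \<in> M"
    "\<And>v. v \<in> M \<Longrightarrow> v \<notin> singular E \<Longrightarrow> edges_from E v M \<noteq> {}"
    "\<And>v w. v \<in> M \<Longrightarrow> w \<in> M \<Longrightarrow> \<exists>g\<in>carrier G. \<exists>u\<in>M. vge E v u \<and> vge E w (vact act g u)"
  using assms unfolding max_tails_def by blast+

context self_similar_graph
begin

lemma max_tail_invariant: "M \<in> max_tails G E act \<Longrightarrow> G_invariant M"
  using max_tailsD(1,2) unfolding G_invariant_def by blast

lemma ptailE:
  assumes "v \<in> ptail x" obtains y where "y \<in> orb x" "brng E y = v"
  using assms unfolding point_tail_def by blast

text \<open>
  This gives the directedness of the maximal tail of an orbit: two orbit elements eventually run
  through images of the same tail of \<open>x\<close>.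
\<close>

lemma common_tail:
  assumes "admissible \<mu> g \<nu> z" "admissible \<mu>' g' \<nu>' z'" "bcat \<nu> z = bcat \<nu>' z'" "plen \<nu> \<le> plen \<nu>'"
  shows "\<exists>k\<in>carrier G. vge E (prng \<mu>) (vact act k (brng E z'))" 
    "vge E (prng \<mu>') (vact act g' (brng E z'))"
proof -
  note r = admissibleD[OF assms(1)] and r' = admissibleD[OF assms(2)]
  obtain \<beta> where b: "\<beta> \<in> fpaths E" "psrc E \<nu> = prng \<beta>" "\<nu>' = pcat \<nu> \<beta>" "z = bcat \<beta> z'" 
    "psrc E \<beta> = brng E z'"
    by (rule gph.bcat_compare[OF r'(4) r(4) r'(5) r(5) assms(3)[symmetric] assms(4)])
  note e = admissible_extend(1)[OF assms(1)[unfolded b(4)] b(1) r'(1) b(5)]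
  have "vge E (prng \<mu>) (vact act (res g \<beta>) (brng E z'))"
    using gph.vgeI[OF admissibleD(3)[OF e]] e by (simp add: admissible_def)
  then show "\<exists>k\<in>carrier G. vge E (prng \<mu>) (vact act k (brng E z'))" using admissibleD(2)[OF e] by blast
  show "vge E (prng \<mu>') (vact act g' (brng E z'))"
    using gph.vgeI[OF r'(3)] assms(2) by (simp add: admissible_def)
qed

lemma ptail_max_tail:
  assumes x: "x \<in> boundary E"
  shows "ptail x \<in> max_tails G E act"
proof -
  let ?M = "ptail x"
  have ne: "?M \<noteq> {}" using brng_ptail[OF orb_refl[OF x]] by blast
  have sub: "?M \<subseteq> verts E"
    using orb_boundary gph.brng_in by (auto simp: point_tail_def)
  have inv: "\<forall>g\<in>carrier G. \<forall>v\<in>?M. vact act g v \<in> ?M"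
  proof (intro ballI)
    fix g v assume g: "g \<in> carrier G" and "v \<in> ?M"
    then obtain y where y: "y \<in> orb x" "brng E y = v" by (elim ptailE)
    then show "vact act g v \<in> ?M"
      using brng_ptail[OF orb_bact[OF y(1) g]] brng_bact[OF g orb_boundary[OF y(1)]] by simp
  qed
  have cl: "\<forall>v w. vge E v w \<and> w \<in> ?M \<longrightarrow> v \<in> ?M"
  proof (intro allI impI)
    fix v w assume a: "vge E v w \<and> w \<in> ?M"
    then obtain y where y: "y \<in> orb x" "brng E y = w" by (elim conjE ptailE)
    obtain \<mu> where m: "\<mu> \<in> fpaths E" "prng \<mu> = v" "psrc E \<mu> = w" using a by (elim conjE gph.vgeE)
    have s: "psrc E \<mu> = brng E y" using m y by simp
    show "v \<in> ?M" using brng_ptail[OF orb_bcat[OF y(1) m(1) s]] gph.brng_bcat[OF m(1) s] m(2) by simp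
  qed
  have reg: "\<forall>v\<in>?M. v \<notin> singular E \<longrightarrow> edges_from E v ?M \<noteq> {}"
  proof (intro ballI impI)
    fix v assume v: "v \<in> ?M" "v \<notin> singular E"
    obtain y where y: "y \<in> orb x" "brng E y = v" by (rule ptailE[OF v(1)])
    have "y \<noteq> FinP (vtx (brng E y))"
    proof
      assume a: "y = FinP (vtx (brng E y))"
      have "FinP (vtx (brng E y)) \<in> boundary E" using orb_boundary[OF y(1)] a by simp
      then show False using v(2) y(2) by (simp add: gph.boundary_FinP)
    qed
    then obtain e where e: "e \<in> arcs E" "head E e = brng E y" "bseg E y 1 = (head E e, [e])"
      by (rule gph.boundary_first_edge[OF orb_boundary[OF y(1)]])
    have "tail E e \<in> ?M" using ptail_vertices[OF y(1), of 1] unfolding e(3) by (simp add: psrc_def)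
    then show "edges_from E v ?M \<noteq> {}" using e y(2) by (auto simp: edges_from_def)
  qed
  have "\<exists>g\<in>carrier G. \<exists>u\<in>?M. vge E v u \<and> vge E w (vact act g u)" if vw: "v \<in> ?M" "w \<in> ?M" for v w
  proof -
    obtain y y' where y: "y \<in> orb x" "brng E y = v" "y' \<in> orb x" "brng E y' = w"
      using vw by (elim ptailE)
    obtain \<mu> g \<nu> z where r: "admissible \<mu> g \<nu> z" "x = bcat \<nu> z" "y = bcat \<mu> (bact E act g z)"
      by (rule orbE[OF y(1)])
    obtain \<mu>' g' \<nu>' z' where r': "admissible \<mu>' g' \<nu>' z'" "x = bcat \<nu>' z'" "y' = bcat \<mu>' (bact E act g' z')"
      by (rule orbE[OF y(3)])
    have vm: "v = prng \<mu>" "w = prng \<mu>'"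
      using gph.brng_bcat[OF admissibleD(3,6)[OF r(1)]] gph.brng_bcat[OF admissibleD(3,6)[OF r'(1)]] y r(3) r'(3) by simp_all
    have tail: "brng E t \<in> ?M" if "admissible \<kappa> f \<eta> t" "x = bcat \<eta> t" for \<kappa> f \<eta> t
      using brng_ptail[OF orb_tail[OF _ admissibleD(4,1,5)[OF that(1)]]] orb_refl[OF x] that(2) by simp
    have "\<exists>k\<in>carrier G. \<exists>k'\<in>carrier G. \<exists>t\<in>?M. vge E v (vact act k t) \<and> vge E w (vact act k' t)"
    proof (cases "plen \<nu> \<le> plen \<nu>'")
      case True
      have eq: "bcat \<nu> z = bcat \<nu>' z'" using r(2) r'(2) by simp
      show ?thesis using common_tail[OF r(1) r'(1) eq True] tail[OF r'(1,2)] admissibleD(2)[OF r'(1)] vm by blast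
    next
      case False
      then have le: "plen \<nu>' \<le> plen \<nu>" by simp
      have eq: "bcat \<nu>' z' = bcat \<nu> z" using r(2) r'(2) by simp
      show ?thesis using common_tail[OF r'(1) r(1) eq le] tail[OF r(1,2)] admissibleD(2)[OF r(1)] vm by blast
    qed
    then obtain k k' t where k: "k \<in> carrier G" "k' \<in> carrier G" "t \<in> ?M" 
      "vge E v (vact act k t)" "vge E w (vact act k' t)" by blast
    have t: "t \<in> verts E" using k(3) sub by blast
    have "vact act (k' \<otimes>\<^bsub>G\<^esub> inv\<^bsub>G\<^esub> k) (vact act k t) = vact act k' t"
      using k(1,2) t by (simp add: vact_mult)
    then show ?thesis using k inv by (intro bexI[of _ "k' \<otimes>\<^bsub>G\<^esub> inv\<^bsub>G\<^esub> k"] bexI[of _ "vact act k t"]) simp_all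
  qed
  then have dir: "\<forall>v\<in>?M. \<forall>w\<in>?M. \<exists>g\<in>carrier G. \<exists>u\<in>?M. vge E v u \<and> vge E w (vact act g u)"
    by (intro ballI)
  show ?thesis
    unfolding max_tails_def mem_Collect_eq using ne sub inv cl reg dir by (intro conjI)
qed

lemma ptail_subset:
  assumes M: "M \<in> max_tails G E act" and x: "x \<in> boundary E" and v: "\<And>n. psrc E (bseg E x n) \<in> M"
  shows "ptail x \<subseteq> M"
proof
  fix w assume "w \<in> ptail x"
  then obtain y where y: "y \<in> orb x" "brng E y = w" by (rule ptailE)
  obtain \<mu> g \<nu> z where r: "admissible \<mu> g \<nu> z" "x = bcat \<nu> z" "y = bcat \<mu> (bact E act g z)"
    by (rule orbE[OF y(1)])
  have "psrc E \<nu> \<in> M" using v[of "plen \<nu>"] gph.bseg_bcat_plen[OF admissibleD(4,5)[OF r(1)]] r(2) by simp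
  then have "psrc E \<mu> \<in> M" using max_tailsD(2)[OF M] r(1) by (simp add: admissible_def)
  then have "prng \<mu> \<in> M" using max_tailsD(3)[OF M] gph.vgeI[OF admissibleD(3)[OF r(1)]] by blast
  then show "w \<in> M" using gph.brng_bcat[OF admissibleD(3,6)[OF r(1)]] y(2) r(3) by simp
qed

lemma ptail_vertex:
  assumes "v \<in> verts E" "u \<in> ptail (FinP (vtx v))"
  obtains g where "g \<in> carrier G" "vge E u (vact act g v)"
proof -
  obtain y where y: "y \<in> orb (FinP (vtx v))" "brng E y = u" by (rule ptailE[OF assms(2)])
  obtain \<mu> g \<nu> z where r: "admissible \<mu> g \<nu> z" "FinP (vtx v) = bcat \<nu> z" "y = bcat \<mu> (bact E act g z)"
    by (rule orbE[OF y(1)])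
  obtain \<alpha> where a: "z = FinP \<alpha>" using r(2) by (cases z) auto
  have "snd \<nu> = []" "snd \<alpha> = []" using r(2) a by (auto simp: vtx_def pcat_def)
  moreover have "fst \<nu> = v" using r(2) a by (auto simp: vtx_def pcat_def)
  moreover have "psrc E \<nu> = prng \<alpha>" using admissibleD(5)[OF r(1)] a by simp
  ultimately have "brng E z = v" using a by (simp add: psrc_def prng_def)
  then have "psrc E \<mu> = vact act g v" using r(1) by (simp add: admissible_def)
  moreover have "prng \<mu> = u" using gph.brng_bcat[OF admissibleD(3,6)[OF r(1)]] y(2) r(3) by simp
  ultimately show ?thesis using that[OF admissibleD(2)[OF r(1)]] gph.vgeI[OF admissibleD(3)[OF r(1)]] by simp
qed

lemma orb_InfP:
  assumes "y \<in> orb (InfP p)" obtains q where "y = InfP q"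
proof -
  obtain \<mu> g \<nu> z where r: "admissible \<mu> g \<nu> z" "InfP p = bcat \<nu> z" "y = bcat \<mu> (bact E act g z)"
    by (rule orbE[OF assms])
  obtain w where "z = InfP w" using r(2) by (cases z) auto
  then show ?thesis using that r(3) by simp
qed

text \<open>
  Every path with source in the tail extends to an orbit element, which is fixed.
\<close>

lemma acts_trivially:
  assumes "h \<in> carrier G" "\<And>z. z \<in> orb x \<Longrightarrow> brng E z = v \<Longrightarrow> bact E act h z = z"
    "\<mu> \<in> paths_from E v (ptail x)"
  shows "act h \<mu> = \<mu>"
proof -
  have m: "\<mu> \<in> fpaths E" "prng \<mu> = v" "psrc E \<mu> \<in> ptail x" using assms(3) by (auto simp: paths_from_def)
  obtain y where y: "y \<in> orb x" "psrc E \<mu> = brng E y" using ptailE[OF m(3)] by metis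
  have "bact E act h (bcat \<mu> y) = bcat \<mu> y"
    using assms(2)[OF orb_bcat[OF y(1) m(1) y(2)]] gph.brng_bcat[OF m(1) y(2)] m(2) by simp
  from bact_bcat_fixed(1)[OF assms(1) m(1) orb_boundary[OF y(1)] y(2) this] show ?thesis .
qed

lemma periodic_vertices:
  assumes "y \<in> inf_paths E" "InfP y \<notin> aperiodic G E act"
  obtains g n m where "g \<in> carrier G" "m < n" "\<forall>j. head E (y (n + j)) = vact act g (head E (y (m + j)))"
proof -
  have sh: "(bshift E ^^ n) (InfP y) = InfP (\<lambda>i. y (i + n))" for n
    by (induction n) simp_all
  have sp: "(\<lambda>i. y (i + n)) \<in> inf_paths E" for n using assms(1) by (simp add: inf_paths_def)
  have "InfP y \<in> boundary E" using assms(1) by (simp add: gph.boundary_InfP)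
  then obtain g n m where g0: "g \<in> carrier G" "n \<noteq> m" 
    "(bshift E ^^ n) (InfP y) = bact E act g ((bshift E ^^ m) (InfP y))"
    using assms(2) unfolding aperiodic_def by blast
  note g = g0[unfolded sh]
  have v: "head E (y (n + j)) = vact act g (head E (y (m + j)))" for j
  proof -
    have b: "InfP (\<lambda>i. y (i + m)) \<in> boundary E" using sp by (simp add: gph.boundary_InfP)
    have "bseg E (InfP (\<lambda>i. y (i + n))) j = act g (bseg E (InfP (\<lambda>i. y (i + m))) j)"
      unfolding g(3) by (rule bseg_bact[OF g(1) b])
    then have "psrc E (bseg E (InfP (\<lambda>i. y (i + n))) j) = vact act g (psrc E (bseg E (InfP (\<lambda>i. y (i + m))) j))"
      using psrc_act[OF g(1) gph.bseg_in[OF b]] by simp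
    then show ?thesis unfolding gph.psrc_bseg_InfP[OF sp] by (simp add: add.commute)
  qed
  have hv: "head E (y i) \<in> verts E" for i using assms(1) by (simp add: inf_paths_def)
  show ?thesis
  proof (cases "m < n")
    case True
    show ?thesis by (rule that[OF g(1) True]) (use v in blast)
  next
    case False
    have "head E (y (m + j)) = vact act (inv\<^bsub>G\<^esub> g) (head E (y (n + j)))" for j
      unfolding v using g(1) hv by simp
    then show ?thesis using that[of "inv\<^bsub>G\<^esub> g" n m] g(1,2) False by simp
  qed
qed

end


section \<open>Necessity of the conditions\<close>

context self_similar_graph
begin

text \<open>
  In the closure, \<open>x\<close> is isolated. The vertices of \<open>z\<close> are in \<open>L\<close>, so \<open>z\<close> has to follow \<open>x\<close>. It
  cannot end at a vertex of \<open>x\<close>: it is not in the orbit of an infinite path, and that vertex receives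
  a single edge from \<open>L\<close>.
\<close>

lemma no_entry_closure:
  assumes L: "L \<in> max_tails G E act" and x: "x \<in> inf_paths E" "\<And>n. head E (x n) \<in> L" 
      "inf_no_entry E L x"
    and z: "z \<in> orb_closure (InfP x)" "brng E z = head E (x 0)"
  shows "z = InfP x"
proof -
  have xb: "InfP x \<in> boundary E" using x by (simp add: gph.boundary_InfP)
  have "psrc E (bseg E (InfP x) n) \<in> L" for n
    using x(2) unfolding gph.psrc_bseg_InfP[OF x(1)] .
  then have sub: "ptail (InfP x) \<subseteq> L" by (rule ptail_subset[OF L xb])
  then have vz: "psrc E (bseg E z n) \<in> L" for n using closure_vertices[OF z(1)] by blast
  have zb: "z \<in> boundary E" by (rule closure_boundary[OF z(1)])
  have pos: "psrc E (bseg E z n) = head E (x (plen (bseg E z n)))" for n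
  proof -
    have "psrc E (bseg E z n) = head E (x (0 + plen (bseg E z n)))"
      by (rule gph.no_entry_path[OF x(3,1) max_tailsD(3)[OF L] gph.bseg_in[OF zb] _ vz]) (simp add: z(2))
    then show ?thesis by simp
  qed
  show ?thesis
  proof (cases z)
    case (FinP \<alpha>)
    have "bseg E z (plen \<alpha>) = \<alpha>" using FinP by (simp add: plen_def)
    then have w: "psrc E \<alpha> = head E (x (plen \<alpha>))" using pos[of "plen \<alpha>"] by simp
    have "FinP \<alpha> \<notin> orb (InfP x)"
    proof
      assume "FinP \<alpha> \<in> orb (InfP x)"
      then obtain q where "FinP \<alpha> = InfP q" by (rule orb_InfP)
      then show False by simp
    qed
    from closure_finite_path[OF z(1)[unfolded FinP] this]
    have "infinite (edges_from E (psrc E \<alpha>) (ptail (InfP x)))" .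
    moreover have "edges_from E (psrc E \<alpha>) (ptail (InfP x)) \<subseteq> edges_from E (head E (x (plen \<alpha>))) L"
      unfolding w using sub by (auto simp: edges_from_def)
    moreover have "finite (edges_from E (head E (x (plen \<alpha>))) L)"
      using x(3) by (simp add: inf_no_entry_def)
    ultimately show ?thesis by (meson finite_subset)
  next
    case (InfP q)
    have q: "q \<in> inf_paths E" using zb InfP by (simp add: gph.boundary_InfP)
    have hq: "head E (q n) \<in> L" "head E (q n) = head E (x n)" for n
      using vz[of n] pos[of n] gph.psrc_bseg_InfP[OF q, of n] InfP by (simp_all add: plen_def)
    have "q n = x n" for n
    proof -
      have "q n \<in> arcs E" "tail E (q n) = head E (q (Suc n))" 
        using q unfolding inf_paths_def by blast+
      then have "q n \<in> edges_from E (head E (x n)) L"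
        using hq(1)[of "Suc n"] hq(2)[of n] by (simp add: edges_from_def)
      then show ?thesis using x(3) by (simp add: inf_no_entry_def)
    qed
    then show ?thesis using InfP by auto
  qed
qed

text \<open>
  If a singular vertex of \<open>M\<close> can be reached from \<open>v\<close>, one stops there; otherwise all vertices of \<open>M\<close>
  below \<open>v\<close> are regular and the path can be continued forever.
\<close>

lemma boundary_path_in_tail:
  assumes M: "M \<in> max_tails G E act" and v: "v \<in> M"
  obtains x where "x \<in> boundary E" "brng E x = v" "\<And>n. psrc E (bseg E x n) \<in> M"
proof (cases "\<exists>w\<in>M. w \<in> singular E \<and> vge E v w")
  case True
  then obtain w \<mu> where w: "w \<in> M" "w \<in> singular E" and m: "\<mu> \<in> fpaths E" "prng \<mu> = v" "psrc E \<mu> = w"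
    by (elim bexE conjE gph.vgeE)
  have "psrc E (bseg E (FinP \<mu>) n) \<in> M" for n
  proof (cases "n \<le> plen \<mu>")
    case le: True
    obtain \<beta> \<delta> where b: "\<beta> \<in> fpaths E" "\<delta> \<in> fpaths E" "psrc E \<beta> = prng \<delta>" "\<mu> = pcat \<beta> \<delta>" 
      "psrc E \<delta> = psrc E \<mu>" "plen \<beta> = n"
      by (rule gph.path_split[OF m(1) le])
    have "bseg E (FinP \<mu>) n = \<beta>" using b(4,6) by (simp add: plen_def)
    moreover have "vge E (psrc E \<beta>) w" using gph.vgeI[OF b(2)] b(3,5) m(3) by simp
    ultimately show ?thesis using max_tailsD(3)[OF M] w(1) by auto
  next
    case False
    then have "bseg E (FinP \<mu>) n = \<mu>" by (simp add: plen_def)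
    then show ?thesis using m w by simp
  qed
  moreover have "FinP \<mu> \<in> boundary E" using m w by (simp add: gph.boundary_FinP)
  ultimately show ?thesis using that[of "FinP \<mu>"] m(2) by simp
next
  case False
  have vv: "v \<in> verts E" using v max_tailsD(1)[OF M] by blast
  \<comment> \<open>No vertex of this set is singular, so each has an edge whose source is again in the set.\<close>
  let ?S = "{w \<in> M. vge E v w}"
  have "vge E v v" using gph.vgeI[of "vtx v"] vv by simp
  then have vS: "v \<in> ?S" using v by simp
  have step: "\<exists>e\<in>arcs E. head E e = w \<and> tail E e \<in> ?S" if w: "w \<in> ?S" for w
  proof -
    have "w \<notin> singular E" using w False by blast
    then have "edges_from E w M \<noteq> {}" using max_tailsD(4)[OF M] w by blast
    then obtain e where e: "e \<in> arcs E" "head E e = w" "tail E e \<in> M" by (auto simp: edges_from_def)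
    obtain \<mu> where m: "\<mu> \<in> fpaths E" "prng \<mu> = v" "psrc E \<mu> = w" using w by (elim CollectE conjE gph.vgeE)
    let ?e = "(head E e, [e])"
    have s: "psrc E \<mu> = prng ?e" using m(3) e(2) by (simp add: prng_def)
    have p: "pcat \<mu> ?e \<in> fpaths E" by (rule gph.pcat_in[OF m(1) gph.edge_path(1)[OF e(1)] s])
    have "vge E v (tail E e)"
      using gph.vgeI[OF p] m(2) unfolding psrc_pcat[OF s] gph.edge_path(2)[OF e(1)] by simp
    then show ?thesis using e by blast
  qed
  obtain x where x: "x \<in> inf_paths E" "head E (x 0) = v" "\<And>n. head E (x n) \<in> ?S"
    using gph.inf_path_exists[OF vS step] by blast
  have "psrc E (bseg E (InfP x) n) \<in> M" for n
    unfolding gph.psrc_bseg_InfP[OF x(1)] using x(3) by blast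
  moreover have "InfP x \<in> boundary E" using x(1) by (simp add: gph.boundary_InfP)
  ultimately show ?thesis using that[of "InfP x"] x(2) by simp
qed

lemma stabilizer_trivialI:
  assumes "v \<in> verts E" 
    "\<And>h. \<lbrakk>h \<in> carrier G; h \<noteq> \<one>\<^bsub>G\<^esub>; act h (vtx v) = vtx v\<rbrakk> \<Longrightarrow> False"
  shows "stabilizer G act (vtx v) = {\<one>\<^bsub>G\<^esub>}"
proof -
  have "act \<one>\<^bsub>G\<^esub> (vtx v) = vtx v" using assms(1) by simp
  then show ?thesis using assms(2) unfolding stabilizer_def by auto
qed

lemma stabilizer_trivialD:
  "\<lbrakk>stabilizer G act (vtx v) = {\<one>\<^bsub>G\<^esub>}; h \<in> carrier G; act h (vtx v) = vtx v\<rbrakk> \<Longrightarrow> h = \<one>\<^bsub>G\<^esub>"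
  unfolding stabilizer_def by blast

end

context pseudo_free_ssg
begin

text \<open>
  If all edges at \<open>v\<close> from its tail are excluded, then the neighbourhood of \<open>v\<close> that remains meets the
  orbit closure in \<open>v\<close> only. Hence every element of the stabilizer of \<open>v\<close> fixes the closure near \<open>v\<close>.
\<close>

lemma breaking_stabilizer:
  assumes inj: "\<And>x. x \<in> boundary E \<Longrightarrow> inj_on ep_degree (fiber x)"
    and v: "v \<in> singular E" and fin: "finite (edges_from E v (ptail (FinP (vtx v))))"
  shows "stabilizer G act (vtx v) = {\<one>\<^bsub>G\<^esub>}"
proof (rule stabilizer_trivialI)
  let ?x = "FinP (vtx v) :: ('v, 'e) bpath"
  show vv: "v \<in> verts E" using v by (simp add: singular_def)
  have xb: "?x \<in> boundary E" using v vv by (simp add: gph.boundary_FinP)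
  have inv: "G_invariant (ptail ?x)" by (rule max_tail_invariant[OF ptail_max_tail[OF xb]])
  fix h assume h: "h \<in> carrier G" "h \<noteq> \<one>\<^bsub>G\<^esub>" "act h (vtx v) = vtx v"
  let ?D = "edges_from E v (ptail ?x)"
  have hx: "bact E act h ?x = ?x" using h(3) by simp
  have "\<not> inj_on ep_degree (fiber ?x)"
  proof (rule not_inj_fiber[OF xb h(1,2) hx fin])
    show "set (snd (bseg E ?x 1)) \<inter> ?D = {}" by simp
    fix z assume z: "z \<in> boundary E" "brng E z = brng E ?x" "set (snd (bseg E z 1)) \<inter> ?D = {}"
      "bact E act h z \<in> orb_closure ?x"
    have "z = FinP (vtx (brng E z))"
    proof (rule ccontr)
      assume "z \<noteq> FinP (vtx (brng E z))"
      then obtain e where e: "e \<in> arcs E" "head E e = brng E z" "bseg E z 1 = (head E e, [e])"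
        by (rule gph.boundary_first_edge[OF z(1)])
      have "psrc E (bseg E (bact E act h z) 1) \<in> ptail ?x" by (rule closure_vertices[OF z(4)])
      then have "tail E (eact h e) \<in> ptail ?x"
        unfolding bseg_bact[OF h(1) z(1)] e(3) act_edge(1)[OF h(1) e(1)] by (simp add: psrc_def)
      then have "vact act h (tail E e) \<in> ptail ?x" using act_edge(4)[OF h(1) e(1)] by simp
      then have "vact act (inv\<^bsub>G\<^esub> h) (vact act h (tail E e)) \<in> ptail ?x"
        using inv h(1) unfolding G_invariant_def by simp
      then have "tail E e \<in> ptail ?x" using h(1) e(1) by simp
      then have "e \<in> ?D" using e z(2) by (simp add: edges_from_def)
      then show False using z(3) e(3) by simp
    qed
    then have "z = ?x" using z(2) by simp
    then show "bact E act h z = z" using hx by simp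
  qed
  then show False using inj[OF xb] by blast
qed

text \<open>
  The translates of the vertices of the circuit under \<open>G\<close> form a set \<open>S\<close> in which every vertex has
  exactly one edge from \<open>L\<close>, and this edge stays in \<open>S\<close>. Following these edges from \<open>r(\<gamma>)\<close> gives an
  infinite path \<open>x\<close> without entry, which an element of the stabilizer of \<open>r(\<gamma>)\<close> has to fix, and \<open>x\<close>
  is isolated in the closure of its orbit.
\<close>

lemma no_entry_stabilizer:
  assumes inj: "\<And>x. x \<in> boundary E \<Longrightarrow> inj_on ep_degree (fiber x)"
    and L: "L \<in> max_tails G E act" and c: "is_G_circuit G E act g \<gamma>" 
    and pv: "path_vertices E \<gamma> \<subseteq> L" and ne: "no_entry E L \<gamma>"
  shows "stabilizer G act (vtx (prng \<gamma>)) = {\<one>\<^bsub>G\<^esub>}"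
proof (rule stabilizer_trivialI)
  have g: "g \<in> carrier G" "\<gamma> \<in> fpaths E" "plen \<gamma> > 0" "psrc E \<gamma> = vact act g (prng \<gamma>)"
    using c by (auto simp: is_G_circuit_def)
  show pg: "prng \<gamma> \<in> verts E" by (rule gph.prng_in[OF g(2)])
  fix h assume h: "h \<in> carrier G" "h \<noteq> \<one>\<^bsub>G\<^esub>" "act h (vtx (prng \<gamma>)) = vtx (prng \<gamma>)"
  have inv: "G_invariant L" by (rule max_tail_invariant[OF L])
  obtain es where es: "snd \<gamma> = es" "es \<noteq> []" using g(3) by (auto simp: plen_def)
  have arcs: "f \<in> arcs E" if "f \<in> set es" for f
    using g(2) that es(1) by (auto simp: fpaths_def)
  have hd0: "head E (hd es) = prng \<gamma>"
    using g(2) es by (auto simp: fpaths_def prng_def)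
  \<comment> \<open>The source of an edge of the circuit is the range of the next edge; after the last edge it is \<open>g\<close> applied to the range of the first one.\<close>
  have nxt: "\<exists>k\<in>carrier G. \<exists>f'\<in>set es. tail E f = vact act k (head E f')" if f: "f \<in> set es" for f
  proof -
    obtain i where i: "i < length es" "es ! i = f" using f by (auto simp: in_set_conv_nth)
    show ?thesis
    proof (cases "Suc i < length es")
      case True
      then have "tail E f = head E (es ! Suc i)" using g(2) es(1) i by (auto simp: fpaths_def)
      then have "tail E f = vact act \<one>\<^bsub>G\<^esub> (head E (es ! Suc i))"
        using arcs[OF nth_mem[OF True]] by simp
      then show ?thesis using True by (intro bexI[of _ "\<one>\<^bsub>G\<^esub>"] bexI[of _ "es ! Suc i"]) simp_all
    next
      case False
      then have "i = length es - 1" using i(1) by simp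
      then have "f = last es" using i es(2) by (simp add: last_conv_nth)
      then have "tail E f = psrc E \<gamma>" using es by (simp add: psrc_def)
      then show ?thesis using g(1,4) hd0 es(2) 
        by (intro bexI[of _ g] bexI[of _ "hd es"]) simp_all
    qed
  qed
  have hL: "head E f \<in> L" "tail E f \<in> L" "card (edges_from E (head E f) L) = 1" if "f \<in> set es" for f
    using pv ne that es(1) by (auto simp: path_vertices_def no_entry_def)
  let ?S = "{vact act k (head E f) |k f. k \<in> carrier G \<and> f \<in> set es}"
  have SL: "w \<in> L \<and> card (edges_from E w L) = 1" if w: "w \<in> ?S" for w
  proof -
    obtain k f where k: "w = vact act k (head E f)" "k \<in> carrier G" "f \<in> set es" using w by blast
    have "head E f \<in> verts E" using arcs[OF k(3)] by simp
    then show ?thesis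
      using edges_from_vact_card(3)[OF k(2) _ inv] hL(1,3)[OF k(3)] inv k(1,2) by (simp add: G_invariant_def)
  qed
  have "vact act \<one>\<^bsub>G\<^esub> (head E (hd es)) = prng \<gamma>" using hd0 pg by simp
  then have pS: "prng \<gamma> \<in> ?S"
    using es(2) by (intro CollectI exI[of _ "\<one>\<^bsub>G\<^esub>"] exI[of _ "hd es"]) simp
  have step: "\<exists>e\<in>arcs E. head E e = w \<and> tail E e \<in> ?S" if w: "w \<in> ?S" for w
  proof -
    obtain k f where k: "w = vact act k (head E f)" "k \<in> carrier G" "f \<in> set es" using w by blast
    obtain k' f' where k': "k' \<in> carrier G" "f' \<in> set es" "tail E f = vact act k' (head E f')"
      using nxt[OF k(3)] by blast
    note a = act_edge[OF k(2) arcs[OF k(3)]]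
    have "tail E (eact k f) = vact act (k \<otimes>\<^bsub>G\<^esub> k') (head E f')"
      using a(4) k' k(2) arcs[OF k'(2)] by (simp add: vact_mult)
    moreover have "k \<otimes>\<^bsub>G\<^esub> k' \<in> carrier G" using k(2) k'(1) by simp
    ultimately have "tail E (eact k f) \<in> ?S" using k'(2) by blast
    then show ?thesis using a(2,3) k(1) by (intro bexI[of _ "eact k f"]) simp_all
  qed
  obtain x where x: "x \<in> inf_paths E" "head E (x 0) = prng \<gamma>" "\<And>n. head E (x n) \<in> ?S"
    using gph.inf_path_exists[OF pS step] by blast
  have xL: "head E (x n) \<in> L" for n using SL[OF x(3)] by blast
  have xn: "inf_no_entry E L x"
    unfolding inf_no_entry_def
  proof
    fix n
    have "x n \<in> edges_from E (head E (x n)) L"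
      using x(1) xL[of "Suc n"] by (simp add: inf_paths_def edges_from_def)
    moreover obtain e where "edges_from E (head E (x n)) L = {e}"
      using SL[OF x(3)] by (metis card_1_singletonE)
    ultimately show "edges_from E (head E (x n)) L = {x n}" by auto
  qed
  have xb: "InfP x \<in> boundary E" using x(1) by (simp add: gph.boundary_InfP)
  have hv: "vact act h (prng \<gamma>) = prng \<gamma>" using h(3) by (simp add: vact_def)
  have "bact E act h (InfP x) \<in> orb_closure (InfP x)"
    using orb_bact[OF orb_refl[OF xb] h(1)] orb_subset_closure by blast
  moreover have "brng E (bact E act h (InfP x)) = head E (x 0)"
    using brng_bact[OF h(1) xb] x(2) hv by simp
  ultimately have hx: "bact E act h (InfP x) = InfP x"
    by (rule no_entry_closure[OF L x(1) xL xn])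
  have "\<not> inj_on ep_degree (fiber (InfP x))"
  proof (rule not_inj_fiber[OF xb h(1,2) hx finite.emptyI])
    fix z assume z: "z \<in> boundary E" "brng E z = brng E (InfP x)" "bact E act h z \<in> orb_closure (InfP x)"
    have "brng E (bact E act h z) = head E (x 0)" using brng_bact[OF h(1) z(1)] z(2) x(2) hv by simp
    then have e: "bact E act h z = InfP x" by (rule no_entry_closure[OF L x(1) xL xn z(3)])
    then have "bact E act h z = bact E act h (InfP x)" using hx by simp
    then have "z = InfP x" using bact_inv(1)[OF h(1)] z(1) xb by metis
    then show "bact E act h z = z" using hx by simp
  qed simp
  then show False using inj[OF xb] by blast
qed

text \<open>
  An element that acts trivially on the paths from \<open>v\<close> into \<open>M\<close> fixes every boundary path from \<open>v\<close>
  with vertices in \<open>M\<close>. The closure of the orbit of one such path consists of paths with vertices in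
  \<open>M\<close>.
\<close>

lemma tail_acts_faithfully:
  assumes inj: "\<And>x. x \<in> boundary E \<Longrightarrow> inj_on ep_degree (fiber x)"
    and M: "M \<in> max_tails G E act" and v: "v \<in> M" 
    and h: "h \<in> carrier G" "\<And>\<mu>. \<mu> \<in> paths_from E v M \<Longrightarrow> act h \<mu> = \<mu>"
  shows "h = \<one>\<^bsub>G\<^esub>"
proof (rule ccontr)
  assume ne: "h \<noteq> \<one>\<^bsub>G\<^esub>"
  have vv: "v \<in> verts E" using v max_tailsD(1)[OF M] by blast
  obtain x where x: "x \<in> boundary E" "brng E x = v" "\<And>n. psrc E (bseg E x n) \<in> M"
    using boundary_path_in_tail[OF M v] by blast
  have sub: "ptail x \<subseteq> M" by (rule ptail_subset[OF M x(1) x(3)])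
  have seg: "act h (bseg E z n) = bseg E z n" 
    if "z \<in> boundary E" "brng E z = v" "\<And>n. psrc E (bseg E z n) \<in> M" for z n
    using h(2)[of "bseg E z n"] gph.bseg_in[OF that(1)] that(2,3) by (simp add: paths_from_def)
  have hx: "bact E act h x = x"
    by (rule bseg_ext[of E]) (simp add: bseg_bact[OF h(1) x(1)] seg[OF x])
  have hv: "vact act h v = v" using brng_bact[OF h(1) x(1)] hx x(2) by simp
  have "\<not> inj_on ep_degree (fiber x)"
  proof (rule not_inj_fiber[OF x(1) h(1) ne hx finite.emptyI])
    fix z assume z: "z \<in> boundary E" "brng E z = brng E x" "bact E act h z \<in> orb_closure x"
    have b: "bact E act h z \<in> boundary E" "brng E (bact E act h z) = v"
      using h(1) z(1,2) x(2) hv by simp_all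
    have "psrc E (bseg E (bact E act h z) n) \<in> M" for n using closure_vertices[OF z(3)] sub by blast
    note s = seg[OF b this]
    have "bact E act h (bact E act h z) = bact E act h z"
      by (rule bseg_ext[of E]) (simp only: bseg_bact[OF h(1) b(1)] s)
    then show "bact E act h z = z" using bact_inv(1)[OF h(1)] z(1) b(1) by metis
  qed simp
  then show False using inj[OF x(1)] by blast
qed

section \<open>Sufficiency of the conditions\<close>

text \<open>
  By \<open>acts_trivially\<close>, \<open>h\<close> is trivial on the paths from the range of \<open>p\<close> into the maximal tail of
  \<open>p\<close>, so this tail has to be one with a non-aperiodic path \<open>y\<close> without entry. A common lower bound
  of the range of \<open>p\<close> and of a vertex in the periodic part of \<open>y\<close> lies on \<open>y\<close> up to translation; there
  \<open>y\<close> contains a \<open>G\<close>-circuit, and a conjugate of a restriction of \<open>h\<close> stabilizes its range.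
\<close>

lemma no_infinite_fixing_element:
  assumes circ: "\<And>L g \<gamma>. \<lbrakk>L \<in> tails_L G E act; is_G_circuit G E act g \<gamma>; path_vertices E \<gamma> \<subseteq> L; no_entry E L \<gamma>\<rbrakk>
      \<Longrightarrow> stabilizer G act (vtx (prng \<gamma>)) = {\<one>\<^bsub>G\<^esub>}"
    and faith: "\<And>M v g. \<lbrakk>M \<in> tails_inf G E act; v \<in> M; g \<in> carrier G; \<forall>\<mu>\<in>paths_from E v M. act g \<mu> = \<mu>\<rbrakk> \<Longrightarrow> g = \<one>\<^bsub>G\<^esub>"
    and p: "p \<in> inf_paths E" and h: "h \<in> carrier G" "h \<noteq> \<one>\<^bsub>G\<^esub>"
      "\<And>z. z \<in> orb (InfP p) \<Longrightarrow> brng E z = head E (p 0) \<Longrightarrow> bact E act h z = z"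
  shows False
proof -
  let ?M = "ptail (InfP p)" and ?v = "head E (p 0)"
  have pb: "InfP p \<in> boundary E" using p by (simp add: gph.boundary_InfP)
  have M: "?M \<in> max_tails G E act" by (rule ptail_max_tail[OF pb])
  note MD = max_tailsD[OF M]
  have v: "?v \<in> ?M" using brng_ptail[OF orb_refl[OF pb]] by simp
  have triv: "act h \<mu> = \<mu>" if "\<mu> \<in> paths_from E ?v ?M" for \<mu>
    by (rule acts_trivially[OF h(1,3) that])
  have "edges_from E u ?M \<noteq> {}" if u: "u \<in> ?M" for u
  proof -
    obtain y where y: "y \<in> orb (InfP p)" "brng E y = u" by (rule ptailE[OF u])
    obtain q where q: "y = InfP q" by (rule orb_InfP[OF y(1)])
    have "q \<in> inf_paths E" using orb_boundary[OF y(1)] q by (simp add: gph.boundary_InfP)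
    moreover have "tail E (q 0) \<in> ?M" using ptail_vertices[OF y(1), of 1] q by (simp add: psrc_def)
    ultimately have "q 0 \<in> edges_from E u ?M" using y(2) q by (simp add: edges_from_def inf_paths_def)
    then show ?thesis by blast
  qed
  then have n0: "?M \<notin> tails_0 G E act" unfolding tails_0_def minimal_in_def by blast
  show False
  proof (cases "?M \<in> tails_L G E act")
    case False
    then have "?M \<in> tails_inf G E act" using n0 M by (simp add: tails_inf_def tails_gamma_def)
    then show False using faith[OF _ v h(1)] triv h(2) by blast
  next
    case True
    then obtain y where y: "y \<in> inf_paths E" "InfP y \<notin> aperiodic G E act" 
      "\<And>n. head E (y n) \<in> ?M" "inf_no_entry E ?M y"
      unfolding tails_L_def by blast
    obtain g n m where g: "g \<in> carrier G" "m < n" 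
      "\<forall>j. head E (y (n + j)) = vact act g (head E (y (m + j)))"
      by (rule periodic_vertices[OF y(1,2)])
    obtain k u where u: "k \<in> carrier G" "u \<in> ?M" "vge E ?v u" "vge E (head E (y m)) (vact act k u)"
      using MD(5)[OF v y(3)] by blast
    have uv: "u \<in> verts E" using u(2) MD(1) by blast
    obtain \<beta> where b: "\<beta> \<in> fpaths E" "prng \<beta> = head E (y m)" "psrc E \<beta> = vact act k u"
      by (rule gph.vgeE[OF u(4)])
    have "psrc E \<beta> \<in> ?M" using b(3) u(1,2) MD(2) by simp
    from gph.no_entry_path[OF y(4,1) MD(3) b(1,2) this]
    have ku: "vact act k u = head E (y (m + plen \<beta>))" using b(3) by simp
    define i where "i = m + plen \<beta>"
    define d where "d = n - m"
    have d: "d > 0" using g(2) by (simp add: d_def)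
    \<comment> \<open>One period of \<open>y\<close>, starting at the vertex \<open>k \<cdot> u\<close>; the same \<open>g\<close> relates the vertices of \<open>y\<close> at distance \<open>d\<close> at all later positions.\<close>
    let ?\<gamma> = "(head E (y i), map y [i..<i + d])"
    have per: "head E (y (i + d)) = vact act g (head E (y i))"
      using g(3)[rule_format, of "plen \<beta>"] g(2) by (simp add: i_def d_def add.commute add.left_commute)
    have e: "y j \<in> arcs E" "tail E (y j) = head E (y (Suc j))" for j
      using y(1) unfolding inf_paths_def by blast+
    have gp: "(head E (y i), map y [i..<i + d]) \<in> fpaths E \<and> psrc E (head E (y i), map y [i..<i + d]) = head E (y (i + d))" for i d
    proof (induction d)
      case 0
      show ?case using e(1) by (simp add: gph.fpaths_Nil psrc_def)
    next
      case (Suc d)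
      have "(head E (y (i + d)), [y (i + d)]) \<in> fpaths E" by (rule gph.edge_path(1)[OF e(1)])
      then show ?case using Suc e(2)[of "i + d"] by (simp add: gph.fpaths_append psrc_def)
    qed
    have circuit: "is_G_circuit G E act g ?\<gamma>"
      using gp[of i d] per g(1) d by (simp add: is_G_circuit_def prng_def plen_def)
    have sub: "path_vertices E ?\<gamma> \<subseteq> range (\<lambda>j. head E (y j))"
      using e(2) by (auto simp: path_vertices_def prng_def)
    then have "path_vertices E ?\<gamma> \<subseteq> ?M" using y(3) by blast
    moreover have "no_entry E ?M ?\<gamma>"
      unfolding no_entry_def
    proof
      fix w assume "w \<in> path_vertices E ?\<gamma>"
      then obtain j where "w = head E (y j)" using sub by blast
      then show "card (edges_from E w ?M) = 1" using y(4) by (simp add: inf_no_entry_def)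
    qed
    ultimately have st: "stabilizer G act (vtx (vact act k u)) = {\<one>\<^bsub>G\<^esub>}"
      using circ[OF True circuit] ku by (simp add: prng_def i_def)
    obtain \<mu> where m: "\<mu> \<in> fpaths E" "prng \<mu> = ?v" "psrc E \<mu> = u"
      by (rule gph.vgeE[OF u(3)])
    have hm: "act h \<mu> = \<mu>" using triv[of \<mu>] m u(2) by (simp add: paths_from_def)
    let ?r = "res h \<mu>"
    have r: "?r \<in> carrier G" "?r \<noteq> \<one>\<^bsub>G\<^esub>" 
      using res_closed[OF h(1) m(1)] res_ne_one[OF h(1) m(1) hm h(2)] by blast+
    have ru: "vact act ?r u = u" using vact_res[OF h(1) m(1)] psrc_act[OF h(1) m(1)] m(3) hm by simp
    \<comment> \<open>\<open>?r\<close> fixes \<open>u\<close>, so its conjugate fixes the range \<open>k \<cdot> u\<close> of the circuit.\<close>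
    let ?c = "k \<otimes>\<^bsub>G\<^esub> ?r \<otimes>\<^bsub>G\<^esub> inv\<^bsub>G\<^esub> k"
    have c: "?c \<in> carrier G" using u(1) r by simp
    have "vact act ?c (vact act k u) = vact act k u" using u(1) r uv ru by (simp add: vact_mult)
    then have "act ?c (vtx (vact act k u)) = vtx (vact act k u)" using act_vtx c u(1) uv by simp
    then have "?c = \<one>\<^bsub>G\<^esub>" by (rule stabilizer_trivialD[OF st c])
    then have "k \<otimes>\<^bsub>G\<^esub> ?r = k" using grp.inv_solve_right[of "\<one>\<^bsub>G\<^esub>" "k \<otimes>\<^bsub>G\<^esub> ?r" k] u(1) r by simp
    then have "?r = \<one>\<^bsub>G\<^esub>" using grp.r_cancel_one[of k ?r] u(1) r by simp
    then show False using r(2) by blast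
  qed
qed

text \<open>
  Only the case of infinitely many edges from the tail of \<open>v\<close> to \<open>v\<close> needs work. An edge outside \<open>D\<close>
  can be continued to a path \<open>\<alpha>\<close> from \<open>v\<close> to some \<open>g \<cdot> v\<close>. All orbit elements that begin with \<open>\<alpha>\<close>
  are fixed by \<open>h\<close>, so the restriction of \<open>h\<close> to \<open>\<alpha>\<close> fixes all orbit elements at \<open>g \<cdot> v\<close>.
\<close>

lemma no_singular_fixing_element:
  assumes sing: "\<And>v. v \<in> breaking_vertices G E act res \<union> singular_0 G E act res \<Longrightarrow>
      stabilizer G act (vtx v) = {\<one>\<^bsub>G\<^esub>}"
    and faith: "\<And>M v g. \<lbrakk>M \<in> tails_inf G E act; v \<in> M; g \<in> carrier G; \<forall>\<mu>\<in>paths_from E v M. act g \<mu> = \<mu>\<rbrakk> \<Longrightarrow> g = \<one>\<^bsub>G\<^esub>"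
    and v: "v \<in> singular E" and h: "h \<in> carrier G" "h \<noteq> \<one>\<^bsub>G\<^esub>" and D: "finite D"
    and fixes_orb: "\<And>z. z \<in> orb (FinP (vtx v)) \<Longrightarrow> brng E z = v \<Longrightarrow> set (snd (bseg E z 1)) \<inter> D = {} \<Longrightarrow> bact E act h z = z"
  shows False
proof -
  let ?x = "FinP (vtx v) :: ('v, 'e) bpath"
  let ?M = "ptail ?x"
  have vv: "v \<in> verts E" using v by (simp add: singular_def)
  have xb: "?x \<in> boundary E" using v vv by (simp add: gph.boundary_FinP)
  have M: "?M \<in> max_tails G E act" by (rule ptail_max_tail[OF xb])
  note MD = max_tailsD[OF M]
  have inv: "G_invariant ?M" by (rule max_tail_invariant[OF M])
  have "bact E act h ?x = ?x" by (rule fixes_orb[OF orb_refl[OF xb]]) simp_all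
  then have hv: "act h (vtx v) = vtx v" by simp
  have "infinite (edges_from E v ?M)"
  proof
    assume fin: "finite (edges_from E v ?M)"
    then have "v \<in> breaking_vertices G E act res \<union> singular_0 G E act res"
      using v by (auto simp: breaking_vertices_def singular_0_def card_gt_0_iff)
    then show False using stabilizer_trivialD[OF sing h(1) hv] h(2) by blast
  qed
  then have ninf: "infinite (edges_from E (vact act k v) ?M)" if "k \<in> carrier G" for k
    using edges_from_vact_card(2)[OF that vv inv] by simp
  then have "infinite (edges_from E v ?M - D)" using \<open>infinite (edges_from E v ?M)\<close> D by simp
  then obtain e where e: "e \<in> edges_from E v ?M" "e \<notin> D"
    by (metis Diff_iff finite.emptyI ex_in_conv)
  then have e': "e \<in> arcs E" "head E e = v" "tail E e \<in> ?M" by (auto simp: edges_from_def)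
  obtain g where g: "g \<in> carrier G" "vge E (tail E e) (vact act g v)" by (rule ptail_vertex[OF vv e'(3)])
  obtain \<beta> where b: "\<beta> \<in> fpaths E" "prng \<beta> = tail E e" "psrc E \<beta> = vact act g v"
    by (rule gph.vgeE[OF g(2)])
  let ?u = "vact act g v"
  let ?\<alpha> = "pcat (v, [e]) \<beta>"
  have ep: "(v, [e]) \<in> fpaths E" "psrc E (v, [e]) = prng \<beta>"
    using gph.edge_path(1)[OF e'(1)] gph.edge_path(2)[OF e'(1), of v] e'(2) b(2) by simp_all
  have a: "?\<alpha> \<in> fpaths E" "psrc E ?\<alpha> = ?u" "prng ?\<alpha> = v" "plen ?\<alpha> = Suc (plen \<beta>)"
    using gph.pcat_in[OF ep(1) b(1) ep(2)] psrc_pcat[OF ep(2)] b(3) by (simp_all add: prng_def plen_def)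
  have fixed: "bact E act h (bcat ?\<alpha> z) = bcat ?\<alpha> z" if z: "z \<in> orb ?x" "brng E z = ?u" for z
  proof (rule fixes_orb)
    have s: "psrc E ?\<alpha> = brng E z" using a(2) z(2) by simp
    show "bcat ?\<alpha> z \<in> orb ?x" by (rule orb_bcat[OF z(1) a(1) s])
    show "brng E (bcat ?\<alpha> z) = v" unfolding gph.brng_bcat[OF a(1) s] by (rule a(3))
    have "1 \<le> plen ?\<alpha>" using a(4) by simp
    from gph.bseg_bcat_le[OF a(1) s this] have "snd (bseg E (bcat ?\<alpha> z) 1) = [e]" by simp
    then show "set (snd (bseg E (bcat ?\<alpha> z) 1)) \<inter> D = {}" using e(2) by simp
  qed
  let ?r = "res h ?\<alpha>"
  have gx: "bact E act g ?x \<in> orb ?x" "brng E (bact E act g ?x) = ?u"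
    using orb_bact[OF orb_refl[OF xb] g(1)] brng_bact[OF g(1) xb] by simp_all
  have s: "psrc E ?\<alpha> = brng E (bact E act g ?x)" using a(2) gx(2) by simp
  have ha: "act h ?\<alpha> = ?\<alpha>"
    by (rule bact_bcat_fixed(1)[OF h(1) a(1) orb_boundary[OF gx(1)] s fixed[OF gx]])
  have r: "?r \<in> carrier G" "?r \<noteq> \<one>\<^bsub>G\<^esub>" 
    using res_closed[OF h(1) a(1)] res_ne_one[OF h(1) a(1) ha h(2)] by blast+
  have rfix: "bact E act ?r z = z" if z: "z \<in> orb ?x" "brng E z = ?u" for z
  proof -
    have s: "psrc E ?\<alpha> = brng E z" using a(2) z(2) by simp
    show ?thesis by (rule bact_bcat_fixed(2)[OF h(1) a(1) orb_boundary[OF z(1)] s fixed[OF z]])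
  qed
  have triv: "act ?r \<mu> = \<mu>" if "\<mu> \<in> paths_from E ?u ?M" for \<mu>
    by (rule acts_trivially[OF r(1) rfix that])
  have uM: "?u \<in> ?M" using brng_ptail[OF gx(1)] gx(2) by simp
  \<comment> \<open>Every vertex of \<open>?M\<close> reaches a translate of \<open>v\<close>, and translates of \<open>v\<close> receive infinitely many edges from \<open>?M\<close>.\<close>
  have "edges_from E w ?M \<noteq> {}" if w: "w \<in> ?M" for w
  proof -
    obtain k where k: "k \<in> carrier G" "vge E w (vact act k v)" by (rule ptail_vertex[OF vv w])
    obtain \<mu> where m: "\<mu> \<in> fpaths E" "prng \<mu> = w" "psrc E \<mu> = vact act k v" by (rule gph.vgeE[OF k(2)])
    have kM: "vact act k v \<in> ?M" using MD(2) k(1) brng_ptail[OF orb_refl[OF xb]] by simp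
    show ?thesis
    proof (cases \<mu>)
      case (Pair w' es)
      show ?thesis
      proof (cases es)
        case Nil
        then have "w = vact act k v" using m Pair by (simp add: psrc_def prng_def)
        then show ?thesis using ninf[OF k(1)] by auto
      next
        case (Cons f fs)
        have f: "f \<in> arcs E" "head E f = w" "(tail E f, fs) \<in> fpaths E"
          using m(1,2) Pair Cons by (simp_all add: gph.fpaths_Cons prng_def)
        have "psrc E (tail E f, fs) = vact act k v" using m(3) Pair Cons by (simp add: psrc_Cons)
        then have "vge E (tail E f) (vact act k v)" using gph.vgeI[OF f(3)] by (simp add: prng_def)
        then have "tail E f \<in> ?M" using MD(3) kM by blast
        then show ?thesis using f by (auto simp: edges_from_def)
      qed
    qed
  qed
  then have n0: "?M \<notin> tails_0 G E act" unfolding tails_0_def minimal_in_def by blast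
  have nL: "?M \<notin> tails_L G E act"
  proof
    assume "?M \<in> tails_L G E act"
    then obtain y where y: "y \<in> inf_paths E" "\<And>n. head E (y n) \<in> ?M" "inf_no_entry E ?M y"
      unfolding tails_L_def by blast
    obtain k where k: "k \<in> carrier G" "vge E (head E (y 0)) (vact act k v)" 
      by (rule ptail_vertex[OF vv y(2)])
    obtain \<mu> where m: "\<mu> \<in> fpaths E" "prng \<mu> = head E (y 0)" "psrc E \<mu> = vact act k v" 
      by (rule gph.vgeE[OF k(2)])
    have "psrc E \<mu> \<in> ?M" using m(3) MD(2) k(1) brng_ptail[OF orb_refl[OF xb]] by simp
    from gph.no_entry_path[OF y(3,1) MD(3) m(1,2) this] 
    have "vact act k v = head E (y (plen \<mu>))" using m(3) by simp
    then have "edges_from E (vact act k v) ?M = {y (plen \<mu>)}" using y(3) by (simp add: inf_no_entry_def)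
    then show False using ninf[OF k(1)] by simp
  qed
  have "?M \<in> tails_inf G E act" using n0 nL M by (simp add: tails_inf_def tails_gamma_def)
  then show False using faith[OF _ uM r(1)] triv r(2) by blast
qed

end

theorem proposition4p26:
  fixes G :: "('g, 'm) monoid_scheme"
    and E :: "('v, 'e) pre_digraph"
    and act :: "'g \<Rightarrow> ('v, 'e) path \<Rightarrow> ('v, 'e) path"
    and res :: "'g \<Rightarrow> ('v, 'e) path \<Rightarrow> 'g"
  assumes "self_similar_graph G E act res"
    and "pseudo_free G E act res"
    and "countable_ssg G E"
  shows "essentially_central_isotropy integer_group (ep_groupoid G E act res) ep_degree \<longleftrightarrow>
    (\<forall>v \<in> breaking_vertices G E act res \<union> singular_0 G E act res.
       stabilizer G act (vtx v) = {\<one>\<^bsub>G\<^esub>}) \<and>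
    (\<forall>L \<in> tails_L G E act. \<forall>g \<gamma>.
       is_G_circuit G E act g \<gamma> \<and> path_vertices E \<gamma> \<subseteq> L \<and> no_entry E L \<gamma> \<longrightarrow>
       stabilizer G act (vtx (prng \<gamma>)) = {\<one>\<^bsub>G\<^esub>}) \<and>
    (\<forall>M \<in> tails_inf G E act. \<forall>v \<in> M.
       \<not> (\<exists>g \<in> carrier G. g \<noteq> \<one>\<^bsub>G\<^esub> \<and> (\<forall>\<mu> \<in> paths_from E v M. act g \<mu> = \<mu>)))"
    (is "?eci \<longleftrightarrow> ?i \<and> ?ii \<and> ?iii")
proof -
  interpret pseudo_free_ssg G E act res
    using assms(1,2) by (intro pseudo_free_ssg.intro pseudo_free_ssg_axioms.intro)
  show ?thesis
  proof (intro iffI conjI)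
    assume ?eci
    then have inj: "\<And>x. x \<in> boundary E \<Longrightarrow> inj_on ep_degree (fiber x)" unfolding eci_iff by blast
    show ?i
    proof
      fix v assume v: "v \<in> breaking_vertices G E act res \<union> singular_0 G E act res"
      then have "v \<in> singular E" "finite (edges_from E v (ptail (FinP (vtx v))))"
        by (auto simp: breaking_vertices_def singular_0_def)
      with inj show "stabilizer G act (vtx v) = {\<one>\<^bsub>G\<^esub>}" by (rule breaking_stabilizer)
    qed
    show ?ii
    proof (intro ballI allI impI, elim conjE)
      fix L g \<gamma> assume "L \<in> tails_L G E act" and c: "is_G_circuit G E act g \<gamma>" 
        "path_vertices E \<gamma> \<subseteq> L" "no_entry E L \<gamma>"
      then have "L \<in> max_tails G E act" by (simp add: tails_L_def)
      with inj show "stabilizer G act (vtx (prng \<gamma>)) = {\<one>\<^bsub>G\<^esub>}" using c by (rule no_entry_stabilizer)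
    qed
    show ?iii
    proof (intro ballI notI, elim bexE conjE)
      fix M v g assume "M \<in> tails_inf G E act" and v: "v \<in> M" "g \<in> carrier G" "g \<noteq> \<one>\<^bsub>G\<^esub>" 
        "\<forall>\<mu>\<in>paths_from E v M. act g \<mu> = \<mu>"
      then have "M \<in> max_tails G E act" by (simp add: tails_inf_def tails_gamma_def)
      then show False using tail_acts_faithfully[OF inj _ v(1,2)] v(3,4) by blast
    qed
  next
    assume c: "?i \<and> ?ii \<and> ?iii"
    have sing: "\<And>v. v \<in> breaking_vertices G E act res \<union> singular_0 G E act res \<Longrightarrow>
        stabilizer G act (vtx v) = {\<one>\<^bsub>G\<^esub>}"
      using conjunct1[OF c] by blast
    have circ: "\<And>L g \<gamma>. \<lbrakk>L \<in> tails_L G E act; is_G_circuit G E act g \<gamma>; path_vertices E \<gamma> \<subseteq> L; 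
        no_entry E L \<gamma>\<rbrakk> \<Longrightarrow> stabilizer G act (vtx (prng \<gamma>)) = {\<one>\<^bsub>G\<^esub>}"
      using conjunct1[OF conjunct2[OF c]] by blast
    have faith: "\<And>M v g. \<lbrakk>M \<in> tails_inf G E act; v \<in> M; g \<in> carrier G; 
        \<forall>\<mu>\<in>paths_from E v M. act g \<mu> = \<mu>\<rbrakk> \<Longrightarrow> g = \<one>\<^bsub>G\<^esub>"
      using conjunct2[OF conjunct2[OF c]] by blast
    show ?eci
      unfolding eci_iff
    proof (intro ballI, rule ccontr)
      fix x assume x: "x \<in> boundary E" "\<not> inj_on ep_degree (fiber x)"
      show False
        using x
      proof (cases rule: fixing_element_cases)
        case (infinite p h)
        with circ faith show ?thesis by (rule no_infinite_fixing_element)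
      next
        case (singular v h D)
        with sing faith show ?thesis by (rule no_singular_fixing_element)
      qed
    qed
  qed
qed

end
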